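(* Let $p$ be an odd prime, $n\ge2$, and let $\eta$ be trivial or $\left(\frac{\cdot}{p}\right)$. The representation $I(n)$ of $\overline K$ is the direct sum of the $2n$ irreducible representations $$S_1=\mathrm{Span}(\pi_R(\overline K)u_1),\quad S_2=\mathrm{Span}(\pi_R(\overline K)u_2),\quad T_k=\mathrm{Span}(\pi_R(\overline K)v_k),\quad T_k'=\mathrm{Span}(\pi_R(\overline K)v_k')\quad(1\le k\le n-1),$$ with $\dim T_k=\dim T'_k=p^{k-1}\frac{p^2-1}{2}$ for $1\le k\le n-1$, and $\dim S_1=1$, $\dim S_2=p$ if $\eta$ is trivial, while $\dim S_1=\dim S_2=\frac{p+1}{2}$ if $\eta=\left(\frac{\cdot}{p}\right)$.
   Context: $K=\mathrm{SL}_2(\mathbb Z_p)$, $K_n=K_0(p^n)=\{\begin{pmatrix}a&b\\ c&d\end{pmatrix}\in K:c\in p^n\mathbb Z_p\}$. $\widetilde G$ is the metaplectic double cover of $\mathrm{SL}_2(\mathbb Q_p)$ and $\overline S$ the full inverse image of a subgroup $S$; since $p$ is odd the cover splits over $K$ and one identifies $\overline K=K\times\{\pm1\}$, $\overline{K_n}=K_n\times\{\pm1\}$. $\eta$ defines the character $\begin{pmatrix}a&b\\ c&d\end{pmatrix}\mapsto\eta(d)$ of $K_n$ and the genuine character $\eta((A,\epsilon))=\epsilon\eta(A)$ of $\overline{K_n}$. $I(n)=\mathrm{Ind}_{\overline{K_n}}^{\overline K}\overline\eta$ is the space of locally constant $\phi:\overline K\to\mathbb C$ with $\phi(k_0k)=\overline\eta(k_0)\phi(k)$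 for $k_0\in\overline{K_n}$, and $\pi_R$ is the action of $\overline K$ on it by right translation. $H=H(\overline K//\overline{K_n},\eta)$ is the space of functions $f$ on $\overline K$ with $f(kgk')=\overline\eta(k)\overline\eta(k')f(g)$ for $k,k'\in\overline{K_n}$; it is a subspace of $I(n)$. Put $y(s)=\begin{pmatrix}1&0\\ s&1\end{pmatrix}$, $w(1)=\begin{pmatrix}0&1\\ -1&0\end{pmatrix}$, and let $\lambda\in\mathbb Z_p^\times$ be a nonsquare mod $p$. $\mathcal I,\mathcal U_0,\mathcal V_{r,a}$ ($1\le r\le n-1$, $a\in\{1,\lambda\}$) are the elements of $H$ supported on the $\overline{K_n}$-double cosets of $(I,1),(w(1),1),(y(ap^r),1)$ with value $1$ at that representative. $\mathcal V_r=\mathcal V_{r,1}+\mathcal V_{r,\lambda}$, $\mathcal W_r=\mathcal V_{r,1}-\mathcal V_{r,\lambda}$, $\mathcal Y_r=\mathcal I+\sum_{j=r}^{n-1}\mathcal V_j$, $\mathcal Y_n=\mathcal I$. Put $p^*=\left(\frac{-1}{p}\right)p$ and fix a square root $\sqrt{p^*}$. The vectors are: if $\eta=1$, $u_1=\mathcal U_0+\mathcal Y_1$, $u_2=\mathcal U_0-p\mathcal Y_1$; if $\eta\neq1$, $u_1=\mathcal U_0+\sqrt{p^*}\,\mathcal Y_1$, $u_2=\mathcal U_0-\sqrt{p^*}\,\mathcal Y_1$; in both cases, for $1\le k\le n-1$, $v_k=p\mathcal Y_{k+1}-\mathcal Y_k+\frac{p}{\sqrt{p^*}}\mathcal W_k$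 and $v'_k=p\mathcal Y_{k+1}-\mathcal Y_k-\frac{p}{\sqrt{p^*}}\mathcal W_k$. *)

theory Defs
  imports
    "HOL-Analysis.Analysis"
    "HOL-Algebra.Algebra"
    "HOL-Number_Theory.Number_Theory"
    "HOL-Library.Function_Algebras"
begin

section \<open>The ring of p-adic integers\<close>

text \<open>A p-adic integer is the coherent sequence of its residues modulo \<open>p ^ k\<close>
  (inverse limit of the rings of integers modulo \<open>p ^ k\<close>). The instance topology of
  \<^typ>\<open>nat \<Rightarrow> int\<close>, a product of discrete spaces, induces the p-adic topology on the carrier.\<close>

type_synonym padic = "nat \<Rightarrow> int"

definition Zp :: "nat \<Rightarrow> padic ring" where
  "Zp p = \<lparr>carrier = {x. \<forall>k. x k \<in> {0..<int p ^ k} \<and> x (Suc k) mod int p ^ k = x k},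
           monoid.mult = (\<lambda>x y k. (x k * y k) mod int p ^ k),
           one = (\<lambda>k. 1 mod int p ^ k),
           ring.zero = (\<lambda>k. 0),
           ring.add = (\<lambda>x y k. (x k + y k) mod int p ^ k)\<rparr>"

definition Zp_of_int :: "nat \<Rightarrow> int \<Rightarrow> padic" where
  "Zp_of_int p m = (\<lambda>k. m mod int p ^ k)"

lemma Zp_cring:
  assumes "p > 0"
  shows "cring (Zp p)"
proof -
  have pp: "int p ^ k > 0" for k using assms by simp
  have coh: "(\<lambda>k. f k mod int p ^ k) \<in> carrier (Zp p)"
    if "\<And>k. f (Suc k) mod int p ^ k = f k mod int p ^ k" for f
    using that pp by (simp add: Zp_def mod_mod_cancel)
  have sub: "x (Suc k) mod int p ^ k = x k mod int p ^ k" if "x \<in> carrier (Zp p)" for x k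
    using that by (simp add: Zp_def)
  have nrm: "x k mod int p ^ k = x k" if "x \<in> carrier (Zp p)" for x k
    using that by (simp add: Zp_def)
  have add_cl: "x \<oplus>\<^bsub>Zp p\<^esub> y \<in> carrier (Zp p)"
    if "x \<in> carrier (Zp p)" "y \<in> carrier (Zp p)" for x y
  proof -
    have "(\<lambda>k. (x k + y k) mod int p ^ k) \<in> carrier (Zp p)"
      by (rule coh, rule mod_add_cong) (rule sub, fact)+
    then show ?thesis by (simp add: Zp_def)
  qed
  have mul_cl: "x \<otimes>\<^bsub>Zp p\<^esub> y \<in> carrier (Zp p)"
    if "x \<in> carrier (Zp p)" "y \<in> carrier (Zp p)" for x y
  proof -
    have "(\<lambda>k. (x k * y k) mod int p ^ k) \<in> carrier (Zp p)"
      by (rule coh, rule mod_mult_cong) (rule sub, fact)+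
    then show ?thesis by (simp add: Zp_def)
  qed
  have one_cl: "\<one>\<^bsub>Zp p\<^esub> \<in> carrier (Zp p)" using coh[of "\<lambda>k. 1"] by (simp add: Zp_def)
  have zero_cl: "\<zero>\<^bsub>Zp p\<^esub> \<in> carrier (Zp p)" using pp by (simp add: Zp_def)
  have neg: "\<exists>y\<in>carrier (Zp p). y \<oplus>\<^bsub>Zp p\<^esub> x = \<zero>\<^bsub>Zp p\<^esub>" if x: "x \<in> carrier (Zp p)" for x
  proof
    show "(\<lambda>k. (- x k) mod int p ^ k) \<in> carrier (Zp p)"
      by (rule coh) (metis mod_minus_eq sub x)
    show "(\<lambda>k. (- x k) mod int p ^ k) \<oplus>\<^bsub>Zp p\<^esub> x = \<zero>\<^bsub>Zp p\<^esub>"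
      by (simp add: Zp_def mod_add_left_eq)
  qed
  have ag: "abelian_group (Zp p)"
  proof (rule abelian_groupI)
    fix x y z assume "x \<in> carrier (Zp p)" "y \<in> carrier (Zp p)" "z \<in> carrier (Zp p)"
    show "x \<oplus>\<^bsub>Zp p\<^esub> y \<oplus>\<^bsub>Zp p\<^esub> z = x \<oplus>\<^bsub>Zp p\<^esub> (y \<oplus>\<^bsub>Zp p\<^esub> z)"
      by (simp add: Zp_def mod_simps add.assoc)
  next
    fix x y show "x \<oplus>\<^bsub>Zp p\<^esub> y = y \<oplus>\<^bsub>Zp p\<^esub> x" by (simp add: Zp_def add.commute)
  next
    fix x assume "x \<in> carrier (Zp p)"
    then show "\<zero>\<^bsub>Zp p\<^esub> \<oplus>\<^bsub>Zp p\<^esub> x = x" using nrm[of x] by (simp add: Zp_def)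
  qed (use add_cl zero_cl neg in auto)
  have cm: "Group.comm_monoid (Zp p)"
  proof (rule comm_monoidI)
    fix x y z assume "x \<in> carrier (Zp p)" "y \<in> carrier (Zp p)" "z \<in> carrier (Zp p)"
    show "x \<otimes>\<^bsub>Zp p\<^esub> y \<otimes>\<^bsub>Zp p\<^esub> z = x \<otimes>\<^bsub>Zp p\<^esub> (y \<otimes>\<^bsub>Zp p\<^esub> z)"
      by (simp add: Zp_def mod_simps mult.assoc)
  next
    fix x y show "x \<otimes>\<^bsub>Zp p\<^esub> y = y \<otimes>\<^bsub>Zp p\<^esub> x" by (simp add: Zp_def mult.commute)
  next
    fix x assume "x \<in> carrier (Zp p)"
    then show "\<one>\<^bsub>Zp p\<^esub> \<otimes>\<^bsub>Zp p\<^esub> x = x" using nrm[of x] by (simp add: Zp_def mod_simps)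
  qed (use mul_cl one_cl in auto)
  show ?thesis
  proof (rule cringI[OF ag cm])
    fix x y z
    show "(x \<oplus>\<^bsub>Zp p\<^esub> y) \<otimes>\<^bsub>Zp p\<^esub> z = x \<otimes>\<^bsub>Zp p\<^esub> z \<oplus>\<^bsub>Zp p\<^esub> y \<otimes>\<^bsub>Zp p\<^esub> z"
      by (simp add: Zp_def mod_simps distrib_right)
  qed
qed

section \<open>The groups\<close>

text \<open>The tuple \<open>(a, b, c, d)\<close> is the matrix with rows \<open>(a, b)\<close> and \<open>(c, d)\<close>.\<close>

type_synonym 'a mat2 = "'a \<times> 'a \<times> 'a \<times> 'a"

definition SL2 :: "('a, 'm) ring_scheme \<Rightarrow> 'a mat2 monoid" where
  "SL2 R = \<lparr>carrier = {(a, b, c, d). a \<in> carrier R \<and> b \<in> carrier R \<and> c \<in> carrier R \<and>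
                         d \<in> carrier R \<and> a \<otimes>\<^bsub>R\<^esub> d \<ominus>\<^bsub>R\<^esub> b \<otimes>\<^bsub>R\<^esub> c = \<one>\<^bsub>R\<^esub>},
            monoid.mult = (\<lambda>(a, b, c, d) (a', b', c', d').
              (a \<otimes>\<^bsub>R\<^esub> a' \<oplus>\<^bsub>R\<^esub> b \<otimes>\<^bsub>R\<^esub> c', a \<otimes>\<^bsub>R\<^esub> b' \<oplus>\<^bsub>R\<^esub> b \<otimes>\<^bsub>R\<^esub> d',
               c \<otimes>\<^bsub>R\<^esub> a' \<oplus>\<^bsub>R\<^esub> d \<otimes>\<^bsub>R\<^esub> c', c \<otimes>\<^bsub>R\<^esub> b' \<oplus>\<^bsub>R\<^esub> d \<otimes>\<^bsub>R\<^esub> d')),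
            one = (\<one>\<^bsub>R\<^esub>, \<zero>\<^bsub>R\<^esub>, \<zero>\<^bsub>R\<^esub>, \<one>\<^bsub>R\<^esub>)\<rparr>"

lemma (in cring) SL2_group: "group (SL2 R)"
proof (rule groupI)
  show "\<one>\<^bsub>SL2 R\<^esub> \<in> carrier (SL2 R)" by (simp add: SL2_def minus_eq)
next
  fix x assume "x \<in> carrier (SL2 R)"
  then show "\<one>\<^bsub>SL2 R\<^esub> \<otimes>\<^bsub>SL2 R\<^esub> x = x" by (auto simp: SL2_def)
next
  fix x y z assume "x \<in> carrier (SL2 R)" "y \<in> carrier (SL2 R)" "z \<in> carrier (SL2 R)"
  then show "x \<otimes>\<^bsub>SL2 R\<^esub> y \<otimes>\<^bsub>SL2 R\<^esub> z = x \<otimes>\<^bsub>SL2 R\<^esub> (y \<otimes>\<^bsub>SL2 R\<^esub> z)"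
    by (auto simp: SL2_def l_distr r_distr a_ac m_ac)
next
  fix x y assume "x \<in> carrier (SL2 R)" "y \<in> carrier (SL2 R)"
  then obtain a b c d a' b' c' d' where xy: "x = (a, b, c, d)" "y = (a', b', c', d')"
    and cl: "a \<in> carrier R" "b \<in> carrier R" "c \<in> carrier R" "d \<in> carrier R"
      "a' \<in> carrier R" "b' \<in> carrier R" "c' \<in> carrier R" "d' \<in> carrier R"
    and det: "a \<otimes> d \<ominus> b \<otimes> c = \<one>" "a' \<otimes> d' \<ominus> b' \<otimes> c' = \<one>"
    by (auto simp: SL2_def)
  have "(a \<otimes> a' \<oplus> b \<otimes> c') \<otimes> (c \<otimes> b' \<oplus> d \<otimes> d') \<ominus> (a \<otimes> b' \<oplus> b \<otimes> d') \<otimes> (c \<otimes> a' \<oplus> d \<otimes> c')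
      = (a \<otimes> d \<ominus> b \<otimes> c) \<otimes> (a' \<otimes> d' \<ominus> b' \<otimes> c')"
    using cl by algebra
  then show "x \<otimes>\<^bsub>SL2 R\<^esub> y \<in> carrier (SL2 R)"
    using cl det by (simp add: xy SL2_def)
next
  fix x assume "x \<in> carrier (SL2 R)"
  then obtain a b c d where x: "x = (a, b, c, d)"
    and cl: "a \<in> carrier R" "b \<in> carrier R" "c \<in> carrier R" "d \<in> carrier R"
    and det: "a \<otimes> d \<ominus> b \<otimes> c = \<one>"
    by (auto simp: SL2_def)
  have "d \<otimes> a \<ominus> (\<ominus> b) \<otimes> (\<ominus> c) = a \<otimes> d \<ominus> b \<otimes> c" "d \<otimes> a \<oplus> (\<ominus> b) \<otimes> c = a \<otimes> d \<ominus> b \<otimes> c"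
    "d \<otimes> b \<oplus> (\<ominus> b) \<otimes> d = \<zero>" "(\<ominus> c) \<otimes> a \<oplus> a \<otimes> c = \<zero>"
    "(\<ominus> c) \<otimes> b \<oplus> a \<otimes> d = a \<otimes> d \<ominus> b \<otimes> c"
    using cl by algebra+
  then have "(d, \<ominus> b, \<ominus> c, a) \<in> carrier (SL2 R)"
    "(d, \<ominus> b, \<ominus> c, a) \<otimes>\<^bsub>SL2 R\<^esub> x = \<one>\<^bsub>SL2 R\<^esub>"
    using cl det by (simp_all add: x SL2_def)
  then show "\<exists>y\<in>carrier (SL2 R). y \<otimes>\<^bsub>SL2 R\<^esub> x = \<one>\<^bsub>SL2 R\<^esub>" by blast
qed

definition sign_group :: "int monoid" where
  "sign_group = \<lparr>carrier = {1, -1}, monoid.mult = (*), one = 1\<rparr>"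

text \<open>The inverse image of \<open>SL2 (Zp p)\<close> in the metaplectic double cover, identified with a
  direct product through the splitting of the cover, which exists for odd \<open>p\<close>.\<close>

definition Kbar :: "nat \<Rightarrow> (padic mat2 \<times> int) monoid" where
  "Kbar p = SL2 (Zp p) \<times>\<times> sign_group"

definition K0 :: "nat \<Rightarrow> nat \<Rightarrow> padic mat2 set" where
  "K0 p n = {(a, b, c, d) \<in> carrier (SL2 (Zp p)). c \<in> PIdl\<^bsub>Zp p\<^esub> (Zp_of_int p (int p ^ n))}"

definition K0bar :: "nat \<Rightarrow> nat \<Rightarrow> (padic mat2 \<times> int) set" where
  "K0bar p n = K0 p n \<times> carrier sign_group"

section \<open>Characters\<close>

text \<open>Only the values at units of \<^term>\<open>Zp p\<close> matter.\<close>

definition triv_char :: "padic \<Rightarrow> complex" where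
  "triv_char d = 1"

definition legendre_char :: "nat \<Rightarrow> padic \<Rightarrow> complex" where
  "legendre_char p d = of_int (Legendre (d 1) (int p))"

definition genuine_char :: "(padic \<Rightarrow> complex) \<Rightarrow> padic mat2 \<times> int \<Rightarrow> complex" where
  "genuine_char \<eta> = (\<lambda>((a, b, c, d), \<epsilon>). of_int \<epsilon> * \<eta> d)"

section \<open>Complex functions on a group and right translation\<close>

text \<open>A function on \<open>carrier G\<close> is represented by its extension by zero.\<close>

definition fscale :: "complex \<Rightarrow> ('a \<Rightarrow> complex) \<Rightarrow> 'a \<Rightarrow> complex" (infixr \<open>*\<^sub>f\<close> 75) where
  "c *\<^sub>f \<phi> = (\<lambda>x. c * \<phi> x)"

interpretation fvs: vector_space fscale
  by unfold_locales (auto simp: fscale_def fun_eq_iff algebra_simps)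

definition functions_on :: "('a, 'm) monoid_scheme \<Rightarrow> ('a \<Rightarrow> complex) set" where
  "functions_on G = {\<phi>. \<forall>x. x \<notin> carrier G \<longrightarrow> \<phi> x = 0}"

definition locally_constant_on :: "'a::topological_space set \<Rightarrow> ('a \<Rightarrow> 'b) \<Rightarrow> bool" where
  "locally_constant_on S \<phi> \<longleftrightarrow>
     (\<forall>x\<in>S. \<exists>U. openin (top_of_set S) U \<and> x \<in> U \<and> (\<forall>y\<in>U. \<phi> y = \<phi> x))"

definition right_translation ::
    "('a, 'm) monoid_scheme \<Rightarrow> 'a \<Rightarrow> ('a \<Rightarrow> complex) \<Rightarrow> 'a \<Rightarrow> complex" where
  "right_translation G g \<phi> = (\<lambda>x. if x \<in> carrier G then \<phi> (x \<otimes>\<^bsub>G\<^esub> g) else 0)"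

definition subrepresentation ::
    "('a, 'm) monoid_scheme \<Rightarrow> ('a \<Rightarrow> complex) set \<Rightarrow> bool" where
  "subrepresentation G W \<longleftrightarrow> fvs.subspace W \<and> W \<subseteq> functions_on G \<and>
     (\<forall>g\<in>carrier G. right_translation G g ` W \<subseteq> W)"

definition irreducible_rep ::
    "('a, 'm) monoid_scheme \<Rightarrow> ('a \<Rightarrow> complex) set \<Rightarrow> bool" where
  "irreducible_rep G W \<longleftrightarrow> subrepresentation G W \<and> W \<noteq> {0} \<and>
     (\<forall>U. subrepresentation G U \<and> U \<subseteq> W \<longrightarrow> U = {0} \<or> U = W)"

definition generated_rep ::
    "('a, 'm) monoid_scheme \<Rightarrow> ('a \<Rightarrow> complex) \<Rightarrow> ('a \<Rightarrow> complex) set" where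
  "generated_rep G u = fvs.span ((\<lambda>g. right_translation G g u) ` carrier G)"

text \<open>\<open>V\<close> is the internal direct sum of the subspaces \<open>W j\<close>, for \<open>j\<close> in the finite set \<open>J\<close>:
  addition is a bijection from the product of the \<open>W j\<close> onto \<open>V\<close>.\<close>

definition internal_direct_sum ::
    "('a \<Rightarrow> complex) set \<Rightarrow> 'j set \<Rightarrow> ('j \<Rightarrow> ('a \<Rightarrow> complex) set) \<Rightarrow> bool" where
  "internal_direct_sum V J W \<longleftrightarrow> finite J \<and> (\<forall>j\<in>J. fvs.subspace (W j)) \<and>
     bij_betw (\<lambda>x. \<Sum>j\<in>J. x j) (\<Pi>\<^sub>E j\<in>J. W j) V"

section \<open>The induced representation and its Hecke vectors\<close>

definition Ind_rep :: "nat \<Rightarrow> nat \<Rightarrow> (padic \<Rightarrow> complex) \<Rightarrow> (padic mat2 \<times> int \<Rightarrow> complex) set" where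
  "Ind_rep p n \<eta> = {\<phi> \<in> functions_on (Kbar p). locally_constant_on (carrier (Kbar p)) \<phi> \<and>
     (\<forall>k\<^sub>0\<in>K0bar p n. \<forall>k\<in>carrier (Kbar p).
        \<phi> (k\<^sub>0 \<otimes>\<^bsub>Kbar p\<^esub> k) = genuine_char \<eta> k\<^sub>0 * \<phi> k)}"

definition Hecke :: "nat \<Rightarrow> nat \<Rightarrow> (padic \<Rightarrow> complex) \<Rightarrow> (padic mat2 \<times> int \<Rightarrow> complex) set" where
  "Hecke p n \<eta> = {f \<in> functions_on (Kbar p).
     \<forall>k\<in>K0bar p n. \<forall>k'\<in>K0bar p n. \<forall>g\<in>carrier (Kbar p).
       f (k \<otimes>\<^bsub>Kbar p\<^esub> g \<otimes>\<^bsub>Kbar p\<^esub> k') = genuine_char \<eta> k * genuine_char \<eta> k' * f g}"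

definition is_Hecke_elt ::
    "nat \<Rightarrow> nat \<Rightarrow> (padic \<Rightarrow> complex) \<Rightarrow> padic mat2 \<times> int \<Rightarrow> (padic mat2 \<times> int \<Rightarrow> complex) \<Rightarrow> bool"
  where
  "is_Hecke_elt p n \<eta> g f \<longleftrightarrow> f \<in> Hecke p n \<eta> \<and>
     (\<forall>x. x \<notin> K0bar p n <#>\<^bsub>Kbar p\<^esub> {g} <#>\<^bsub>Kbar p\<^esub> K0bar p n \<longrightarrow> f x = 0) \<and> f g = 1"

definition Hecke_elt ::
    "nat \<Rightarrow> nat \<Rightarrow> (padic \<Rightarrow> complex) \<Rightarrow> padic mat2 \<times> int \<Rightarrow> padic mat2 \<times> int \<Rightarrow> complex" where
  "Hecke_elt p n \<eta> g = (THE f. is_Hecke_elt p n \<eta> g f)"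

definition y_mat :: "nat \<Rightarrow> padic \<Rightarrow> padic mat2" where
  "y_mat p s = (\<one>\<^bsub>Zp p\<^esub>, \<zero>\<^bsub>Zp p\<^esub>, s, \<one>\<^bsub>Zp p\<^esub>)"

definition w_mat :: "nat \<Rightarrow> padic mat2" where
  "w_mat p = (\<zero>\<^bsub>Zp p\<^esub>, \<one>\<^bsub>Zp p\<^esub>, \<ominus>\<^bsub>Zp p\<^esub> \<one>\<^bsub>Zp p\<^esub>, \<zero>\<^bsub>Zp p\<^esub>)"

definition I_elt :: "nat \<Rightarrow> nat \<Rightarrow> (padic \<Rightarrow> complex) \<Rightarrow> padic mat2 \<times> int \<Rightarrow> complex" where
  "I_elt p n \<eta> = Hecke_elt p n \<eta> (\<one>\<^bsub>SL2 (Zp p)\<^esub>, 1)"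

definition U0_elt :: "nat \<Rightarrow> nat \<Rightarrow> (padic \<Rightarrow> complex) \<Rightarrow> padic mat2 \<times> int \<Rightarrow> complex" where
  "U0_elt p n \<eta> = Hecke_elt p n \<eta> (w_mat p, 1)"

definition Vra_elt ::
    "nat \<Rightarrow> nat \<Rightarrow> (padic \<Rightarrow> complex) \<Rightarrow> nat \<Rightarrow> padic \<Rightarrow> padic mat2 \<times> int \<Rightarrow> complex" where
  "Vra_elt p n \<eta> r a =
     Hecke_elt p n \<eta> (y_mat p (a \<otimes>\<^bsub>Zp p\<^esub> Zp_of_int p (int p ^ r)), 1)"

text \<open>Below, \<open>l\<close> is the chosen unit that is a nonsquare modulo \<open>p\<close> and \<open>s\<close> is the chosen square
  root of \<open>p_star p\<close>.\<close>

definition V_elt ::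
    "nat \<Rightarrow> nat \<Rightarrow> (padic \<Rightarrow> complex) \<Rightarrow> padic \<Rightarrow> nat \<Rightarrow> padic mat2 \<times> int \<Rightarrow> complex" where
  "V_elt p n \<eta> l r = Vra_elt p n \<eta> r \<one>\<^bsub>Zp p\<^esub> + Vra_elt p n \<eta> r l"

definition W_elt ::
    "nat \<Rightarrow> nat \<Rightarrow> (padic \<Rightarrow> complex) \<Rightarrow> padic \<Rightarrow> nat \<Rightarrow> padic mat2 \<times> int \<Rightarrow> complex" where
  "W_elt p n \<eta> l r = Vra_elt p n \<eta> r \<one>\<^bsub>Zp p\<^esub> - Vra_elt p n \<eta> r l"

definition Y_elt ::
    "nat \<Rightarrow> nat \<Rightarrow> (padic \<Rightarrow> complex) \<Rightarrow> padic \<Rightarrow> nat \<Rightarrow> padic mat2 \<times> int \<Rightarrow> complex" where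
  "Y_elt p n \<eta> l r = I_elt p n \<eta> + (\<Sum>j = r..<n. V_elt p n \<eta> l j)"

definition p_star :: "nat \<Rightarrow> int" where
  "p_star p = Legendre (-1) (int p) * int p"

definition u1_vec ::
    "nat \<Rightarrow> nat \<Rightarrow> (padic \<Rightarrow> complex) \<Rightarrow> padic \<Rightarrow> complex \<Rightarrow> padic mat2 \<times> int \<Rightarrow> complex" where
  "u1_vec p n \<eta> l s = (if \<eta> = triv_char then U0_elt p n \<eta> + Y_elt p n \<eta> l 1
                        else U0_elt p n \<eta> + s *\<^sub>f Y_elt p n \<eta> l 1)"

definition u2_vec ::
    "nat \<Rightarrow> nat \<Rightarrow> (padic \<Rightarrow> complex) \<Rightarrow> padic \<Rightarrow> complex \<Rightarrow> padic mat2 \<times> int \<Rightarrow> complex" where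
  "u2_vec p n \<eta> l s = (if \<eta> = triv_char then U0_elt p n \<eta> - of_nat p *\<^sub>f Y_elt p n \<eta> l 1
                        else U0_elt p n \<eta> - s *\<^sub>f Y_elt p n \<eta> l 1)"

definition v_vec ::
    "nat \<Rightarrow> nat \<Rightarrow> (padic \<Rightarrow> complex) \<Rightarrow> padic \<Rightarrow> complex \<Rightarrow> nat \<Rightarrow> padic mat2 \<times> int \<Rightarrow> complex" where
  "v_vec p n \<eta> l s k = of_nat p *\<^sub>f Y_elt p n \<eta> l (k + 1) - Y_elt p n \<eta> l k
                        + (of_nat p / s) *\<^sub>f W_elt p n \<eta> l k"

definition v'_vec ::
    "nat \<Rightarrow> nat \<Rightarrow> (padic \<Rightarrow> complex) \<Rightarrow> padic \<Rightarrow> complex \<Rightarrow> nat \<Rightarrow> padic mat2 \<times> int \<Rightarrow> complex" where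
  "v'_vec p n \<eta> l s k = of_nat p *\<^sub>f Y_elt p n \<eta> l (k + 1) - Y_elt p n \<eta> l k
                         - (of_nat p / s) *\<^sub>f W_elt p n \<eta> l k"

datatype summand = S\<^sub>1 | S\<^sub>2 | T nat | T' nat

definition summands :: "nat \<Rightarrow> summand set" where
  "summands n = {S\<^sub>1, S\<^sub>2} \<union> T ` {1..n-1} \<union> T' ` {1..n-1}"

fun summand_vec ::
    "nat \<Rightarrow> nat \<Rightarrow> (padic \<Rightarrow> complex) \<Rightarrow> padic \<Rightarrow> complex \<Rightarrow> summand \<Rightarrow> padic mat2 \<times> int \<Rightarrow> complex" where
  "summand_vec p n \<eta> l s S\<^sub>1 = u1_vec p n \<eta> l s"
| "summand_vec p n \<eta> l s S\<^sub>2 = u2_vec p n \<eta> l s"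
| "summand_vec p n \<eta> l s (T k) = v_vec p n \<eta> l s k"
| "summand_vec p n \<eta> l s (T' k) = v'_vec p n \<eta> l s k"

definition summand_space ::
    "nat \<Rightarrow> nat \<Rightarrow> (padic \<Rightarrow> complex) \<Rightarrow> padic \<Rightarrow> complex \<Rightarrow> summand \<Rightarrow>
     (padic mat2 \<times> int \<Rightarrow> complex) set" where
  "summand_space p n \<eta> l s j = generated_rep (Kbar p) (summand_vec p n \<eta> l s j)"

end

theory Submission
  imports Defs
begin

text \<open>
  Let \<open>Q\<close> be \<open>K0bar p n\<close> with its character. The functions on \<open>Kbar p\<close> that are equivariant under
  \<open>Q\<close> on both sides act on the induced space by convolution on the left, and this action commutes with right
  translation. Hence orthogonal idempotents \<open>e\<^sub>j\<close> of this Hecke algebra with sum \<open>1\<close> split the induced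
  space into the subrepresentations generated by the \<open>e\<^sub>j\<close>. Every nonzero subrepresentation
  contains a nonzero \<open>Q\<close>-equivariant vector (average a vector not vanishing at the identity), so if the
  \<open>e\<^sub>j\<close> span the Hecke algebra, each summand is irreducible. Its dimension is the trace of the projection,
  that is, the index of \<open>Q\<close> times \<open>e\<^sub>j(1)\<close>.

  A Hecke function is determined by the bottom row \<open>(c, d)\<close>. Averaging over \<open>y(p\<^sup>r t)\<close> gives
  the relations among the \<open>Y\<^sub>r\<close>, the Legendre sum \<open>\<Sum>\<^sub>t (t/p) ((t+m)/p)\<close> gives \<open>W\<^sub>k \<star> W\<^sub>k\<close>, and
  products in the opposite order follow from the anti-involution \<open>f(g) \<mapsto> f(g\<inverse>)\<close>, under which
  \<open>Y\<^sub>r\<close>, \<open>W\<^sub>k\<close> and \<open>U\<^sub>0\<close> are invariant up to sign.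
\<close>

section \<open>Convolution on a representation induced from a sign character\<close>

text \<open>Convolution by Y_r averages over y(p^r t) up to the factor p^(n-r), so Y_r / p^(n-r) is
  the projection onto the functions that already transform under K_0(p^r). These projections
  increase to the identity at r = n. The difference of two neighbours is proportional to p Y_(k+1) -
  Y_k; it fixes W_k, and W_k squares to a multiple of it that carries the sign (-1/p). Adding or
  subtracting W_k with the right coefficient therefore halves the difference, and this is where the
  square root of (-1/p) p enters. On the smallest piece the Hecke algebra is spanned by Y_1 and U_0;
  its two idempotents come from the roots of a quadratic equation that depends on \<eta> through the
  sum of its values over the units modulo p, which is p - 1 or 0. The resulting 2n idempotents match
  the 2n double cosets. All functions involved depend only on the sign and on the bottom row modulo
  p^n, so every product is a finite sum governed by integer congruences.\<close>

lemma sum_fun_apply: "(\<Sum>i\<in>I. f i) x = (\<Sum>i\<in>I. f i x)"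
  for f :: "'i \<Rightarrow> 'a \<Rightarrow> 'b::comm_monoid_add"
  by (induction I rule: infinite_finite_induct) auto

lemma functions_on_subspace: "fvs.subspace (functions_on G)"
  by (auto simp: fvs.subspace_def functions_on_def fscale_def)

lemma right_translation_functions_on: "right_translation G g \<phi> \<in> functions_on G"
  by (simp add: right_translation_def functions_on_def)

lemma right_translation_linear:
  "right_translation G g (\<phi> + \<psi>) = right_translation G g \<phi> + right_translation G g \<psi>"
  "right_translation G g (c *\<^sub>f \<phi>) = c *\<^sub>f right_translation G g \<phi>"
  "right_translation G g 0 = 0"
  by (auto simp: right_translation_def fscale_def fun_eq_iff)

lemma right_translation_sum:
  "right_translation G g (\<Sum>i\<in>I. f i) = (\<Sum>i\<in>I. right_translation G g (f i))"
  by (auto simp: right_translation_def fun_eq_iff sum_fun_apply)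

lemma (in group) right_translation_mult:
  assumes "g \<in> carrier G" "h \<in> carrier G"
  shows "right_translation G g (right_translation G h \<phi>) = right_translation G (g \<otimes> h) \<phi>"
  using assms by (auto simp: right_translation_def fun_eq_iff m_assoc)

lemma (in group) right_translation_one:
  assumes "\<phi> \<in> functions_on G"
  shows "right_translation G \<one> \<phi> = \<phi>"
  using assms by (auto simp: right_translation_def functions_on_def fun_eq_iff)

lemma (in group) generated_rep_subrepresentation:
  "subrepresentation G (generated_rep G u)"
proof -
  let ?S = "(\<lambda>g. right_translation G g u) ` carrier G"
  have "right_translation G g ` fvs.span ?S \<subseteq> fvs.span ?S" if g: "g \<in> carrier G" for g
  proof
    fix \<psi> assume "\<psi> \<in> right_translation G g ` fvs.span ?S"
    then obtain \<phi> where \<phi>: "\<phi> \<in> fvs.span ?S" "\<psi> = right_translation G g \<phi>" by blast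
    have "right_translation G g \<phi> \<in> fvs.span ?S" using \<phi>(1)
    proof (induction rule: fvs.span_induct_alt)
      case base show ?case unfolding right_translation_linear(3) by (rule fvs.span_zero)
    next
      case (step c x y)
      then obtain h where "h \<in> carrier G" "x = right_translation G h u" by blast
      with g have "right_translation G g x \<in> ?S" by (auto simp: right_translation_mult)
      then show ?case unfolding right_translation_linear
        by (intro fvs.span_add fvs.span_scale fvs.span_base step.IH)
    qed
    with \<phi> show "\<psi> \<in> fvs.span ?S" by simp
  qed
  moreover have "fvs.span ?S \<subseteq> functions_on G"
    by (rule fvs.span_minimal) (auto simp: functions_on_subspace right_translation_functions_on)
  ultimately show ?thesis by (simp add: subrepresentation_def generated_rep_def)
qed

lemma generated_rep_minimal:
  assumes "subrepresentation G U" "u \<in> U"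
  shows "generated_rep G u \<subseteq> U"
  unfolding generated_rep_def
  by (rule fvs.span_minimal) (use assms in \<open>auto simp: subrepresentation_def\<close>)

lemma (in group) generated_rep_self:
  assumes "u \<in> functions_on G"
  shows "u \<in> generated_rep G u"
  unfolding generated_rep_def using right_translation_one[OF assms]
  by (metis (no_types, lifting) fvs.span_base image_eqI one_closed)

lemma (in vector_space) span_eq_scale_sum:
  assumes "finite J" "x \<in> span (e ` J)"
  shows "\<exists>a. x = (\<Sum>j\<in>J. scale (a j) (e j))"
  using assms(2)
proof (induction rule: span_induct_alt)
  case base
  show ?case by (rule exI[of _ "\<lambda>_. 0"]) simp
next
  case (step c x y)
  then obtain a j where a: "y = (\<Sum>j\<in>J. scale (a j) (e j))" and j: "j \<in> J" "x = e j" by blast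
  have "scale c x + y = (\<Sum>i\<in>J. scale (if i = j then c else 0) (e i)) + (\<Sum>j\<in>J. scale (a j) (e j))"
    using j assms(1) by (simp add: a if_distrib[of "\<lambda>c. scale c _"] sum.delta cong: if_cong)
  also have "\<dots> = (\<Sum>i\<in>J. scale ((if i = j then c else 0) + a i) (e i))"
    by (simp add: sum.distrib scale_left_distrib)
  finally show ?case by (intro exI[of _ "\<lambda>i. (if i = j then c else 0) + a i"])
qed

text \<open>\<open>R\<close> represents the right cosets of \<open>Q\<close>; its finiteness makes
  convolution a plain finite sum. With values in {1, -1} the character is its own inverse, so the
  same \<open>\<theta>\<close> serves on both sides in \<open>Hecke_space\<close>.\<close>

locale induced_character = group G for G (structure) +
  fixes Q :: "'a set" and \<theta> :: "'a \<Rightarrow> complex" and R :: "'a set"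
  assumes Q_subgroup: "subgroup Q G"
    and theta_mult: "\<lbrakk>q \<in> Q; q' \<in> Q\<rbrakk> \<Longrightarrow> \<theta> (q \<otimes> q') = \<theta> q * \<theta> q'"
    and theta_values: "q \<in> Q \<Longrightarrow> \<theta> q \<in> {1, -1}"
    and R_finite: "finite R" and R_carrier: "R \<subseteq> carrier G"
    and R_transversal: "g \<in> carrier G \<Longrightarrow> \<exists>!r. r \<in> R \<and> g \<otimes> inv r \<in> Q"
begin

lemma Q_closed [simp]: "q \<in> Q \<Longrightarrow> q \<in> carrier G"
  using Q_subgroup subgroup.subset by blast

lemma R_closed [simp]: "r \<in> R \<Longrightarrow> r \<in> carrier G"
  using R_carrier by blast

lemma inv_cancel: "a \<in> carrier G \<Longrightarrow> b \<in> carrier G \<Longrightarrow> inv a \<otimes> (a \<otimes> b) = b"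
  "a \<in> carrier G \<Longrightarrow> b \<in> carrier G \<Longrightarrow> a \<otimes> (inv a \<otimes> b) = b"
  by (simp_all add: m_assoc[symmetric])

lemma Q_one [simp]: "\<one> \<in> Q" and Q_inv [simp]: "q \<in> Q \<Longrightarrow> inv q \<in> Q"
  and Q_mult [simp]: "q \<in> Q \<Longrightarrow> q' \<in> Q \<Longrightarrow> q \<otimes> q' \<in> Q"
  using Q_subgroup by (auto simp: subgroup.one_closed subgroup.m_inv_closed subgroup.m_closed)

lemma theta_square: "q \<in> Q \<Longrightarrow> \<theta> q * \<theta> q = 1"
  using theta_values[of q] by auto

lemma theta_one [simp]: "\<theta> \<one> = 1"
  using theta_mult[of \<one> \<one>] theta_values[of \<one>] by auto

lemma theta_inv [simp]: "q \<in> Q \<Longrightarrow> \<theta> (inv q) = \<theta> q"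
  using theta_mult[of "inv q" q] theta_values[of q] theta_values[of "inv q"] by auto

definition Ind :: "('a \<Rightarrow> complex) set" where
  "Ind = {\<phi> \<in> functions_on G. \<forall>q\<in>Q. \<forall>g\<in>carrier G. \<phi> (q \<otimes> g) = \<theta> q * \<phi> g}"

definition Hecke_space :: "('a \<Rightarrow> complex) set" where
  "Hecke_space = {f \<in> functions_on G.
     \<forall>k\<in>Q. \<forall>k'\<in>Q. \<forall>g\<in>carrier G. f (k \<otimes> g \<otimes> k') = \<theta> k * \<theta> k' * f g}"

definition Hecke_unit :: "'a \<Rightarrow> complex" where
  "Hecke_unit g = (if g \<in> Q then \<theta> g else 0)"

text \<open>For a Hecke function f and \<phi> in \<open>Ind\<close> the summand does not change when
  h is replaced by q h, since the two factors \<open>\<theta> q\<close> cancel. The sum is thus one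
  over the right cosets of \<open>Q\<close>, independent of the choice of \<open>R\<close>.\<close>

definition convolution :: "('a \<Rightarrow> complex) \<Rightarrow> ('a \<Rightarrow> complex) \<Rightarrow> 'a \<Rightarrow> complex" (infixl \<open>\<star>\<close> 70)
  where "f \<star> \<phi> = (\<lambda>g. if g \<in> carrier G then \<Sum>h\<in>R. f (g \<otimes> inv h) * \<phi> h else 0)"

lemma Ind_eq: "\<phi> \<in> Ind \<Longrightarrow> q \<in> Q \<Longrightarrow> g \<in> carrier G \<Longrightarrow> \<phi> (q \<otimes> g) = \<theta> q * \<phi> g"
  by (simp add: Ind_def)

lemma Hecke_both:
  "f \<in> Hecke_space \<Longrightarrow> k \<in> Q \<Longrightarrow> k' \<in> Q \<Longrightarrow> g \<in> carrier G \<Longrightarrow>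
    f (k \<otimes> g \<otimes> k') = \<theta> k * \<theta> k' * f g"
  unfolding Hecke_space_def by blast

lemma Hecke_left: "f \<in> Hecke_space \<Longrightarrow> q \<in> Q \<Longrightarrow> g \<in> carrier G \<Longrightarrow> f (q \<otimes> g) = \<theta> q * f g"
  using Hecke_both[of f q \<one> g] by simp

lemma Hecke_right: "f \<in> Hecke_space \<Longrightarrow> q \<in> Q \<Longrightarrow> g \<in> carrier G \<Longrightarrow> f (g \<otimes> q) = \<theta> q * f g"
  using Hecke_both[of f \<one> q g] by simp

lemma Hecke_subset_Ind: "Hecke_space \<subseteq> Ind"
  using Hecke_left by (auto simp: Ind_def Hecke_space_def)

lemma Hecke_spaceI:
  assumes "f \<in> Ind" "\<And>q g. q \<in> Q \<Longrightarrow> g \<in> carrier G \<Longrightarrow> f (g \<otimes> q) = \<theta> q * f g"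
  shows "f \<in> Hecke_space"
  using assms by (auto simp: Ind_def Hecke_space_def)

lemma Ind_outside: "\<phi> \<in> Ind \<Longrightarrow> g \<notin> carrier G \<Longrightarrow> \<phi> g = 0"
  by (simp add: Ind_def functions_on_def)

lemma Ind_subspace: "fvs.subspace Ind"
  by (auto simp: fvs.subspace_def Ind_def functions_on_def fscale_def algebra_simps)

lemma Hecke_subspace: "fvs.subspace Hecke_space"
  by (auto simp: fvs.subspace_def Hecke_space_def functions_on_def fscale_def algebra_simps)

lemma Ind_translation:
  "\<phi> \<in> Ind \<Longrightarrow> g \<in> carrier G \<Longrightarrow> right_translation G g \<phi> \<in> Ind"
  by (auto simp: Ind_def functions_on_def right_translation_def m_assoc)

lemma Ind_subrepresentation: "subrepresentation G Ind"
  using Ind_subspace Ind_translation by (auto simp: subrepresentation_def Ind_def)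

definition rep :: "'a \<Rightarrow> 'a" where "rep g = (THE r. r \<in> R \<and> g \<otimes> inv r \<in> Q)"

lemma rep: "g \<in> carrier G \<Longrightarrow> rep g \<in> R" "g \<in> carrier G \<Longrightarrow> g \<otimes> inv (rep g) \<in> Q"
  using theI'[OF R_transversal, of g] by (simp_all add: rep_def)

lemma rep_eqI: "g \<in> carrier G \<Longrightarrow> r \<in> R \<Longrightarrow> g \<otimes> inv r \<in> Q \<Longrightarrow> rep g = r"
  using R_transversal[of g] rep[of g] by blast

lemma rep_decomp: "g \<in> carrier G \<Longrightarrow> g = (g \<otimes> inv (rep g)) \<otimes> rep g"
  using rep(1)[of g] by (simp add: m_assoc)

lemma Ind_determined:
  assumes "\<phi> \<in> Ind" "\<psi> \<in> Ind" "\<And>r. r \<in> R \<Longrightarrow> \<phi> r = \<psi> r"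
  shows "\<phi> = \<psi>"
proof
  fix g
  show "\<phi> g = \<psi> g"
  proof (cases "g \<in> carrier G")
    case True
    then have "\<phi> g = \<theta> (g \<otimes> inv (rep g)) * \<phi> (rep g)" "\<psi> g = \<theta> (g \<otimes> inv (rep g)) * \<psi> (rep g)"
      using rep[OF True] rep_decomp[OF True] assms(1,2) Ind_eq by (metis R_closed)+
    with assms(3) rep(1)[OF True] show ?thesis by simp
  qed (simp add: assms Ind_outside)
qed

text \<open>Right multiplication by x permutes the right cosets of \<open>Q\<close>, so r \<mapsto>
  \<open>rep (r \<otimes> x)\<close> is a bijection of \<open>R\<close>.\<close>

lemma sum_shift:
  fixes F :: "'a \<Rightarrow> complex"
  assumes F: "\<And>q g. q \<in> Q \<Longrightarrow> g \<in> carrier G \<Longrightarrow> F (q \<otimes> g) = F g" and x: "x \<in> carrier G"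
  shows "(\<Sum>r\<in>R. F (r \<otimes> x)) = (\<Sum>r\<in>R. F r)"
proof -
  let ?h = "\<lambda>r. rep (r \<otimes> x)"
  have "inj_on ?h R"
  proof (rule inj_onI)
    fix r r' assume r: "r \<in> R" "r' \<in> R" and eq: "?h r = ?h r'"
    have c: "r \<otimes> x \<in> carrier G" "r' \<otimes> x \<in> carrier G" "?h r \<in> carrier G" using r x rep(1) by auto
    have "(r \<otimes> x \<otimes> inv (?h r)) \<otimes> inv (r' \<otimes> x \<otimes> inv (?h r)) \<in> Q"
      using rep(2)[OF c(1)] rep(2)[OF c(2)] eq by (metis Q_mult Q_inv)
    also have "(r \<otimes> x \<otimes> inv (?h r)) \<otimes> inv (r' \<otimes> x \<otimes> inv (?h r)) = r \<otimes> inv r'"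
      using r x c by (simp add: inv_mult_group m_assoc inv_cancel)
    finally have "r \<otimes> inv r' \<in> Q" .
    moreover have "r \<otimes> inv r \<in> Q" using r by simp
    ultimately show "r = r'" using R_transversal[of r] r by auto
  qed
  moreover have "?h ` R \<subseteq> R" using x rep(1) by auto
  ultimately have bij: "bij_betw ?h R R"
    using R_finite by (simp add: bij_betw_def endo_inj_surj)
  have "F (r \<otimes> x) = F (?h r)" if "r \<in> R" for r
    using that x rep[of "r \<otimes> x"] rep_decomp[of "r \<otimes> x"] F by (metis R_closed m_closed)
  then show ?thesis using sum.reindex_bij_betw[OF bij, of F] by simp
qed

text \<open>Substituting h g for h moves g from f to \<phi>. Explicit products are computed in this
  form, because f enters only through its values at the inverses of the representatives.\<close>

lemma convolution_alt:
  assumes f: "f \<in> Hecke_space" and \<phi>: "\<phi> \<in> Ind" and g: "g \<in> carrier G"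
  shows "(f \<star> \<phi>) g = (\<Sum>h\<in>R. f (inv h) * \<phi> (h \<otimes> g))"
proof -
  have "(\<Sum>h\<in>R. f (g \<otimes> inv (h \<otimes> g)) * \<phi> (h \<otimes> g)) = (\<Sum>h\<in>R. f (g \<otimes> inv h) * \<phi> h)"
  proof (rule sum_shift[OF _ g])
    fix q h assume qh: "q \<in> Q" "h \<in> carrier G"
    then show "f (g \<otimes> inv (q \<otimes> h)) * \<phi> (q \<otimes> h) = f (g \<otimes> inv h) * \<phi> h"
      using Hecke_right[OF f, of "inv q" "g \<otimes> inv h"] Ind_eq[OF \<phi> qh] theta_square[of q] g
      by (simp add: inv_mult_group m_assoc)
  qed
  moreover have "f (g \<otimes> inv (h \<otimes> g)) = f (inv h)" if "h \<in> R" for h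
    using that g by (simp add: inv_mult_group m_assoc[symmetric])
  ultimately show ?thesis using g by (simp add: convolution_def)
qed

lemma convolution_Ind: "f \<in> Hecke_space \<Longrightarrow> f \<star> \<phi> \<in> Ind"
  by (auto simp: Ind_def functions_on_def convolution_def m_assoc Hecke_left sum_distrib_left mult.assoc)

lemma convolution_linear:
  "(f + f') \<star> \<phi> = f \<star> \<phi> + f' \<star> \<phi>" "(f - f') \<star> \<phi> = f \<star> \<phi> - f' \<star> \<phi>"
  "(c *\<^sub>f f) \<star> \<phi> = c *\<^sub>f (f \<star> \<phi>)" "0 \<star> \<phi> = 0"
  "f \<star> (\<phi> + \<phi>') = f \<star> \<phi> + f \<star> \<phi>'" "f \<star> (\<phi> - \<phi>') = f \<star> \<phi> - f \<star> \<phi>'"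
  "f \<star> (c *\<^sub>f \<phi>) = c *\<^sub>f (f \<star> \<phi>)" "f \<star> 0 = 0"
  by (auto simp: convolution_def fscale_def fun_eq_iff algebra_simps sum.distrib sum_subtractf
      sum_distrib_left)

lemma convolution_sum:
  "(\<Sum>i\<in>I. f i) \<star> \<phi> = (\<Sum>i\<in>I. f i \<star> \<phi>)" "F \<star> (\<Sum>i\<in>I. f i) = (\<Sum>i\<in>I. F \<star> f i)"
  by (induction I rule: infinite_finite_induct) (simp_all add: convolution_linear)

text \<open>In the shifted form g occurs only at the right end of the argument of \<phi>, where
  translation by x acts.\<close>

lemma convolution_translation:
  assumes f: "f \<in> Hecke_space" and \<phi>: "\<phi> \<in> Ind" and x: "x \<in> carrier G"
  shows "f \<star> right_translation G x \<phi> = right_translation G x (f \<star> \<phi>)"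
proof
  fix g
  show "(f \<star> right_translation G x \<phi>) g = right_translation G x (f \<star> \<phi>) g"
  proof (cases "g \<in> carrier G")
    case True
    have "(f \<star> right_translation G x \<phi>) g = (\<Sum>h\<in>R. f (inv h) * \<phi> (h \<otimes> (g \<otimes> x)))"
      unfolding convolution_alt[OF f Ind_translation[OF \<phi> x] True]
      using x True by (simp add: right_translation_def m_assoc)
    then show ?thesis
      using x True by (simp add: convolution_alt[OF f \<phi>] right_translation_def)
  qed (simp add: right_translation_def convolution_def)
qed

lemma convolution_assoc:
  assumes "f \<in> Hecke_space" "f' \<in> Hecke_space" "\<phi> \<in> Ind"
  shows "f \<star> (f' \<star> \<phi>) = (f \<star> f') \<star> \<phi>"
proof
  fix g
  have f': "f' \<in> Ind" using assms Hecke_subset_Ind by blast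
  show "(f \<star> (f' \<star> \<phi>)) g = ((f \<star> f') \<star> \<phi>) g"
  proof (cases "g \<in> carrier G")
    case True
    \<comment> \<open>The outer convolution is taken in the shifted form and the inner one in the
      defining form. After exchanging the sums, the sum over h is the shifted form of
      \<open>f \<star> f'\<close>.\<close>
    have "(f \<star> (f' \<star> \<phi>)) g = (\<Sum>h\<in>R. \<Sum>k\<in>R. f (inv h) * f' (h \<otimes> g \<otimes> inv k) * \<phi> k)"
      using True assms
      by (simp add: convolution_alt[OF assms(1) convolution_Ind])
         (simp add: convolution_def sum_distrib_left mult.assoc)
    also have "\<dots> = (\<Sum>k\<in>R. \<Sum>h\<in>R. f (inv h) * f' (h \<otimes> (g \<otimes> inv k)) * \<phi> k)"
      using True by (subst sum.swap) (simp add: m_assoc)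
    also have "\<dots> = (\<Sum>k\<in>R. (f \<star> f') (g \<otimes> inv k) * \<phi> k)"
      using True by (simp add: convolution_alt[OF assms(1) f'] sum_distrib_right)
    finally show ?thesis using True by (simp add: convolution_def)
  qed (simp add: convolution_def)
qed

text \<open>As a function of g, f (g r^-1) is a right translate of f. Hence the image of convolution
  by f lies in the representation generated by f and is spanned by finitely many translates.\<close>

lemma convolution_expand: "f \<star> \<phi> = (\<Sum>r\<in>R. \<phi> r *\<^sub>f right_translation G (inv r) f)"
  by (auto simp: fun_eq_iff sum_fun_apply fscale_def right_translation_def convolution_def mult.commute)

lemma convolution_generated: "f \<star> \<phi> \<in> generated_rep G f"
  unfolding convolution_expand generated_rep_def
  by (intro fvs.span_sum fvs.span_scale fvs.span_base) auto

lemma Hecke_unit_convolution: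
  assumes "\<phi> \<in> Ind"
  shows "Hecke_unit \<star> \<phi> = \<phi>"
proof
  fix g
  show "(Hecke_unit \<star> \<phi>) g = \<phi> g"
  proof (cases "g \<in> carrier G")
    case True
    have "(\<Sum>h\<in>R. Hecke_unit (g \<otimes> inv h) * \<phi> h)
        = (\<Sum>h\<in>R. if h = rep g then \<theta> (g \<otimes> inv h) * \<phi> h else 0)"
    proof (intro sum.cong refl)
      fix h assume "h \<in> R"
      then have "g \<otimes> inv h \<in> Q \<longleftrightarrow> h = rep g" using rep(2)[OF True] rep_eqI[OF True] by blast
      then show "Hecke_unit (g \<otimes> inv h) * \<phi> h
          = (if h = rep g then \<theta> (g \<otimes> inv h) * \<phi> h else 0)"
        unfolding Hecke_unit_def by (cases "h = rep g") simp_all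
    qed
    also have "\<dots> = \<theta> (g \<otimes> inv (rep g)) * \<phi> (rep g)"
      using R_finite rep(1)[OF True] by simp
    also have "\<dots> = \<phi> ((g \<otimes> inv (rep g)) \<otimes> rep g)"
      using Ind_eq[OF assms rep(2)[OF True], of "rep g"] rep(1)[OF True] by simp
    also have "\<dots> = \<phi> g" using rep_decomp[OF True] by simp
    finally show ?thesis using True by (simp add: convolution_def)
  qed (simp add: convolution_def Ind_outside assms)
qed

text \<open>Inversion turns the shifted form of \<open>f \<star> f'\<close> into the defining form
  of \<open>f' \<star> f\<close>; \<sigma> and \<tau> are the eigenvalues of the two functions under
  inversion.\<close>

lemma convolution_reverse:
  assumes f: "f \<in> Hecke_space" and f': "f' \<in> Hecke_space"
    and \<sigma>: "\<And>g. g \<in> carrier G \<Longrightarrow> f (inv g) = \<sigma> * f g"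
    and \<tau>: "\<And>g. g \<in> carrier G \<Longrightarrow> f' (inv g) = \<tau> * f' g" and g: "g \<in> carrier G"
  shows "(f \<star> f') (inv g) = \<sigma> * \<tau> * (f' \<star> f) g"
proof -
  have Ind: "f \<in> Ind" "f' \<in> Ind" using f f' Hecke_subset_Ind by auto
  have "(f \<star> f') (inv g) = (\<Sum>h\<in>R. f (inv h) * f' (inv (g \<otimes> inv h)))"
    using g by (simp add: convolution_alt[OF f Ind(2)] inv_mult_group)
  also have "\<dots> = (\<Sum>h\<in>R. \<sigma> * \<tau> * (f' (g \<otimes> inv h) * f h))"
    using g by (intro sum.cong) (simp_all add: \<sigma> \<tau> mult_ac)
  also have "\<dots> = \<sigma> * \<tau> * (f' \<star> f) g"
    using g by (simp add: convolution_def sum_distrib_left)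
  finally show ?thesis .
qed

text \<open>\<open>e / \<kappa>\<close> is idempotent, so its image is its fixed space. The factor
  \<kappa> is carried along because the vectors of the theorem are not normalised.\<close>

lemma generated_rep_eq_eigenspace:
  assumes e: "e \<in> Hecke_space" and ee: "e \<star> e = \<kappa> *\<^sub>f e" and \<kappa>: "\<kappa> \<noteq> 0"
  shows "generated_rep G e = {\<phi> \<in> Ind. e \<star> \<phi> = \<kappa> *\<^sub>f \<phi>}"
proof
  have eI: "e \<in> Ind" using e Hecke_subset_Ind by blast
  show "generated_rep G e \<subseteq> {\<phi> \<in> Ind. e \<star> \<phi> = \<kappa> *\<^sub>f \<phi>}"
    unfolding generated_rep_def
  proof (rule fvs.span_minimal)
    show "fvs.subspace {\<phi> \<in> Ind. e \<star> \<phi> = \<kappa> *\<^sub>f \<phi>}"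
      using Ind_subspace
      by (auto simp: fvs.subspace_def convolution_linear fvs.scale_right_distrib mult.commute)
    show "(\<lambda>g. right_translation G g e) ` carrier G \<subseteq> {\<phi> \<in> Ind. e \<star> \<phi> = \<kappa> *\<^sub>f \<phi>}"
      using eI by (auto simp: Ind_translation convolution_translation e ee right_translation_linear)
  qed
  show "{\<phi> \<in> Ind. e \<star> \<phi> = \<kappa> *\<^sub>f \<phi>} \<subseteq> generated_rep G e"
  proof
    fix \<phi> assume "\<phi> \<in> {\<phi> \<in> Ind. e \<star> \<phi> = \<kappa> *\<^sub>f \<phi>}"
    then have "\<phi> = (1/\<kappa>) *\<^sub>f (e \<star> \<phi>)" using \<kappa> by simp
    then show "\<phi> \<in> generated_rep G e"
      using convolution_generated[of e \<phi>] unfolding generated_rep_def by (metis fvs.span_scale)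
  qed
qed

text \<open>The translates of a vector by \<open>Q\<close>, twisted by \<open>\<theta>\<close>, form a finite set because a function in
  \<^term>\<open>Ind\<close> is determined by its values on \<open>R\<close>; their sum is the required equivariant vector.\<close>

lemma subrepresentation_contains_Hecke:
  assumes U: "subrepresentation G U" "U \<subseteq> Ind" "U \<noteq> {0}"
  shows "\<exists>f\<in>U \<inter> Hecke_space. f \<noteq> 0"
proof -
  have sub: "fvs.subspace U" and tr: "\<And>g \<phi>. g \<in> carrier G \<Longrightarrow> \<phi> \<in> U \<Longrightarrow> right_translation G g \<phi> \<in> U"
    using U(1) by (auto simp: subrepresentation_def)
  obtain \<phi>0 where \<phi>0: "\<phi>0 \<in> U" "\<phi>0 \<noteq> 0" using U(3) fvs.subspace_0[OF sub] by blast
  then obtain g where g: "\<phi>0 g \<noteq> 0" by (auto simp: fun_eq_iff)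
  then have gc: "g \<in> carrier G" using \<phi>0 U(2) Ind_outside by blast
  define \<phi> where "\<phi> = right_translation G g \<phi>0"
  have \<phi>: "\<phi> \<in> U" "\<phi> \<in> Ind" "\<phi> \<one> \<noteq> 0"
    using \<phi>0 gc g tr U(2) by (auto simp: \<phi>_def right_translation_def)
  define tw where "tw = (\<lambda>q. \<theta> q *\<^sub>f right_translation G q \<phi>)"
  have twU: "tw q \<in> U" if "q \<in> Q" for q
    using that \<phi>(1) tr sub by (simp add: tw_def fvs.subspace_scale)
  have finO: "finite (tw ` Q)"
  proof (rule finite_imageD)
    let ?res = "\<lambda>\<psi> :: 'a \<Rightarrow> complex. restrict \<psi> R"
    \<comment> \<open>Each value \<phi> (r q) is, up to sign, the value of \<phi> at the
      representative of r q, so only finitely many restrictions to \<open>R\<close> occur.\<close>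
    let ?C = "(\<lambda>r. \<phi> r) ` R \<union> (\<lambda>r. - \<phi> r) ` R"
    show "inj_on ?res (tw ` Q)"
    proof (rule inj_onI)
      fix \<psi> \<psi>' assume "\<psi> \<in> tw ` Q" "\<psi>' \<in> tw ` Q" "?res \<psi> = ?res \<psi>'"
      then show "\<psi> = \<psi>'" using twU U(2)
        by (intro Ind_determined) (auto simp: restrict_def fun_eq_iff split: if_splits)
    qed
    have "tw q r \<in> ?C" if "q \<in> Q" "r \<in> R" for q r
    proof -
      let ?x = "r \<otimes> q"
      have x: "?x \<in> carrier G" using that by simp
      have "tw q r = \<theta> q * \<phi> ?x" using that by (simp add: tw_def fscale_def right_translation_def)
      also have "\<phi> ?x = \<theta> (?x \<otimes> inv (rep ?x)) * \<phi> (rep ?x)"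
        using Ind_eq[OF \<phi>(2) rep(2)[OF x], of "rep ?x"] rep_decomp[OF x] rep(1)[OF x]
        by (metis R_closed)
      finally show ?thesis
        using rep(1)[OF x] theta_values[OF rep(2)[OF x]] theta_values[OF that(1)] by auto
    qed
    then have "?res ` tw ` Q \<subseteq> (\<Pi>\<^sub>E r\<in>R. ?C)" by (simp add: image_subset_iff restrict_PiE_iff)
    then show "finite (?res ` tw ` Q)"
      by (rule finite_subset) (intro finite_PiE R_finite finite_UnI finite_imageI)
  qed
  define f where "f = \<Sum>(tw ` Q)"
  have fU: "f \<in> U" unfolding f_def using twU sub by (auto intro!: fvs.subspace_sum)
  \<comment> \<open>At the identity every twisted translate has the value of \<phi> there, because
    \<open>\<theta> q\<close> occurs twice; the sum therefore cannot cancel.\<close>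
  have "f \<one> = (\<Sum>\<psi>\<in>tw ` Q. \<phi> \<one>)"
    unfolding f_def sum_fun_apply
  proof (intro sum.cong refl)
    fix \<psi> assume "\<psi> \<in> tw ` Q"
    then obtain q where "q \<in> Q" "\<psi> = tw q" by blast
    then show "\<psi> \<one> = \<phi> \<one>"
      using Ind_eq[OF \<phi>(2), of q \<one>] theta_square[of q]
      by (simp add: tw_def fscale_def right_translation_def mult.assoc[symmetric])
  qed
  moreover have "tw ` Q \<noteq> {}" using Q_one by blast
  ultimately have "f \<noteq> 0" using \<phi>(3) finO by auto
  moreover have "f \<in> Hecke_space"
  proof (rule Hecke_spaceI)
    fix q g assume q: "q \<in> Q" and g: "g \<in> carrier G"
    let ?a = "\<lambda>\<psi>. \<theta> q *\<^sub>f right_translation G q \<psi>"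
    have a_tw: "?a (tw q') = tw (q \<otimes> q')" if "q' \<in> Q" for q'
      using that q by (simp add: tw_def right_translation_linear right_translation_mult theta_mult)
    have "?a ` tw ` Q = tw ` Q"
    proof
      show "?a ` tw ` Q \<subseteq> tw ` Q" using q a_tw by auto
      show "tw ` Q \<subseteq> ?a ` tw ` Q"
      proof
        fix \<psi> assume "\<psi> \<in> tw ` Q"
        then obtain q' where q': "q' \<in> Q" "\<psi> = tw q'" by blast
        then have "\<psi> = ?a (tw (inv q \<otimes> q'))" using q a_tw by (simp add: m_assoc[symmetric])
        then show "\<psi> \<in> ?a ` tw ` Q" using q q' by (metis Q_inv Q_mult imageI)
      qed
    qed
    \<comment> \<open>A map of a finite set onto itself permutes it, so \<open>?a\<close> fixes the
      sum of the set.\<close>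
    then have "inj_on ?a (tw ` Q)" using finO by (simp add: eq_card_imp_inj_on)
    then have "(\<Sum>\<psi>\<in>tw ` Q. ?a \<psi>) = f"
      using \<open>?a ` tw ` Q = tw ` Q\<close> sum.reindex[of ?a "tw ` Q" "\<lambda>x. x"]
      unfolding f_def by (simp only: o_def)
    then have "?a f = f"
      unfolding f_def by (simp only: right_translation_sum fvs.scale_sum_right)
    then have "\<theta> q * (\<theta> q * f (g \<otimes> q)) = \<theta> q * f g"
      using g by (metis fscale_def right_translation_def)
    then show "f (g \<otimes> q) = \<theta> q * f g" using theta_square[OF q] by (simp add: mult.assoc[symmetric])
  qed (use fU U(2) in blast)
  ultimately show ?thesis using fU by blast
qed

section \<open>Orthogonal systems of idempotents in the Hecke algebra\<close>

context
  fixes J :: "'j set" and e :: "'j \<Rightarrow> 'a \<Rightarrow> complex" and \<kappa> :: "'j \<Rightarrow> complex"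
  assumes J: "finite J" and e: "\<And>j. j \<in> J \<Longrightarrow> e j \<in> Hecke_space"
    and \<kappa>: "\<And>j. j \<in> J \<Longrightarrow> \<kappa> j \<noteq> 0"
    and idem: "\<And>j. j \<in> J \<Longrightarrow> e j \<star> e j = \<kappa> j *\<^sub>f e j"
    and orth: "\<And>i j. i \<in> J \<Longrightarrow> j \<in> J \<Longrightarrow> i \<noteq> j \<Longrightarrow> e i \<star> e j = 0"
begin

text \<open>On its own summand \<open>e j\<close> is the scalar \<open>\<kappa> j\<close>, so \<phi>
  may be replaced by a multiple of \<open>e j \<star> \<phi>\<close> and associativity
  applies.\<close>

lemma orthogonal_convolution:
  assumes "i \<in> J" "j \<in> J" "\<phi> \<in> generated_rep G (e j)"
  shows "e i \<star> \<phi> = (if i = j then \<kappa> j *\<^sub>f \<phi> else 0)"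
proof (cases "i = j")
  case False
  have \<phi>: "\<phi> \<in> Ind" "e j \<star> \<phi> = \<kappa> j *\<^sub>f \<phi>"
    using assms generated_rep_eq_eigenspace[OF e idem \<kappa>] by auto
  have "\<kappa> j *\<^sub>f (e i \<star> \<phi>) = e i \<star> (e j \<star> \<phi>)" by (simp add: \<phi> convolution_linear)
  also have "\<dots> = 0"
    using convolution_assoc[OF e[OF assms(1)] e[OF assms(2)] \<phi>(1)] orth[OF assms(1,2) False]
    by (simp add: convolution_linear(4))
  finally show ?thesis using \<kappa>[OF assms(2)] False by (simp add: fvs.scale_eq_0_iff)
qed (use assms generated_rep_eq_eigenspace[OF e idem \<kappa>] in auto)

lemma internal_direct_sum_generated:
  assumes unit: "(\<Sum>j\<in>J. (1 / \<kappa> j) *\<^sub>f e j) = Hecke_unit"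
  shows "internal_direct_sum Ind J (\<lambda>j. generated_rep G (e j))"
  unfolding internal_direct_sum_def
proof (intro conjI ballI)
  let ?W = "\<lambda>j. generated_rep G (e j)"
  show "fvs.subspace (?W j)" for j by (simp add: generated_rep_def)
  have gen: "?W j = {\<phi> \<in> Ind. e j \<star> \<phi> = \<kappa> j *\<^sub>f \<phi>}" if "j \<in> J" for j
    using that e idem \<kappa> by (intro generated_rep_eq_eigenspace)
  \<comment> \<open>Convolution with \<open>e i\<close> reads off the component \<open>x i\<close>
    up to the nonzero factor \<open>\<kappa> i\<close>, which yields injectivity.\<close>
  have proj: "e i \<star> (\<Sum>j\<in>J. x j) = \<kappa> i *\<^sub>f x i" if "x \<in> (\<Pi>\<^sub>E j\<in>J. ?W j)" "i \<in> J" for x i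
  proof -
    have "e i \<star> (\<Sum>j\<in>J. x j) = (\<Sum>j\<in>J. if i = j then \<kappa> j *\<^sub>f x j else 0)"
      unfolding convolution_sum using that
      by (intro sum.cong refl orthogonal_convolution) (auto simp: PiE_def)
    then show ?thesis using that J by simp
  qed
  show "bij_betw (\<lambda>x. \<Sum>j\<in>J. x j) (\<Pi>\<^sub>E j\<in>J. ?W j) Ind"
    unfolding bij_betw_def
  proof
    show "inj_on (\<lambda>x. \<Sum>j\<in>J. x j) (\<Pi>\<^sub>E j\<in>J. ?W j)"
    proof (rule inj_onI)
      fix x y assume xy: "x \<in> (\<Pi>\<^sub>E j\<in>J. ?W j)" "y \<in> (\<Pi>\<^sub>E j\<in>J. ?W j)" "sum x J = sum y J"
      have "x i = y i" if "i \<in> J" for i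
        using proj[OF xy(1) that] proj[OF xy(2) that] xy(3) \<kappa>[OF that] by simp
      with xy show "x = y" by (intro PiE_ext) auto
    qed
    show "(\<lambda>x. \<Sum>j\<in>J. x j) ` (\<Pi>\<^sub>E j\<in>J. ?W j) = Ind"
    proof
      show "(\<lambda>x. \<Sum>j\<in>J. x j) ` (\<Pi>\<^sub>E j\<in>J. ?W j) \<subseteq> Ind"
        using gen Ind_subspace by (auto intro!: fvs.subspace_sum simp: PiE_def Pi_def)
      show "Ind \<subseteq> (\<lambda>x. \<Sum>j\<in>J. x j) ` (\<Pi>\<^sub>E j\<in>J. ?W j)"
      proof
        fix \<phi> assume \<phi>: "\<phi> \<in> Ind"
        let ?x = "\<lambda>j\<in>J. (1 / \<kappa> j) *\<^sub>f (e j \<star> \<phi>)"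
        have "(\<Sum>j\<in>J. ?x j) = \<phi>"
          using Hecke_unit_convolution[OF \<phi>]
          by (simp add: unit[symmetric] convolution_sum convolution_linear)
        moreover have "?x \<in> (\<Pi>\<^sub>E j\<in>J. ?W j)"
          unfolding restrict_PiE_iff
          using convolution_generated by (simp add: generated_rep_def fvs.span_scale)
        ultimately show "\<phi> \<in> (\<lambda>x. \<Sum>j\<in>J. x j) ` (\<Pi>\<^sub>E j\<in>J. ?W j)" 
          by (intro image_eqI[of _ _ ?x]) simp_all
      qed
    qed
  qed
qed (rule J)

text \<open>A nonzero subrepresentation U of the summand contains a nonzero Hecke vector. Applying
  \<open>e j\<close> to its expansion kills every term but the j-th, so the vector is a multiple of
  \<open>e j\<close>, and U contains the generator.\<close>

lemma irreducible_generated: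
  assumes j: "j \<in> J" "e j \<noteq> 0" and span: "Hecke_space \<subseteq> fvs.span (e ` J)"
  shows "irreducible_rep G (generated_rep G (e j))"
  unfolding irreducible_rep_def
proof (intro conjI allI impI)
  let ?W = "generated_rep G (e j)"
  have gen: "?W = {\<phi> \<in> Ind. e j \<star> \<phi> = \<kappa> j *\<^sub>f \<phi>}"
    using j e idem \<kappa> by (intro generated_rep_eq_eigenspace) auto
  have self: "e i \<in> generated_rep G (e i)" if "i \<in> J" for i
    using e[OF that] by (intro generated_rep_self) (simp add: Hecke_space_def)
  show "subrepresentation G ?W" by (rule generated_rep_subrepresentation)
  show "?W \<noteq> {0}" using self j by blast
  fix U assume U: "subrepresentation G U \<and> U \<subseteq> ?W"
  show "U = {0} \<or> U = ?W"
  proof (rule disjCI)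
    assume "U \<noteq> ?W"
    show "U = {0}"
    proof (rule ccontr)
      assume "U \<noteq> {0}"
      then obtain f where f: "f \<in> U" "f \<in> Hecke_space" "f \<noteq> 0"
        using subrepresentation_contains_Hecke[of U] U gen by blast
      obtain a where a: "f = (\<Sum>i\<in>J. a i *\<^sub>f e i)"
        using fvs.span_eq_scale_sum[OF J] f(2) span by blast
      have "\<kappa> j *\<^sub>f f = e j \<star> f" using f(1) U gen by auto
      also have "\<dots> = (\<Sum>i\<in>J. if j = i then (a i * \<kappa> i) *\<^sub>f e i else 0)"
        unfolding a convolution_sum convolution_linear
        using j by (intro sum.cong refl) (simp add: orthogonal_convolution[OF _ _ self])
      also have "\<dots> = \<kappa> j *\<^sub>f (a j *\<^sub>f e j)" using J j by (simp add: mult.commute)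
      finally have fa: "f = a j *\<^sub>f e j" using \<kappa>[OF j(1)] by (metis fvs.scale_cancel_left)
      with f have aj: "a j \<noteq> 0" by auto
      have "e j = (1 / a j) *\<^sub>f f" using aj by (simp add: fa)
      then have "e j \<in> U" using f U by (metis fvs.subspace_scale subrepresentation_def)
      then show False using generated_rep_minimal[of G U "e j"] U \<open>U \<noteq> ?W\<close> by blast
    qed
  qed
qed

end

text \<open>The dimension is the trace of the projection \<open>\<phi> \<mapsto> (1 / \<kappa>) *\<^sub>f (e \<star> \<phi>)\<close>, computed by expanding
  its kernel in a basis of the image.\<close>

lemma dim_generated:
  assumes e: "e \<in> Hecke_space" and ee: "e \<star> e = \<kappa> *\<^sub>f e" and \<kappa>: "\<kappa> \<noteq> 0"
  shows "of_nat (fvs.dim (generated_rep G e)) = of_nat (card R) * e \<one> / \<kappa>"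
proof -
  let ?W = "generated_rep G e"
  have gen: "?W = {\<phi> \<in> Ind. e \<star> \<phi> = \<kappa> *\<^sub>f \<phi>}" by (rule generated_rep_eq_eigenspace[OF assms])
  obtain B where B: "B \<subseteq> ?W" "fvs.independent B" "?W \<subseteq> fvs.span B" "card B = fvs.dim ?W"
    using fvs.basis_exists by blast
  let ?t = "\<lambda>r. right_translation G (inv r) e"
  have "?W \<subseteq> fvs.span (?t ` R)"
  proof
    fix \<phi> assume "\<phi> \<in> ?W"
    then have "\<phi> = (1/\<kappa>) *\<^sub>f (e \<star> \<phi>)" using \<kappa> gen by simp
    also have "\<dots> \<in> fvs.span (?t ` R)" unfolding convolution_expand
      by (intro fvs.span_scale fvs.span_sum fvs.span_base) auto
    finally show "\<phi> \<in> fvs.span (?t ` R)" .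
  qed
  then have finB: "finite B"
    using fvs.independent_span_bound[of "?t ` R" B] B R_finite by blast
  have "\<exists>c. ?t r = (\<Sum>b\<in>B. c b *\<^sub>f b)" if "r \<in> R" for r
  proof -
    have "?t r \<in> ?W" using that unfolding generated_rep_def by (intro fvs.span_base) auto
    then have "?t r \<in> fvs.span ((\<lambda>x. x) ` B)" using B by auto
    from fvs.span_eq_scale_sum[OF finB this] show ?thesis .
  qed
  then obtain c where c: "\<And>r. r \<in> R \<Longrightarrow> ?t r = (\<Sum>b\<in>B. c r b *\<^sub>f b)" by metis
  \<comment> \<open>This is the coordinate along b of \<open>e \<star> b\<close>, that is, a
    diagonal entry of the convolution operator in the basis \<open>B\<close>.\<close>
  have "(\<Sum>r\<in>R. b r * c r b) = \<kappa>" if b: "b \<in> B" for b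
  proof -
    have "\<kappa> *\<^sub>f b = e \<star> b" using b B gen by auto
    also have "\<dots> = (\<Sum>r\<in>R. b r *\<^sub>f (\<Sum>b'\<in>B. c r b' *\<^sub>f b'))"
      unfolding convolution_expand by (intro sum.cong refl) (simp add: c)
    also have "\<dots> = (\<Sum>b'\<in>B. (\<Sum>r\<in>R. b r * c r b') *\<^sub>f b')"
      by (simp add: fvs.scale_sum_right fvs.scale_sum_left) (rule sum.swap)
    finally have "(\<Sum>b'\<in>B. (\<Sum>r\<in>R. b r * c r b') *\<^sub>f b') = (\<Sum>b'\<in>B. (if b' = b then \<kappa> else 0) *\<^sub>f b')"
      using b finB by (simp add: if_distrib[of "\<lambda>c. c *\<^sub>f _"] cong: if_cong)
    then have "(\<Sum>b'\<in>B. ((\<Sum>r\<in>R. b r * c r b') - (if b' = b then \<kappa> else 0)) *\<^sub>f b') = 0"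
      by (simp add: fvs.scale_left_diff_distrib sum_subtractf)
    then have "(\<Sum>r\<in>R. b r * c r b) - (if b = b then \<kappa> else 0) = 0"
      by (rule fvs.independentD[OF B(2) finB order.refl _ b])
    then show ?thesis by simp
  qed
  \<comment> \<open>The trace in two ways: as the sum of the diagonal entries over the basis, and as
    the sum of the diagonal values e (r r^-1) of the kernel.\<close>
  then have "of_nat (card B) * \<kappa> = (\<Sum>b\<in>B. \<Sum>r\<in>R. b r * c r b)" by simp
  also have "\<dots> = (\<Sum>r\<in>R. (\<Sum>b\<in>B. c r b *\<^sub>f b) r)"
    by (subst sum.swap) (simp add: sum_fun_apply fscale_def mult.commute)
  also have "\<dots> = (\<Sum>r\<in>R. ?t r r)" by (simp add: c)
  also have "\<dots> = of_nat (card R) * e \<one>" by (simp add: right_translation_def)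
  finally show ?thesis using \<kappa> B(4) by (simp add: field_simps)
qed

end

section \<open>Sums of Legendre symbols\<close>

lemma Legendre_cong:
  assumes "[a = b] (mod m)"
  shows "Legendre a m = Legendre b m"
proof -
  have "[a = 0] (mod m) \<longleftrightarrow> [b = 0] (mod m)" "QuadRes m a \<longleftrightarrow> QuadRes m b"
    unfolding QuadRes_def using assms by (meson cong_trans cong_sym)+
  then show ?thesis by (simp add: Legendre_def)
qed

lemma Legendre_values: "Legendre a m \<in> {-1, 0, 1}"
  by (simp add: Legendre_def)

text \<open>By Euler's criterion the two sides agree modulo p. Each is at most 1 in absolute value,
  so a difference divisible by p > 2 vanishes.\<close>

lemma Legendre_mult:
  fixes p :: nat
  assumes "Factorial_Ring.prime p" "2 < p"
  shows "Legendre (a * b) (int p) = Legendre a (int p) * Legendre b (int p)"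
proof -
  have "[Legendre (a * b) (int p) = (a * b) ^ ((p - 1) div 2)] (mod int p)"
    by (rule euler_criterion[OF assms])
  also have "(a * b) ^ ((p - 1) div 2) = a ^ ((p - 1) div 2) * b ^ ((p - 1) div 2)"
    by (rule power_mult_distrib)
  also have "[a ^ ((p - 1) div 2) * b ^ ((p - 1) div 2) = Legendre a (int p) * Legendre b (int p)] (mod int p)"
    by (intro cong_mult cong_sym[OF euler_criterion[OF assms]])
  finally have "int p dvd Legendre (a * b) (int p) - Legendre a (int p) * Legendre b (int p)"
    by (simp add: cong_iff_dvd_diff)
  moreover have "\<bar>Legendre (a * b) (int p) - Legendre a (int p) * Legendre b (int p)\<bar> < int p"
  proof -
    have "\<bar>x - y * z\<bar> \<le> 2" if "x \<in> {-1, 0, 1}" "y \<in> {-1, 0, 1}" "z \<in> {-1, 0, 1}" for x y z :: int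
      using that by auto
    from this[OF Legendre_values Legendre_values Legendre_values] show ?thesis
      using assms(2) by (metis (no_types) nat_int_comparison(2) of_nat_numeral order.strict_trans1)
  qed
  ultimately show ?thesis
    using dvd_imp_le_int[of "Legendre (a * b) (int p) - Legendre a (int p) * Legendre b (int p)" "int p"]
    by linarith
qed

lemma sum_affine_residues:
  fixes F :: "int \<Rightarrow> 'b::comm_monoid_add"
  assumes per: "\<And>x y. [x = y] (mod m) \<Longrightarrow> F x = F y" and m: "m > 0" and a: "coprime a m"
  shows "(\<Sum>t\<in>{0..<m}. F (a * t + b)) = (\<Sum>t\<in>{0..<m}. F t)"
proof -
  let ?h = "\<lambda>t. (a * t + b) mod m"
  have inj: "inj_on ?h {0..<m}"
  proof (rule inj_onI)
    fix x y assume xy: "x \<in> {0..<m}" "y \<in> {0..<m}" and "?h x = ?h y"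
    then have "[a * x + b = a * y + b] (mod m)" by (simp add: cong_def)
    then have "[a * x = a * y] (mod m)" by (simp add: cong_add_rcancel)
    then have "[x = y] (mod m)" using a by (simp add: cong_mult_lcancel)
    then show "x = y" using xy by (simp add: cong_def)
  qed
  moreover have "?h ` {0..<m} \<subseteq> {0..<m}" using m by auto
  ultimately have bij: "bij_betw ?h {0..<m} {0..<m}" by (simp add: bij_betw_def endo_inj_surj)
  have "F (a * t + b) = F (?h t)" for t by (rule per) (simp add: cong_def)
  then show ?thesis using sum.reindex_bij_betw[OF bij, of F] by simp
qed

lemma sum_periodic:
  fixes F :: "int \<Rightarrow> 'b::semiring_1"
  assumes per: "\<And>x y. [x = y] (mod m) \<Longrightarrow> F x = F y" and m: "m > 0"
  shows "(\<Sum>t\<in>{0..<m * int N}. F t) = of_nat N * (\<Sum>t\<in>{0..<m}. F t)"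
proof (induction N)
  case (Suc N)
  have "{0..<m * int (Suc N)} = {0..<m * int N} \<union> (\<lambda>t. t + m * int N) ` {0..<m}"
  proof -
    have "{0..<k + m} = {0..<k} \<union> {0 + k..<m + k}" if "0 \<le> k" for k using that m by auto
    from this[of "m * int N"] show ?thesis
      using m by (simp add: image_add_atLeastLessThan' algebra_simps)
  qed
  moreover have "{0..<m * int N} \<inter> (\<lambda>t. t + m * int N) ` {0..<m} = {}" by auto
  moreover have "(\<Sum>t\<in>(\<lambda>t. t + m * int N) ` {0..<m}. F t) = (\<Sum>t\<in>{0..<m}. F t)"
    by (subst sum.reindex) (auto simp: inj_on_def cong_def intro!: sum.cong per)
  ultimately show ?case using Suc by (simp add: sum.union_disjoint algebra_simps)
qed simp

text \<open>Scaling shows that the sum does not depend on \<open>m\<close>; summing over all \<open>m\<close> determines it.\<close>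

lemma sum_Legendre:
  fixes p :: nat and a :: int
  assumes p: "Factorial_Ring.prime p" "2 < p" and a: "\<not> QuadRes (int p) a"
  shows "(\<Sum>t\<in>{0..<int p}. Legendre t (int p)) = 0"
    and "(\<Sum>t\<in>{0..<int p}. Legendre t (int p) * Legendre (t + m) (int p))
          = (if int p dvd m then int p - 1 else -1)"
proof -
  let ?L = "\<lambda>t. Legendre t (int p)"
  have cop: "coprime b (int p)" if "\<not> int p dvd b" for b
    using that p(1) by (metis coprime_commute prime_imp_coprime prime_nat_int_transfer)
  have a0: "\<not> int p dvd a"
  proof
    assume "int p dvd a"
    then have "[0\<^sup>2 = a] (mod int p)" by (auto simp: cong_def mod_eq_0_iff_dvd)
    then show False using a unfolding QuadRes_def by blast
  qed
  then have "?L a = -1" using a by (simp add: Legendre_def cong_0_iff)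
  \<comment> \<open>Multiplication by the nonresidue a permutes the residues and negates each
    symbol.\<close>
  then have "(\<Sum>t\<in>{0..<int p}. ?L t) = - (\<Sum>t\<in>{0..<int p}. ?L t)"
    using sum_affine_residues[where F = ?L and m = "int p" and a = a and b = 0] Legendre_cong cop[OF a0] p
    by (simp add: Legendre_mult sum_negf)
  then show sum0: "(\<Sum>t\<in>{0..<int p}. ?L t) = 0" by simp
  define S where "S = (\<lambda>m. \<Sum>t\<in>{0..<int p}. ?L t * ?L (t + m))"
  have per: "[x = y] (mod int p) \<Longrightarrow> ?L x * ?L (x + m) = ?L y * ?L (y + m)" for x y m
    by (metis Legendre_cong cong_add_rcancel)
  have sq: "?L t * ?L t = (if int p dvd t then 0 else 1)" for t
    using Legendre_values[of t "int p"] by (auto simp: Legendre_def cong_0_iff)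
  have S1: "S m = S 1" if "\<not> int p dvd m" for m
  proof -
    have "S m = (\<Sum>t\<in>{0..<int p}. ?L (m * t + 0) * ?L ((m * t + 0) + m))"
      unfolding S_def using p cop[OF that]
      by (intro sum_affine_residues[symmetric, where F = "\<lambda>t. ?L t * ?L (t + m)"] per) auto
    also have "\<dots> = (\<Sum>t\<in>{0..<int p}. (?L m * ?L m) * (?L t * ?L (t + 1)))"
    proof (rule sum.cong)
      fix t
      have "?L ((m * t + 0) + m) = ?L m * ?L (t + 1)"
        by (subst Legendre_mult[OF p, symmetric]) (simp add: algebra_simps)
      then show "?L (m * t + 0) * ?L ((m * t + 0) + m) = (?L m * ?L m) * (?L t * ?L (t + 1))"
        by (simp add: Legendre_mult[OF p])
    qed simp
    finally show ?thesis using that by (simp add: sq S_def)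
  qed
  have card: "card {1..<int p} = p - 1" by simp
  have split: "{0..<int p} = insert 0 {1..<int p}" using p by auto
  have ndvd: "\<not> int p dvd t" if "t \<in> {1..<int p}" for t
    using that zdvd_not_zless by auto
  have S0: "S m = int p - 1" if "int p dvd m" for m
  proof -
    have "?L (t + m) = ?L t" for t
      using that by (intro Legendre_cong) (simp add: cong_iff_dvd_diff)
    then have "S m = (\<Sum>t\<in>{1..<int p}. if int p dvd t then 0 else 1)"
      unfolding S_def split by (simp add: sq)
    also have "\<dots> = (\<Sum>t\<in>{1..<int p}. 1)" by (intro sum.cong refl) (simp add: ndvd)
    finally have "S m = (\<Sum>t\<in>{1..<int p}. 1)" .
    then show ?thesis using p by simp
  qed
  have "(\<Sum>m\<in>{0..<int p}. S m) = (\<Sum>t\<in>{0..<int p}. ?L t * (\<Sum>m\<in>{0..<int p}. ?L (1 * m + t)))"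
    unfolding S_def by (subst sum.swap) (simp add: sum_distrib_left add.commute)
  also have "\<dots> = 0"
    using p sum0 by (subst sum_affine_residues) (auto intro: Legendre_cong)
  finally have "S 0 + (\<Sum>m\<in>{1..<int p}. S m) = 0" unfolding split by simp
  moreover have "(\<Sum>m\<in>{1..<int p}. S m) = (\<Sum>m\<in>{1..<int p}. S 1)"
    by (intro sum.cong refl S1 ndvd)
  ultimately have "S 0 + (\<Sum>m\<in>{1..<int p}. S 1) = 0" by simp
  then have "(int p - 1) * (1 + S 1) = 0" using S0[of 0] card p by (simp add: algebra_simps)
  then have "S 1 = -1" using p by auto
  with S0 S1 show "(\<Sum>t\<in>{0..<int p}. ?L t * ?L (t + m)) = (if int p dvd m then int p - 1 else -1)"
    by (simp add: S_def)
qed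

text \<open>Hensel lifting: a root v modulo a power of p is corrected by a multiple of that power,
  which is possible because the derivative 2 v is a unit.\<close>

lemma square_lift:
  fixes p :: nat and a u :: int
  assumes p: "Factorial_Ring.prime p" "odd p" and a: "\<not> int p dvd a" and u: "[u\<^sup>2 = a] (mod int p)"
  shows "\<exists>v. [v\<^sup>2 = a] (mod int p ^ N)"
proof -
  have "\<exists>v. [v\<^sup>2 = a] (mod int p ^ Suc N)"
  proof (induction N)
    case 0
    then show ?case using u by auto
  next
    case (Suc N)
    then obtain v where v: "[v\<^sup>2 = a] (mod int p ^ Suc N)" by blast
    then obtain k where k: "a = v\<^sup>2 + int p ^ Suc N * k"
      by (metis cong_iff_lin)
    have "\<not> int p dvd v"
    proof
      assume "int p dvd v"
      then have "int p dvd v\<^sup>2 + int p ^ Suc N * k" by (simp add: power2_eq_square)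
      then show False using a k by simp
    qed
    moreover have "\<not> int p dvd 2"
    proof
      assume "int p dvd 2"
      then have "p dvd 2" by presburger
      then have "p = 2" using p(1) by (metis primes_dvd_imp_eq two_is_prime_nat)
      then show False using p(2) by simp
    qed
    ultimately have "\<not> int p dvd 2 * v"
      using p(1) by (simp add: prime_dvd_mult_iff)
    then have "coprime (2 * v) (int p)"
      using p(1) by (metis coprime_commute prime_imp_coprime prime_nat_int_transfer)
    then obtain w where "[2 * v * w = 1] (mod int p)" using cong_solve_coprime_int by blast
    then obtain j where j: "2 * v * w = 1 + int p * j" by (metis cong_iff_lin cong_sym)
    \<comment> \<open>Here w inverts 2 v modulo p, so the linear term of the square supplies the
      missing multiple k up to a multiple of the next power.\<close>
    have "(v + int p ^ Suc N * (w * k))\<^sup>2 = v\<^sup>2 + (2 * v * w) * (int p ^ Suc N * k)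
        + int p ^ Suc N * int p ^ Suc N * (w * k)\<^sup>2"
      by (simp add: power2_eq_square algebra_simps)
    also have "\<dots> = a + int p ^ Suc (Suc N) * (j * k + int p ^ N * (w * k)\<^sup>2)"
      unfolding j k by (simp add: algebra_simps)
    finally have "[(v + int p ^ Suc N * (w * k))\<^sup>2 = a] (mod int p ^ Suc (Suc N))"
      by (simp add: cong_iff_dvd_diff)
    then show ?case by blast
  qed
  then show ?thesis by (meson cong_dvd_modulus le_imp_power_dvd lessI less_imp_le)
qed

section \<open>Arithmetic in the p-adic integers and in the covering group\<close>

lemma Zp_simps:
  "(x \<otimes>\<^bsub>Zp p\<^esub> y) k = (x k * y k) mod int p ^ k" "(x \<oplus>\<^bsub>Zp p\<^esub> y) k = (x k + y k) mod int p ^ k"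
  "\<one>\<^bsub>Zp p\<^esub> k = 1 mod int p ^ k" "\<zero>\<^bsub>Zp p\<^esub> k = 0"
  by (simp_all add: Zp_def)

lemma Zp_carrier_mod: "x \<in> carrier (Zp p) \<Longrightarrow> x k mod int p ^ k = x k"
  by (simp add: Zp_def)

lemma Zp_coherent:
  assumes "x \<in> carrier (Zp p)" "j \<le> k"
  shows "x k mod int p ^ j = x j"
  using assms(2)
proof (induction k rule: dec_induct)
  case (step k)
  have "x (Suc k) mod int p ^ j = x (Suc k) mod int p ^ k mod int p ^ j"
    using step.hyps by (simp add: mod_mod_cancel le_imp_power_dvd)
  then show ?case using step assms(1) by (simp add: Zp_def)
qed (simp add: Zp_carrier_mod[OF assms(1)])

lemma Zp_minus:
  assumes "p > 0" "x \<in> carrier (Zp p)"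
  shows "(\<ominus>\<^bsub>Zp p\<^esub> x) k = (- x k) mod int p ^ k"
proof -
  interpret cring "Zp p" by (rule Zp_cring[OF assms(1)])
  have "(x \<oplus>\<^bsub>Zp p\<^esub> (\<ominus>\<^bsub>Zp p\<^esub> x)) k = 0" using r_neg[OF assms(2)] by (simp add: Zp_simps)
  then have "int p ^ k dvd (\<ominus>\<^bsub>Zp p\<^esub> x) k - (- x k)" by (simp add: Zp_simps mod_eq_0_iff_dvd add.commute)
  then have "(\<ominus>\<^bsub>Zp p\<^esub> x) k mod int p ^ k = (- x k) mod int p ^ k" by (simp add: mod_eq_dvd_iff)
  then show ?thesis using a_inv_closed[OF assms(2)] by (simp add: Zp_carrier_mod)
qed

lemma Zp_of_int_closed [simp]: "p > 0 \<Longrightarrow> Zp_of_int p m \<in> carrier (Zp p)"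
  by (simp add: Zp_def Zp_of_int_def mod_mod_cancel)

lemma Zp_of_int_hom:
  "Zp_of_int p a \<otimes>\<^bsub>Zp p\<^esub> Zp_of_int p b = Zp_of_int p (a * b)"
  "Zp_of_int p a \<oplus>\<^bsub>Zp p\<^esub> Zp_of_int p b = Zp_of_int p (a + b)"
  "\<one>\<^bsub>Zp p\<^esub> = Zp_of_int p 1" "\<zero>\<^bsub>Zp p\<^esub> = Zp_of_int p 0"
  by (auto simp: Zp_simps Zp_of_int_def fun_eq_iff mod_simps)

lemma Zp_of_int_minus:
  assumes "p > 0"
  shows "\<ominus>\<^bsub>Zp p\<^esub> Zp_of_int p a = Zp_of_int p (- a)"
proof
  fix k
  show "(\<ominus>\<^bsub>Zp p\<^esub> Zp_of_int p a) k = Zp_of_int p (- a) k"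
    unfolding Zp_minus[OF assms Zp_of_int_closed[OF assms]] by (simp add: Zp_of_int_def mod_simps)
qed

lemma Zp_PIdl_iff:
  assumes "p > 0"
  shows "c \<in> PIdl\<^bsub>Zp p\<^esub> (Zp_of_int p (int p ^ n)) \<longleftrightarrow> c \<in> carrier (Zp p) \<and> c n = 0"
proof
  interpret cring "Zp p" by (rule Zp_cring[OF assms])
  assume "c \<in> PIdl\<^bsub>Zp p\<^esub> (Zp_of_int p (int p ^ n))"
  then obtain x where "x \<in> carrier (Zp p)" "c = x \<otimes>\<^bsub>Zp p\<^esub> Zp_of_int p (int p ^ n)"
    by (auto simp: cgenideal_def)
  then show "c \<in> carrier (Zp p) \<and> c n = 0"
    using assms Zp_of_int_closed[OF assms] by (simp add: m_closed) (simp add: Zp_simps Zp_of_int_def)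
next
  assume c: "c \<in> carrier (Zp p) \<and> c n = 0"
  \<comment> \<open>Division by p^n shifts the index: the quotient modulo p^k is read off from c
    modulo p^(n+k).\<close>
  define x where "x = (\<lambda>k. c (n + k) div int p ^ n)"
  have pos: "int p ^ k > 0" for k using assms by simp
  have "x k \<in> {0..<int p ^ k} \<and> x (Suc k) mod int p ^ k = x k" for k
  proof
    have range: "c (n + k) \<in> {0..<int p ^ (n + k)}" using c by (simp add: Zp_def)
    have "x k * int p ^ n = c (n + k)"
      using c Zp_coherent[of c p n "n + k"] by (simp add: x_def dvd_div_mult_self mod_eq_0_iff_dvd)
    then have "x k * int p ^ n < int p ^ k * int p ^ n"
      using range by (simp add: power_add mult.commute)
    then show "x k \<in> {0..<int p ^ k}"
      using range pos[of n] by (simp add: x_def pos_imp_zdiv_nonneg_iff)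
    have "c (n + Suc k) mod (int p ^ n * int p ^ k) = c (n + k)"
      using c Zp_coherent[of c p "n + k" "n + Suc k"] by (simp add: power_add)
    moreover have "c (n + Suc k) mod (int p ^ n * int p ^ k) = int p ^ n * (x (Suc k) mod int p ^ k)"
      using c Zp_coherent[of c p n "n + Suc k"] by (simp add: mod_mult2_eq' zmod_zmult2_eq x_def)
    ultimately show "x (Suc k) mod int p ^ k = x k" using pos[of n] by (simp add: x_def)
  qed
  then have x: "x \<in> carrier (Zp p)" by (simp add: Zp_def)
  have "(x \<otimes>\<^bsub>Zp p\<^esub> Zp_of_int p (int p ^ n)) k = c k" for k
  proof -
    have "x k * int p ^ n = c (n + k)"
      using c Zp_coherent[of c p n "n + k"] by (simp add: x_def dvd_div_mult_self mod_eq_0_iff_dvd)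
    then show ?thesis
      using c Zp_coherent[of c p k "n + k"] by (simp add: Zp_simps Zp_of_int_def mod_simps)
  qed
  then have "c = x \<otimes>\<^bsub>Zp p\<^esub> Zp_of_int p (int p ^ n)" by auto
  with x show "c \<in> PIdl\<^bsub>Zp p\<^esub> (Zp_of_int p (int p ^ n))" by (auto simp: cgenideal_def)
qed

lemma sign_group_group: "group sign_group"
  by (rule groupI) (auto simp: sign_group_def)

lemma Kbar_group: "p > 0 \<Longrightarrow> group (Kbar p)"
  unfolding Kbar_def by (intro DirProd_group cring.SL2_group Zp_cring sign_group_group)

lemma Kbar_mult:
  "((a, b, c, d), \<epsilon>) \<otimes>\<^bsub>Kbar p\<^esub> ((a', b', c', d'), \<epsilon>')
    = ((a \<otimes>\<^bsub>Zp p\<^esub> a' \<oplus>\<^bsub>Zp p\<^esub> b \<otimes>\<^bsub>Zp p\<^esub> c', a \<otimes>\<^bsub>Zp p\<^esub> b' \<oplus>\<^bsub>Zp p\<^esub> b \<otimes>\<^bsub>Zp p\<^esub> d',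
        c \<otimes>\<^bsub>Zp p\<^esub> a' \<oplus>\<^bsub>Zp p\<^esub> d \<otimes>\<^bsub>Zp p\<^esub> c', c \<otimes>\<^bsub>Zp p\<^esub> b' \<oplus>\<^bsub>Zp p\<^esub> d \<otimes>\<^bsub>Zp p\<^esub> d'), \<epsilon> * \<epsilon>')"
  by (simp add: Kbar_def SL2_def sign_group_def)

lemma Kbar_one: "\<one>\<^bsub>Kbar p\<^esub> = ((\<one>\<^bsub>Zp p\<^esub>, \<zero>\<^bsub>Zp p\<^esub>, \<zero>\<^bsub>Zp p\<^esub>, \<one>\<^bsub>Zp p\<^esub>), 1)"
  by (simp add: Kbar_def SL2_def sign_group_def)

lemma Kbar_carrier:
  "((a, b, c, d), \<epsilon>) \<in> carrier (Kbar p) \<longleftrightarrow>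
    a \<in> carrier (Zp p) \<and> b \<in> carrier (Zp p) \<and> c \<in> carrier (Zp p) \<and> d \<in> carrier (Zp p) \<and>
    a \<otimes>\<^bsub>Zp p\<^esub> d \<ominus>\<^bsub>Zp p\<^esub> b \<otimes>\<^bsub>Zp p\<^esub> c = \<one>\<^bsub>Zp p\<^esub> \<and> (\<epsilon> = 1 \<or> \<epsilon> = -1)"
  by (simp add: Kbar_def SL2_def sign_group_def)

lemma Kbar_inv:
  assumes "p > 0" "((a, b, c, d), \<epsilon>) \<in> carrier (Kbar p)"
  shows "inv\<^bsub>Kbar p\<^esub> ((a, b, c, d), \<epsilon>) = ((d, \<ominus>\<^bsub>Zp p\<^esub> b, \<ominus>\<^bsub>Zp p\<^esub> c, a), \<epsilon>)"
proof -
  interpret cring "Zp p" by (rule Zp_cring[OF assms(1)])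
  interpret K: group "Kbar p" by (rule Kbar_group[OF assms(1)])
  have cl: "a \<in> carrier (Zp p)" "b \<in> carrier (Zp p)" "c \<in> carrier (Zp p)" "d \<in> carrier (Zp p)"
    and det: "a \<otimes>\<^bsub>Zp p\<^esub> d \<ominus>\<^bsub>Zp p\<^esub> b \<otimes>\<^bsub>Zp p\<^esub> c = \<one>\<^bsub>Zp p\<^esub>" and \<epsilon>: "\<epsilon> = 1 \<or> \<epsilon> = -1"
    using assms(2) by (auto simp: Kbar_carrier)
  have eqs: "d \<otimes>\<^bsub>Zp p\<^esub> a \<ominus>\<^bsub>Zp p\<^esub> (\<ominus>\<^bsub>Zp p\<^esub> b) \<otimes>\<^bsub>Zp p\<^esub> (\<ominus>\<^bsub>Zp p\<^esub> c) = a \<otimes>\<^bsub>Zp p\<^esub> d \<ominus>\<^bsub>Zp p\<^esub> b \<otimes>\<^bsub>Zp p\<^esub> c"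
    "d \<otimes>\<^bsub>Zp p\<^esub> a \<oplus>\<^bsub>Zp p\<^esub> (\<ominus>\<^bsub>Zp p\<^esub> b) \<otimes>\<^bsub>Zp p\<^esub> c = a \<otimes>\<^bsub>Zp p\<^esub> d \<ominus>\<^bsub>Zp p\<^esub> b \<otimes>\<^bsub>Zp p\<^esub> c"
    "d \<otimes>\<^bsub>Zp p\<^esub> b \<oplus>\<^bsub>Zp p\<^esub> (\<ominus>\<^bsub>Zp p\<^esub> b) \<otimes>\<^bsub>Zp p\<^esub> d = \<zero>\<^bsub>Zp p\<^esub>" "(\<ominus>\<^bsub>Zp p\<^esub> c) \<otimes>\<^bsub>Zp p\<^esub> a \<oplus>\<^bsub>Zp p\<^esub> a \<otimes>\<^bsub>Zp p\<^esub> c = \<zero>\<^bsub>Zp p\<^esub>"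
    "(\<ominus>\<^bsub>Zp p\<^esub> c) \<otimes>\<^bsub>Zp p\<^esub> b \<oplus>\<^bsub>Zp p\<^esub> a \<otimes>\<^bsub>Zp p\<^esub> d = a \<otimes>\<^bsub>Zp p\<^esub> d \<ominus>\<^bsub>Zp p\<^esub> b \<otimes>\<^bsub>Zp p\<^esub> c"
    using cl by algebra+
  show ?thesis
    using K.inv_equality[OF _ assms(2), of "((d, \<ominus>\<^bsub>Zp p\<^esub> b, \<ominus>\<^bsub>Zp p\<^esub> c, a), \<epsilon>)"] cl det \<epsilon> eqs
    by (auto simp: Kbar_mult Kbar_one Kbar_carrier)
qed

section \<open>Entries modulo \<open>p ^ n\<close> and coset representatives\<close>

locale metaplectic_data =
  fixes p n :: nat and \<eta> :: "padic \<Rightarrow> complex" and l :: padic and s :: complex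
  assumes p_prime: "Factorial_Ring.prime p" and p_odd: "odd p" and n_ge: "n \<ge> 2"
    and eta: "\<eta> = triv_char \<or> \<eta> = legendre_char p"
    and l_unit: "l \<in> Units (Zp p)" and l_nonres: "\<not> QuadRes (int p) (l 1)"
    and s_square: "s\<^sup>2 = of_int (p_star p)"
begin

lemma p_gt2: "2 < p" and p_pos [simp]: "0 < p"
  using p_prime p_odd prime_ge_2_nat[OF p_prime] prime_gt_0_nat[OF p_prime]
  by (auto simp: order.strict_iff_order)

lemma p_dvd_mult: "int p dvd a * b \<longleftrightarrow> int p dvd a \<or> int p dvd b"
  using p_prime by (simp add: prime_dvd_mult_iff)

lemma coprime_p: "\<not> int p dvd b \<Longrightarrow> coprime b (int p ^ k)"
  using p_prime by (metis coprime_commute coprime_power_right_iff prime_imp_coprime prime_nat_int_transfer)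

lemma dvd_mult_cancel_unit: "\<not> int p dvd b \<Longrightarrow> int p ^ r dvd a * b \<longleftrightarrow> int p ^ r dvd a"
  using coprime_p[of b r] by (simp add: coprime_commute coprime_dvd_mult_left_iff)

lemma p_dvd_pn: "r \<ge> 1 \<Longrightarrow> int p dvd int p ^ r"
  by (simp add: dvd_power)

lemma cong_p: "[a = b] (mod int p ^ n) \<Longrightarrow> [a = b] (mod int p)"
  using n_ge p_dvd_pn[of n] by (auto intro: cong_dvd_modulus)

definition L :: "int \<Rightarrow> complex" where "L m = of_int (Legendre m (int p))"

text \<open>\<open>P\<close> is \<open>\<eta>\<close> as a character of the units modulo \<open>p\<close>, extended by zero.\<close>

definition P :: "int \<Rightarrow> complex" where
  "P m = (if int p dvd m then 0 else if \<eta> = triv_char then 1 else L m)"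

lemma L_cong: "[a = b] (mod int p) \<Longrightarrow> L a = L b"
  by (simp add: L_def Legendre_cong)

lemma L_mult: "L (a * b) = L a * L b"
  by (simp add: L_def Legendre_mult[OF p_prime p_gt2])

lemma L_zero_iff: "L a = 0 \<longleftrightarrow> int p dvd a"
  by (simp add: L_def Legendre_def cong_0_iff)

lemma L_square: "\<not> int p dvd a \<Longrightarrow> L a * L a = 1"
  by (simp add: L_def Legendre_def cong_0_iff)

lemma L_one [simp]: "L 1 = 1"
  using L_mult[of 1 1] L_zero_iff[of 1] p_gt2 by simp

lemma sum_L: "(\<Sum>t\<in>{0..<int p}. L t) = 0"
  using sum_Legendre(1)[OF p_prime p_gt2 l_nonres] unfolding L_def of_int_sum[symmetric] by simp

lemma sum_L_L: "(\<Sum>t\<in>{0..<int p}. L t * L (t + m)) = (if int p dvd m then of_nat p - 1 else -1)"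
  using sum_Legendre(2)[OF p_prime p_gt2 l_nonres, of m]
  unfolding L_def of_int_mult[symmetric] of_int_sum[symmetric] by simp

lemma l_closed: "l \<in> carrier (Zp p)"
  using l_unit by (simp add: Units_def)

lemma L_l: "L (l n) = -1"
proof -
  have "[l n = l 1] (mod int p)"
    using Zp_coherent[OF l_closed, of 1 n] n_ge by (simp add: cong_def) (metis mod_mod_trivial)
  then have "L (l n) = L (l 1)" by (rule L_cong)
  moreover have "\<not> [l 1 = 0] (mod int p)"
    using l_nonres unfolding QuadRes_def by (metis cong_sym power_zero_numeral)
  ultimately show ?thesis using l_nonres by (simp add: L_def Legendre_def)
qed

lemma P_cong: "[a = b] (mod int p) \<Longrightarrow> P a = P b"
  using L_cong[of a b] cong_dvd_iff[of a b "int p"] by (simp add: P_def)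

lemma P_mult: "P (a * b) = P a * P b"
  by (auto simp: P_def p_dvd_mult L_mult)

lemma P_values: "\<not> int p dvd a \<Longrightarrow> P a \<in> {1, -1}"
  by (auto simp: P_def L_def Legendre_def cong_0_iff)

lemma P_square: "\<not> int p dvd a \<Longrightarrow> P a * P a = 1"
  using P_values[of a] by auto

lemma P_one [simp]: "P 1 = 1"
  using p_gt2 by (simp add: P_def)

lemma P_inverse: "[a * b = 1] (mod int p) \<Longrightarrow> P a = P b"
proof -
  assume "[a * b = 1] (mod int p)"
  then have "P a * P b = 1" using P_cong[of "a * b" 1] by (simp add: P_mult)
  moreover from this have "P b * P b = 1" by (metis P_def P_square mult_zero_right zero_neq_one)
  ultimately show "P a = P b" by (metis mult.assoc mult.right_neutral mult.left_neutral)
qed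

text \<open>The vectors branch on equality with \<open>triv_char\<close> as functions on all
  sequences. The zero sequence separates the two characters, since the Legendre symbol of 0 is
  0.\<close>

lemma legendre_char_neq: "legendre_char p \<noteq> triv_char"
proof
  assume "legendre_char p = triv_char"
  then have "legendre_char p (\<lambda>_. 0) = triv_char (\<lambda>_. 0)" by simp
  then show False by (simp add: legendre_char_def triv_char_def Legendre_def)
qed

lemma sum_P: "(\<Sum>t\<in>{0..<int p}. P t) = (if \<eta> = triv_char then of_nat p - 1 else 0)"
proof (cases "\<eta> = triv_char")
  case True
  have split: "{0..<int p} = insert 0 {1..<int p}" using p_gt2 by auto
  have "(\<Sum>t\<in>{1..<int p}. P t) = (\<Sum>t\<in>{1..<int p}. 1)"
    unfolding P_def using True by (intro sum.cong refl) (simp add: zdvd_not_zless)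
  moreover have "P 0 = 0" by (simp add: P_def)
  ultimately show ?thesis using True p_gt2 unfolding split by (simp add: of_nat_diff)
next
  case False
  then have "P = L" by (auto simp: P_def fun_eq_iff L_zero_iff)
  with False sum_L show ?thesis by simp
qed

text \<open>Entries are read modulo p^n. A function in the induced space depends only on the bottom
  row at this precision and on the sign, so matrix identities may be replaced by integer
  congruences.\<close>

definition ent_a :: "padic mat2 \<times> int \<Rightarrow> int" where "ent_a g = fst (fst g) n"
definition ent_b :: "padic mat2 \<times> int \<Rightarrow> int" where "ent_b g = fst (snd (fst g)) n"
definition ent_c :: "padic mat2 \<times> int \<Rightarrow> int" where "ent_c g = fst (snd (snd (fst g))) n"
definition ent_d :: "padic mat2 \<times> int \<Rightarrow> int" where "ent_d g = snd (snd (snd (fst g))) n"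

lemmas ent_defs = ent_a_def ent_b_def ent_c_def ent_d_def

abbreviation G where "G \<equiv> Kbar p"
abbreviation gmult (infixl \<open>\<odot>\<close> 70) where "g \<odot> h \<equiv> g \<otimes>\<^bsub>G\<^esub> h"
abbreviation ginv where "ginv g \<equiv> inv\<^bsub>G\<^esub> g"

sublocale K: group G by (rule Kbar_group) simp

lemma ent_mult:
  "[ent_a (g \<odot> h) = ent_a g * ent_a h + ent_b g * ent_c h] (mod int p ^ n)"
  "[ent_b (g \<odot> h) = ent_a g * ent_b h + ent_b g * ent_d h] (mod int p ^ n)"
  "[ent_c (g \<odot> h) = ent_c g * ent_a h + ent_d g * ent_c h] (mod int p ^ n)"
  "[ent_d (g \<odot> h) = ent_c g * ent_b h + ent_d g * ent_d h] (mod int p ^ n)"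
proof -
  obtain a b c d \<epsilon> where g: "g = ((a, b, c, d), \<epsilon>)" by (metis prod.collapse)
  obtain a' b' c' d' \<epsilon>' where h: "h = ((a', b', c', d'), \<epsilon>')" by (metis prod.collapse)
  show "[ent_a (g \<odot> h) = ent_a g * ent_a h + ent_b g * ent_c h] (mod int p ^ n)"
    "[ent_b (g \<odot> h) = ent_a g * ent_b h + ent_b g * ent_d h] (mod int p ^ n)"
    "[ent_c (g \<odot> h) = ent_c g * ent_a h + ent_d g * ent_c h] (mod int p ^ n)"
    "[ent_d (g \<odot> h) = ent_c g * ent_b h + ent_d g * ent_d h] (mod int p ^ n)"
    unfolding g h Kbar_mult by (simp_all add: ent_defs Zp_simps cong_def mod_add_eq)
qed

lemma snd_mult: "snd (g \<odot> h) = snd g * snd h"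
  by (cases g; cases h) (simp add: Kbar_def sign_group_def)

lemma ent_inv:
  assumes "g \<in> carrier G"
  shows "ent_a (ginv g) = ent_d g" "[ent_b (ginv g) = - ent_b g] (mod int p ^ n)"
    "[ent_c (ginv g) = - ent_c g] (mod int p ^ n)" "ent_d (ginv g) = ent_a g" "snd (ginv g) = snd g"
proof -
  obtain a b c d \<epsilon> where g: "g = ((a, b, c, d), \<epsilon>)" by (metis prod.collapse)
  then have "b \<in> carrier (Zp p)" "c \<in> carrier (Zp p)" using assms by (auto simp: Kbar_carrier)
  with assms show "ent_a (ginv g) = ent_d g" "[ent_b (ginv g) = - ent_b g] (mod int p ^ n)"
    "[ent_c (ginv g) = - ent_c g] (mod int p ^ n)" "ent_d (ginv g) = ent_a g" "snd (ginv g) = snd g"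
    by (simp_all add: g Kbar_inv ent_defs Zp_minus cong_def)
qed

lemma ent_det:
  assumes "g \<in> carrier G"
  shows "[ent_a g * ent_d g - ent_b g * ent_c g = 1] (mod int p ^ n)"
proof -
  obtain a b c d \<epsilon> where g: "g = ((a, b, c, d), \<epsilon>)" by (metis prod.collapse)
  interpret Z: cring "Zp p" by (rule Zp_cring) simp
  from assms have "b \<in> carrier (Zp p)" "c \<in> carrier (Zp p)"
    and "(a \<otimes>\<^bsub>Zp p\<^esub> d \<ominus>\<^bsub>Zp p\<^esub> b \<otimes>\<^bsub>Zp p\<^esub> c) n = \<one>\<^bsub>Zp p\<^esub> n" by (auto simp: g Kbar_carrier)
  then show ?thesis
    by (simp add: g ent_defs Zp_simps Zp_minus cong_def a_minus_def mod_simps Z.m_closed)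
qed

lemma snd_values: "g \<in> carrier G \<Longrightarrow> snd g = 1 \<or> snd g = -1"
  by (cases g) (simp add: Kbar_def sign_group_def)

lemma ent_c_range:
  assumes "g \<in> carrier G"
  shows "0 \<le> ent_c g \<and> ent_c g < int p ^ n"
proof -
  obtain a b c d \<epsilon> where g: "g = ((a, b, c, d), \<epsilon>)" by (metis prod.collapse)
  then have "c \<in> carrier (Zp p)" using assms by (simp add: Kbar_carrier)
  then show ?thesis by (simp add: g ent_c_def Zp_def)
qed

text \<open>Divisibility, rather than equality with 0, passes through the congruences that describe
  the entries of products.\<close>

lemma Q_iff: "g \<in> K0bar p n \<longleftrightarrow> g \<in> carrier G \<and> int p ^ n dvd ent_c g"
proof -
  have "ent_c g = 0 \<longleftrightarrow> int p ^ n dvd ent_c g" if "g \<in> carrier G"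
    using ent_c_range[OF that] zdvd_not_zless[of "ent_c g" "int p ^ n"] by (cases "ent_c g = 0") auto
  then show ?thesis
    by (cases g) (auto simp: K0bar_def K0_def Kbar_def sign_group_def Zp_PIdl_iff SL2_def ent_c_def)
qed

lemma ad_unit:
  assumes "g \<in> carrier G" "int p dvd ent_c g"
  shows "[ent_a g * ent_d g = 1] (mod int p)" "\<not> int p dvd ent_a g" "\<not> int p dvd ent_d g"
proof -
  have "[ent_a g * ent_d g - ent_b g * ent_c g = 1] (mod int p)" using cong_p ent_det assms by blast
  moreover have "[ent_b g * ent_c g = 0] (mod int p)" using assms by (simp add: cong_0_iff)
  ultimately show *: "[ent_a g * ent_d g = 1] (mod int p)" by (metis cong_add diff_add_cancel add.right_neutral)
  have "\<not> int p dvd ent_a g * ent_d g"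
    using cong_dvd_iff[OF *] p_gt2 by simp
  then show "\<not> int p dvd ent_a g" "\<not> int p dvd ent_d g" by auto
qed

lemma Q_dvd: "q \<in> K0bar p n \<Longrightarrow> int p dvd ent_c q"
  using p_dvd_pn[of n] n_ge by (auto simp: Q_iff intro: dvd_trans)

lemma eta_P:
  assumes "d \<in> carrier (Zp p)" "\<not> int p dvd d n"
  shows "\<eta> d = P (d n)"
proof -
  have "[d 1 = d n] (mod int p)"
    using Zp_coherent[OF assms(1), of 1 n] n_ge by (simp add: cong_def) (metis mod_mod_trivial)
  then show ?thesis
    using eta assms(2) legendre_char_neq
    by (auto simp: P_def triv_char_def legendre_char_def L_def dest!: Legendre_cong)
qed

lemma genuine_char_eq:
  assumes "q \<in> K0bar p n"
  shows "genuine_char \<eta> q = of_int (snd q) * P (ent_d q)"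
proof -
  obtain a b c d \<epsilon> where q: "q = ((a, b, c, d), \<epsilon>)" by (metis prod.collapse)
  have "q \<in> carrier G" using assms Q_iff by blast
  then have "d \<in> carrier (Zp p)" by (simp add: q Kbar_carrier)
  moreover have "\<not> int p dvd d n" using ad_unit(3)[OF \<open>q \<in> carrier G\<close> Q_dvd[OF assms]] by (simp add: q ent_d_def)
  ultimately show ?thesis by (simp add: q genuine_char_def eta_P ent_d_def)
qed

section \<open>Integral matrices in the covering group\<close>

definition int_mat :: "int \<Rightarrow> int \<Rightarrow> int \<Rightarrow> int \<Rightarrow> padic mat2 \<times> int" where
  "int_mat a b c d = ((Zp_of_int p a, Zp_of_int p b, Zp_of_int p c, Zp_of_int p d), 1)"

lemma int_mat_closed: "a * d - b * c = 1 \<Longrightarrow> int_mat a b c d \<in> carrier G"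
  by (simp add: int_mat_def Kbar_carrier Zp_of_int_hom a_minus_def Zp_of_int_minus)

lemma int_mat_ent: "[ent_a (int_mat a b c d) = a] (mod int p ^ n)" "[ent_b (int_mat a b c d) = b] (mod int p ^ n)"
  "[ent_c (int_mat a b c d) = c] (mod int p ^ n)" "[ent_d (int_mat a b c d) = d] (mod int p ^ n)"
  "snd (int_mat a b c d) = 1"
  by (simp_all add: int_mat_def ent_defs Zp_of_int_def cong_def)

lemma int_mat_mult: "int_mat a b c d \<odot> int_mat a' b' c' d'
    = int_mat (a * a' + b * c') (a * b' + b * d') (c * a' + d * c') (c * b' + d * d')"
  by (simp add: int_mat_def Kbar_mult Zp_of_int_hom)

lemma int_mat_one: "\<one>\<^bsub>G\<^esub> = int_mat 1 0 0 1"
  by (simp add: int_mat_def Kbar_one Zp_of_int_hom)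

definition y_int :: "int \<Rightarrow> padic mat2 \<times> int" where "y_int t = int_mat 1 0 t 1"
text \<open>The product of w(1) and the upper unipotent matrix with entry b.\<close>

definition wn_int :: "int \<Rightarrow> padic mat2 \<times> int" where "wn_int b = int_mat 0 1 (- 1) (- b)"

lemma y_int_closed [simp]: "y_int t \<in> carrier G" and wn_int_closed [simp]: "wn_int t \<in> carrier G"
  by (simp_all add: y_int_def wn_int_def int_mat_closed)

lemma y_int_row: "[ent_c (y_int t \<odot> g) = ent_c g + t * ent_a g] (mod int p ^ n)"
    "[ent_d (y_int t \<odot> g) = ent_d g + t * ent_b g] (mod int p ^ n)" "snd (y_int t \<odot> g) = snd g"
proof -
  have "[ent_c (y_int t) * ent_a g + ent_d (y_int t) * ent_c g = t * ent_a g + 1 * ent_c g] (mod int p ^ n)"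
    unfolding y_int_def by (intro cong_add cong_mult int_mat_ent cong_refl)
  then show "[ent_c (y_int t \<odot> g) = ent_c g + t * ent_a g] (mod int p ^ n)"
    using ent_mult(3)[of "y_int t" g] by (simp add: cong_def add.commute)
  have "[ent_c (y_int t) * ent_b g + ent_d (y_int t) * ent_d g = t * ent_b g + 1 * ent_d g] (mod int p ^ n)"
    unfolding y_int_def by (intro cong_add cong_mult int_mat_ent cong_refl)
  then show "[ent_d (y_int t \<odot> g) = ent_d g + t * ent_b g] (mod int p ^ n)"
    using ent_mult(4)[of "y_int t" g] by (simp add: cong_def add.commute)
  show "snd (y_int t \<odot> g) = snd g" by (simp add: snd_mult y_int_def int_mat_ent)
qed

lemma wn_int_row: "[ent_c (wn_int t \<odot> g) = - (ent_a g + t * ent_c g)] (mod int p ^ n)" "snd (wn_int t \<odot> g) = snd g"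
proof -
  have "[ent_c (wn_int t) * ent_a g + ent_d (wn_int t) * ent_c g = (-1) * ent_a g + (- t) * ent_c g] (mod int p ^ n)"
    unfolding wn_int_def by (intro cong_add cong_mult int_mat_ent cong_refl)
  then show "[ent_c (wn_int t \<odot> g) = - (ent_a g + t * ent_c g)] (mod int p ^ n)"
    using ent_mult(3)[of "wn_int t" g] by (simp add: cong_def)
  show "snd (wn_int t \<odot> g) = snd g" by (simp add: snd_mult wn_int_def int_mat_ent)
qed

lemma inv_y_int: "ginv (y_int t) = y_int (- t)"
  by (rule K.inv_equality) (simp_all add: y_int_def int_mat_mult int_mat_one int_mat_closed)

lemma inv_wn_int: "ginv (wn_int t) = int_mat (- t) (- 1) 1 0"
  by (rule K.inv_equality) (simp_all add: wn_int_def int_mat_mult int_mat_one int_mat_closed)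

section \<open>Representatives of the right cosets\<close>

definition p_multiples :: "int set" where "p_multiples = {t \<in> {0..<int p ^ n}. int p dvd t}"
text \<open>A right coset of \<open>K0bar p n\<close> is a bottom row up to units, a point of the
  projective line over Z/p^n. Points with p | c are scaled to (t, 1) with p | t; the others are
  scaled to (-1, -b).\<close>

definition coset_reps :: "(padic mat2 \<times> int) set" where "coset_reps = y_int ` p_multiples \<union> wn_int ` {0..<int p ^ n}"

lemma p_multiples_finite: "finite p_multiples"
  unfolding p_multiples_def by (rule finite_subset[of _ "{0..<int p ^ n}"]) auto

lemma solve_unit:
  assumes "\<not> int p dvd b"
  shows "\<exists>!t. t \<in> {0..<int p ^ n} \<and> int p ^ n dvd a - b * t"
proof (rule ex_ex1I)
  obtain x where "[b * x = 1] (mod int p ^ n)"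
    using coprime_p[OF assms] cong_solve_coprime_int by blast
  then have "[b * x * a = 1 * a] (mod int p ^ n)" by (intro cong_mult cong_refl)
  then have "[b * (x * a mod int p ^ n) = a] (mod int p ^ n)"
    by (simp add: cong_def mod_mult_right_eq mult.assoc)
  then show "\<exists>t. t \<in> {0..<int p ^ n} \<and> int p ^ n dvd a - b * t"
    by (intro exI[of _ "x * a mod int p ^ n"]) (simp add: cong_iff_dvd_diff dvd_diff_commute)
next
  fix t t' assume "t \<in> {0..<int p ^ n} \<and> int p ^ n dvd a - b * t"
    and "t' \<in> {0..<int p ^ n} \<and> int p ^ n dvd a - b * t'"
  then have tt: "t \<in> {0..<int p ^ n}" "t' \<in> {0..<int p ^ n}"
    and "[b * t = b * t'] (mod int p ^ n)"
    by (auto simp: cong_iff_dvd_diff) (metis (no_types) cong_iff_dvd_diff cong_sym cong_trans)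
  then have "[t = t'] (mod int p ^ n)" using coprime_p[OF assms, of n] by (simp add: cong_mult_lcancel)
  with tt show "t = t'" by (simp add: cong_def)
qed

text \<open>The lower left entry of the quotient is the determinant formed by the two bottom rows,
  here (c, d) and (t, 1). It vanishes modulo p^n exactly when the rows define the same
  point.\<close>

lemma coset_y_int: "g \<in> carrier G \<Longrightarrow> g \<odot> ginv (y_int t) \<in> K0bar p n \<longleftrightarrow> int p ^ n dvd ent_c g - ent_d g * t"
proof -
  assume g: "g \<in> carrier G"
  have "[ent_c g * ent_a (y_int (- t)) + ent_d g * ent_c (y_int (- t)) = ent_c g * 1 + ent_d g * (- t)] (mod int p ^ n)"
    unfolding y_int_def by (intro cong_add cong_mult int_mat_ent cong_refl)
  then have "[ent_c (g \<odot> ginv (y_int t)) = ent_c g - ent_d g * t] (mod int p ^ n)"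
    unfolding inv_y_int using ent_mult(3)[of g "y_int (- t)"] by (simp add: cong_def)
  then show ?thesis using g cong_dvd_iff by (simp add: Q_iff)
qed

lemma coset_wn_int: "g \<in> carrier G \<Longrightarrow> g \<odot> ginv (wn_int t) \<in> K0bar p n \<longleftrightarrow> int p ^ n dvd ent_d g - ent_c g * t"
proof -
  assume g: "g \<in> carrier G"
  have "[ent_c g * ent_a (int_mat (- t) (- 1) 1 0) + ent_d g * ent_c (int_mat (- t) (- 1) 1 0) = ent_c g * (- t) + ent_d g * 1] (mod int p ^ n)"
    by (intro cong_add cong_mult int_mat_ent cong_refl)
  then have "[ent_c (g \<odot> ginv (wn_int t)) = ent_d g - ent_c g * t] (mod int p ^ n)"
    unfolding inv_wn_int using ent_mult(3)[of g "int_mat (- t) (- 1) 1 0"] by (simp add: cong_def)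
  then show ?thesis using g cong_dvd_iff by (simp add: Q_iff)
qed

lemma coset_reps_transversal:
  assumes g: "g \<in> carrier G"
  shows "\<exists>!r. r \<in> coset_reps \<and> g \<odot> ginv r \<in> K0bar p n"
proof (cases "int p dvd ent_c g")
  case True
  have dg: "\<not> int p dvd ent_d g" using ad_unit[OF g True] by simp
  obtain t where t: "t \<in> {0..<int p ^ n}" "int p ^ n dvd ent_c g - ent_d g * t"
    and uniq: "\<And>t'. t' \<in> {0..<int p ^ n} \<Longrightarrow> int p ^ n dvd ent_c g - ent_d g * t' \<Longrightarrow> t' = t"
    using solve_unit[OF dg, of "ent_c g"] by blast
  have "int p dvd ent_c g - ent_d g * t" using t(2) p_dvd_pn[of n] n_ge by (auto intro: dvd_trans)
  then have "int p dvd ent_c g - (ent_c g - ent_d g * t)" by (rule dvd_diff[OF True])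
  then have "int p dvd ent_d g * t" by simp
  then have tT: "t \<in> p_multiples" using t dg by (simp add: p_multiples_def p_dvd_mult)
  have nz: "\<not> int p ^ n dvd ent_d g - ent_c g * b" for b
  proof
    assume "int p ^ n dvd ent_d g - ent_c g * b"
    then have "int p dvd ent_d g - ent_c g * b" using p_dvd_pn[of n] n_ge by (auto intro: dvd_trans)
    then have "int p dvd (ent_d g - ent_c g * b) + ent_c g * b" using True by (intro dvd_add dvd_mult2)
    then show False using dg by simp
  qed
  show ?thesis
  proof (rule ex1I[of _ "y_int t"])
    show "y_int t \<in> coset_reps \<and> g \<odot> ginv (y_int t) \<in> K0bar p n"
      using tT t by (simp add: coset_reps_def coset_y_int[OF g])
    fix r assume r: "r \<in> coset_reps \<and> g \<odot> ginv r \<in> K0bar p n"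
    then consider t' where "t' \<in> p_multiples" "r = y_int t'" | b where "r = wn_int b" unfolding coset_reps_def by blast
    then show "r = y_int t"
    proof cases
      case 1
      then have "t' = t" using r uniq[of t'] by (simp add: coset_y_int[OF g] p_multiples_def)
      with 1 show ?thesis by simp
    next
      case 2
      then show ?thesis using r nz by (simp add: coset_wn_int[OF g])
    qed
  qed
next
  case False
  obtain t where t: "t \<in> {0..<int p ^ n}" "int p ^ n dvd ent_d g - ent_c g * t"
    and uniq: "\<And>t'. t' \<in> {0..<int p ^ n} \<Longrightarrow> int p ^ n dvd ent_d g - ent_c g * t' \<Longrightarrow> t' = t"
    using solve_unit[OF False, of "ent_d g"] by blast
  have nz: "\<not> int p ^ n dvd ent_c g - ent_d g * b" if "b \<in> p_multiples" for b
  proof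
    assume "int p ^ n dvd ent_c g - ent_d g * b"
    then have "int p dvd ent_c g - ent_d g * b" using p_dvd_pn[of n] n_ge by (auto intro: dvd_trans)
    moreover have "int p dvd ent_d g * b" using that by (simp add: p_multiples_def)
    ultimately have "int p dvd (ent_c g - ent_d g * b) + ent_d g * b" by (rule dvd_add)
    then show False using False by simp
  qed
  show ?thesis
  proof (rule ex1I[of _ "wn_int t"])
    show "wn_int t \<in> coset_reps \<and> g \<odot> ginv (wn_int t) \<in> K0bar p n"
      using t by (simp add: coset_reps_def coset_wn_int[OF g])
    fix r assume r: "r \<in> coset_reps \<and> g \<odot> ginv r \<in> K0bar p n"
    then consider b where "b \<in> p_multiples" "r = y_int b" | t' where "t' \<in> {0..<int p ^ n}" "r = wn_int t'"
      unfolding coset_reps_def by blast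
    then show "r = wn_int t"
    proof cases
      case 1
      then show ?thesis using r nz by (simp add: coset_y_int[OF g])
    next
      case 2
      then have "t' = t" using r uniq[of t'] by (simp add: coset_wn_int[OF g])
      with 2 show ?thesis by simp
    qed
  qed
qed

lemma Q_mult_ent_d:
  assumes "q \<in> K0bar p n"
  shows "[ent_c (q \<odot> g) = ent_d q * ent_c g] (mod int p ^ n)" "[ent_d (q \<odot> g) = ent_d q * ent_d g] (mod int p ^ n)"
proof -
  have *: "[ent_c q = 0] (mod int p ^ n)" using assms by (simp add: Q_iff cong_0_iff)
  have "[ent_c q * ent_a g + ent_d q * ent_c g = 0 * ent_a g + ent_d q * ent_c g] (mod int p ^ n)"
    by (intro cong_add cong_mult * cong_refl)
  then show "[ent_c (q \<odot> g) = ent_d q * ent_c g] (mod int p ^ n)"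
    using ent_mult(3)[of q g] by (simp add: cong_def)
  have "[ent_c q * ent_b g + ent_d q * ent_d g = 0 * ent_b g + ent_d q * ent_d g] (mod int p ^ n)"
    by (intro cong_add cong_mult * cong_refl)
  then show "[ent_d (q \<odot> g) = ent_d q * ent_d g] (mod int p ^ n)"
    using ent_mult(4)[of q g] by (simp add: cong_def)
qed

lemma Q_subgroup: "subgroup (K0bar p n) G"
proof (rule K.subgroupI)
  show "K0bar p n \<subseteq> carrier G" using Q_iff by blast
  have "[ent_c \<one>\<^bsub>G\<^esub> = 0] (mod int p ^ n)" unfolding int_mat_one by (rule int_mat_ent)
  then have "\<one>\<^bsub>G\<^esub> \<in> K0bar p n" by (simp add: Q_iff cong_0_iff)
  then show "K0bar p n \<noteq> {}" by blast
  fix q assume q: "q \<in> K0bar p n"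
  then show "ginv q \<in> K0bar p n"
    using ent_inv(3)[of q] cong_dvd_iff by (fastforce simp: Q_iff)
  fix h assume h: "h \<in> K0bar p n"
  show "q \<odot> h \<in> K0bar p n"
    using q h Q_mult_ent_d(1)[OF q, of h] cong_dvd_iff by (fastforce simp: Q_iff)
qed

sublocale H: induced_character G "K0bar p n" "genuine_char \<eta>" coset_reps
proof (intro induced_character.intro induced_character_axioms.intro)
  show "group G" by (rule K.is_group)
  show "subgroup (K0bar p n) G" by (rule Q_subgroup)
  show "finite coset_reps" by (simp add: coset_reps_def p_multiples_finite)
  show "coset_reps \<subseteq> carrier G" by (auto simp: coset_reps_def)
  show "\<exists>!r. r \<in> coset_reps \<and> g \<odot> ginv r \<in> K0bar p n" if "g \<in> carrier G" for g
    by (rule coset_reps_transversal[OF that])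
  show "genuine_char \<eta> (q \<odot> q') = genuine_char \<eta> q * genuine_char \<eta> q'"
    if "q \<in> K0bar p n" "q' \<in> K0bar p n" for q q'
    using that subgroup.m_closed[OF Q_subgroup that] P_cong[OF cong_p[OF Q_mult_ent_d(2)[OF that(1), of q']]]
    by (simp add: genuine_char_eq snd_mult P_mult)
  show "genuine_char \<eta> q \<in> {1, -1}" if "q \<in> K0bar p n" for q
    using that P_values[of "ent_d q"] ad_unit(3)[OF _ Q_dvd[OF that]] snd_values[of q]
    by (auto simp: genuine_char_eq Q_iff)
qed

abbreviation conv (infixl \<open>\<star>\<close> 70) where "f \<star> \<phi> \<equiv> H.convolution f \<phi>"

lemma cong_p_power: "[a = b] (mod int p ^ n) \<Longrightarrow> r \<le> n \<Longrightarrow> [a = b] (mod int p ^ r)"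
  by (meson cong_dvd_modulus le_imp_power_dvd)

section \<open>Hecke functions given by the bottom row\<close>

definition row_fun :: "(int \<Rightarrow> int \<Rightarrow> complex) \<Rightarrow> padic mat2 \<times> int \<Rightarrow> complex" where
  "row_fun F g = (if g \<in> carrier G then of_int (snd g) * F (ent_c g) (ent_d g) else 0)"

text \<open>The bottom-row formula of Y_r: the character extended to K_0(p^r), up to the sign
  component added by \<open>row_fun\<close>.\<close>

definition FY :: "nat \<Rightarrow> int \<Rightarrow> int \<Rightarrow> complex" where
  "FY r c d = (if int p ^ r dvd c then P d else 0)"

text \<open>The class of (c / p^r) d modulo squares distinguishes the two double cosets of V_(r,1)
  and V_(r,\<lambda>). The symbol vanishes if p^(r+1) | c, so only rows with c of valuation exactly
  r contribute.\<close>

definition FW :: "nat \<Rightarrow> int \<Rightarrow> int \<Rightarrow> complex" where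
  "FW r c d = (if int p ^ r dvd c then P d * L (c div int p ^ r * d) else 0)"

text \<open>The minus sign normalises the value at w(1), whose lower left entry is -1, to 1.\<close>

definition FU :: "int \<Rightarrow> int \<Rightarrow> complex" where
  "FU c d = P (- c)"

definition Yf where "Yf r = row_fun (FY r)"
definition Wf where "Wf r = row_fun (FW r)"
definition Uf where "Uf = row_fun FU"

lemma FY_cong:
  assumes "[c = c'] (mod int p ^ r)" "[d = d'] (mod int p)"
  shows "FY r c d = FY r c' d'"
  using cong_dvd_iff[OF assms(1)] P_cong[OF assms(2)] by (simp add: FY_def)

lemma FU_cong:
  assumes "[c = c'] (mod int p)"
  shows "FU c d = FU c' d'"
  using assms by (auto simp: FU_def intro!: P_cong simp: cong_minus_minus_iff)

lemma FW_mult: "FW r (int p ^ r * k) d = P d * L (k * d)"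
  by (simp add: FW_def)

text \<open>The quotient c / p^r enters modulo p, hence one more power of p than for
  \<open>FY\<close>. This is the source of the condition r < n for W_r, where Y_r allows r =
  n.\<close>

lemma FW_cong:
  assumes "[c = c'] (mod int p ^ Suc r)" "[d = d'] (mod int p)"
  shows "FW r c d = FW r c' d'"
proof (cases "int p ^ r dvd c")
  case True
  then obtain k where k: "c = int p ^ r * k" by blast
  obtain j where j: "c' = c + int p ^ Suc r * j" using assms(1) by (metis cong_iff_lin)
  then have "c' = int p ^ r * (k + int p * j)" by (simp add: k algebra_simps)
  moreover have "[k * d = (k + int p * j) * d'] (mod int p)"
    using assms(2) by (intro cong_mult) (simp_all add: cong_def)
  ultimately show ?thesis
    using P_cong[OF assms(2)] L_cong by (simp add: k FW_mult del: power_Suc)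
next
  case False
  have "[c = c'] (mod int p ^ r)" using assms(1) by (rule cong_dvd_modulus) simp
  then have "\<not> int p ^ r dvd c'" using False cong_dvd_iff by blast
  with False show ?thesis by (simp add: FW_def)
qed

lemma FY_cong_n:
  assumes "r \<le> n" "[c = c'] (mod int p ^ n)" "[d = d'] (mod int p ^ n)"
  shows "FY r c d = FY r c' d'"
  by (rule FY_cong[OF cong_p_power[OF assms(2,1)] cong_p[OF assms(3)]])

lemma FW_cong_n:
  assumes "r < n" "[c = c'] (mod int p ^ n)" "[d = d'] (mod int p ^ n)"
  shows "FW r c d = FW r c' d'"
  by (rule FW_cong[OF cong_p_power[OF assms(2) Suc_leI[OF assms(1)]] cong_p[OF assms(3)]])

text \<open>Modulo p^n the elements of \<open>K0bar p n\<close> are upper triangular: on the left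
  they scale the bottom row by u, on the right they send (c, d) to (c a, c b + d d').\<close>

lemma row_fun_Hecke:
  assumes cong: "\<And>c c' d d'. [c = c'] (mod int p ^ n) \<Longrightarrow> [d = d'] (mod int p ^ n) \<Longrightarrow> F c d = F c' d'"
    and left: "\<And>u c d. \<not> int p dvd u \<Longrightarrow> F (u * c) (u * d) = P u * F c d"
    and right: "\<And>a b c d d'. [a * d' = 1] (mod int p) \<Longrightarrow> F (c * a) (c * b + d * d') = P d' * F c d"
  shows "row_fun F \<in> H.Hecke_space"
proof (rule H.Hecke_spaceI)
  have "row_fun F (q \<odot> g) = genuine_char \<eta> q * row_fun F g"
    if q: "q \<in> K0bar p n" and g: "g \<in> carrier G" for q g
  proof -
    have qc: "q \<in> carrier G" using q Q_iff by blast
    have "F (ent_c (q \<odot> g)) (ent_d (q \<odot> g)) = F (ent_d q * ent_c g) (ent_d q * ent_d g)"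
      by (intro cong Q_mult_ent_d q)
    then show ?thesis
      using q g qc left[of "ent_d q"] ad_unit(3)[OF qc Q_dvd[OF q]]
      by (simp add: row_fun_def snd_mult genuine_char_eq)
  qed
  then show "row_fun F \<in> H.Ind" by (auto simp: H.Ind_def functions_on_def row_fun_def)
  fix q g assume q: "q \<in> K0bar p n" and g: "g \<in> carrier G"
  then have qc: "q \<in> carrier G" using Q_iff by blast
  have "[ent_c g * ent_a q + ent_d g * ent_c q = ent_c g * ent_a q + ent_d g * 0] (mod int p ^ n)"
    using q by (intro cong_add cong_mult cong_refl) (simp add: Q_iff cong_0_iff)
  then have "[ent_c (g \<odot> q) = ent_c g * ent_a q] (mod int p ^ n)"
    using ent_mult(3)[of g q] by (simp add: cong_def)
  then have "F (ent_c (g \<odot> q)) (ent_d (g \<odot> q)) = F (ent_c g * ent_a q) (ent_c g * ent_b q + ent_d g * ent_d q)"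
    by (intro cong ent_mult)
  also have "\<dots> = P (ent_d q) * F (ent_c g) (ent_d g)"
    by (rule right[OF ad_unit(1)[OF qc Q_dvd[OF q]]])
  finally show "row_fun F (g \<odot> q) = genuine_char \<eta> q * row_fun F g"
    using q g qc by (simp add: row_fun_def snd_mult genuine_char_eq)
qed

lemma unit_of_inverse:
  assumes "[a * d = 1] (mod int p)"
  shows "\<not> int p dvd a \<and> \<not> int p dvd d"
proof -
  have "\<not> int p dvd a * d" using cong_dvd_iff[OF assms] p_gt2 by simp
  then show ?thesis by (simp add: p_dvd_mult)
qed

lemma Yf_Hecke:
  assumes "1 \<le> r" "r \<le> n"
  shows "Yf r \<in> H.Hecke_space"
  unfolding Yf_def
proof (rule row_fun_Hecke)
  show "FY r c d = FY r c' d'" if "[c = c'] (mod int p ^ n)" "[d = d'] (mod int p ^ n)" for c c' d d'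
    by (rule FY_cong_n[OF assms(2) that])
  show "FY r (u * c) (u * d) = P u * FY r c d" if "\<not> int p dvd u" for u c d
    using dvd_mult_cancel_unit[OF that, of r c] by (simp add: FY_def P_mult mult.commute)
  show "FY r (c * a) (c * b + d * d') = P d' * FY r c d" if "[a * d' = 1] (mod int p)" for a b c d d'
  proof -
    have "P (c * b + d * d') = P d' * P d" if "int p ^ r dvd c"
    proof -
      have "int p dvd c" by (rule dvd_trans[OF p_dvd_pn[OF assms(1)] that])
      then have "[c * b + d * d' = d' * d] (mod int p)" by (simp add: cong_iff_dvd_diff)
      then show ?thesis using P_cong P_mult by metis
    qed
    then show ?thesis
      using dvd_mult_cancel_unit[of a r c] unit_of_inverse[OF that] by (simp add: FY_def)
  qed
qed

lemma Wf_Hecke: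
  assumes "1 \<le> r" "r < n"
  shows "Wf r \<in> H.Hecke_space"
  unfolding Wf_def
proof (rule row_fun_Hecke)
  show "FW r c d = FW r c' d'" if "[c = c'] (mod int p ^ n)" "[d = d'] (mod int p ^ n)" for c c' d d'
    by (rule FW_cong_n[OF assms(2) that])
  show "FW r (u * c) (u * d) = P u * FW r c d" if u: "\<not> int p dvd u" for u c d
  proof (cases "int p ^ r dvd c")
    case True
    then obtain k where k: "c = int p ^ r * k" by blast
    have "FW r (u * c) (u * d) = FW r (int p ^ r * (u * k)) (u * d)" by (simp add: k mult_ac)
    also have "\<dots> = P u * FW r c d"
      using L_square[OF u] unfolding k FW_mult L_mult P_mult by (simp add: mult_ac)
    finally show ?thesis .
  next
    case False
    then show ?thesis using dvd_mult_cancel_unit[OF u, of r c] by (simp add: FW_def mult.commute)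
  qed
  show "FW r (c * a) (c * b + d * d') = P d' * FW r c d" if inv: "[a * d' = 1] (mod int p)" for a b c d d'
  proof (cases "int p ^ r dvd c")
    case True
    then obtain k where k: "c = int p ^ r * k" by blast
    have "int p dvd c" by (rule dvd_trans[OF p_dvd_pn[OF assms(1)] True])
    then have d: "[c * b + d * d' = d * d'] (mod int p)" by (simp add: cong_iff_dvd_diff)
    have "FW r (c * a) (c * b + d * d') = FW r (int p ^ r * (k * a)) (c * b + d * d')" by (simp add: k mult_ac)
    also have "\<dots> = FW r (int p ^ r * (k * a)) (d * d')" by (rule FW_cong[OF cong_refl d])
    also have "\<dots> = P d * P d' * (L k * L d * L (a * d'))" 
      unfolding FW_mult P_mult L_mult by (simp add: mult_ac)
    also have "L (a * d') = 1" using L_cong[OF inv] by simp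
    finally show ?thesis by (simp add: k FW_mult L_mult)
  next
    case False
    then show ?thesis using dvd_mult_cancel_unit[of a r c] unit_of_inverse[OF inv] by (simp add: FW_def)
  qed
qed

lemma Uf_Hecke: "Uf \<in> H.Hecke_space"
  unfolding Uf_def
proof (rule row_fun_Hecke)
  show "FU c d = FU c' d'" if "[c = c'] (mod int p ^ n)" "[d = d'] (mod int p ^ n)" for c c' d d'
    using that by (intro FU_cong cong_p)
  show "FU (u * c) (u * d) = P u * FU c d" for u c d
    unfolding FU_def P_mult[symmetric] by simp
  show "FU (c * a) (c * b + d * d') = P d' * FU c d" if "[a * d' = 1] (mod int p)" for a b c d d'
    using P_inverse[OF that] P_mult[of "- c" a] by (simp add: FU_def)
qed

text \<open>The inverse of a matrix of determinant 1 has bottom row (-c, a).\<close>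

lemma row_fun_inv:
  assumes cong: "\<And>c c' d. [c = c'] (mod int p ^ n) \<Longrightarrow> F c d = F c' d"
    and F: "\<And>a b c d. [a * d - b * c = 1] (mod int p ^ n) \<Longrightarrow> F (- c) a = \<sigma> * F c d"
    and g: "g \<in> carrier G"
  shows "row_fun F (ginv g) = \<sigma> * row_fun F g"
  using F[OF ent_det[OF g]] cong[OF ent_inv(3)[OF g]] g by (simp add: row_fun_def ent_inv)

lemma det_mod_p:
  assumes "[a * d - b * c = 1] (mod int p ^ n)" "int p dvd c"
  shows "[a * d = 1] (mod int p)"
proof -
  have "int p dvd a * d - b * c - 1" using cong_p[OF assms(1)] by (simp add: cong_iff_dvd_diff)
  then have "int p dvd (a * d - b * c - 1) + b * c" using assms(2) by (intro dvd_add) auto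
  then show ?thesis by (simp add: cong_iff_dvd_diff)
qed

lemma Yf_inv:
  assumes "1 \<le> r" "r \<le> n" "g \<in> carrier G"
  shows "Yf r (ginv g) = 1 * Yf r g"
  unfolding Yf_def
proof (rule row_fun_inv[OF _ _ assms(3)])
  show "FY r c d = FY r c' d" if "[c = c'] (mod int p ^ n)" for c c' d
    by (rule FY_cong_n[OF assms(2) that cong_refl])
  show "FY r (- c) a = 1 * FY r c d" if "[a * d - b * c = 1] (mod int p ^ n)" for a b c d
    using P_inverse[OF det_mod_p[OF that]] dvd_trans[OF p_dvd_pn[OF assms(1)], of c] by (simp add: FY_def)
qed

text \<open>From a d = 1 modulo p, the entries a and d have the same quadratic symbol, so only the
  sign of -c is left.\<close>

lemma Wf_inv:
  assumes "1 \<le> r" "r < n" "g \<in> carrier G"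
  shows "Wf r (ginv g) = L (- 1) * Wf r g"
  unfolding Wf_def
proof (rule row_fun_inv[OF _ _ assms(3)])
  show "FW r c d = FW r c' d" if "[c = c'] (mod int p ^ n)" for c c' d
    by (rule FW_cong_n[OF assms(2) that cong_refl])
  show "FW r (- c) a = L (- 1) * FW r c d" if det: "[a * d - b * c = 1] (mod int p ^ n)" for a b c d
  proof (cases "int p ^ r dvd c")
    case True
    then obtain k where k: "c = int p ^ r * k" by blast
    have "int p dvd c" by (rule dvd_trans[OF p_dvd_pn[OF assms(1)] True])
    then have ad: "[a * d = 1] (mod int p)" using det_mod_p[OF det] by blast
    have "FW r (- c) a = FW r (int p ^ r * (- k)) a" by (simp add: k)
    also have "\<dots> = P a * L ((- 1) * k * a)" unfolding FW_mult by simp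
    also have "\<dots> = P d * (L (- 1) * L k * L a * (L d * L d))"
      using P_inverse[OF ad] L_square[of d] unit_of_inverse[OF ad] by (simp add: L_mult[symmetric])
    also have "\<dots> = P d * (L (- 1) * L k * L d * L (a * d))" by (simp add: L_mult)
    finally show ?thesis using L_cong[OF ad] by (simp add: k FW_mult L_mult)
  qed (simp add: FW_def)
qed

lemma Uf_inv:
  assumes "g \<in> carrier G"
  shows "Uf (ginv g) = P (- 1) * Uf g"
  unfolding Uf_def
proof (rule row_fun_inv[OF _ _ assms])
  show "FU c d = FU c' d" if "[c = c'] (mod int p ^ n)" for c c' d
    using that by (intro FU_cong cong_p)
  show "FU (- c) a = P (- 1) * FU c d" if "[a * d - b * c = 1] (mod int p ^ n)" for a b c d
    unfolding FU_def P_mult[symmetric] by simp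
qed

text \<open>For functions in the induced space and 1 \<le> r \<le> n this says that they transform
  under the larger group K_0(p^r), which is generated by \<open>K0 p n\<close> and the y(t) with p^r
  | t.\<close>

definition y_int_inv :: "nat \<Rightarrow> (padic mat2 \<times> int \<Rightarrow> complex) \<Rightarrow> bool" where
  "y_int_inv r \<phi> \<longleftrightarrow> (\<forall>t. \<forall>g\<in>carrier G. int p ^ r dvd t \<longrightarrow> \<phi> (y_int t \<odot> g) = \<phi> g)"

lemma row_fun_y_int_inv:
  assumes cong: "\<And>c c' d d'. [c = c'] (mod int p ^ r) \<Longrightarrow> [d = d'] (mod int p ^ r) \<Longrightarrow> F c d = F c' d'"
    and r: "r \<le> n"
  shows "y_int_inv r (row_fun F)"
  unfolding y_int_inv_def
proof (intro allI ballI impI)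
  fix t g assume g: "g \<in> carrier G" and t: "int p ^ r dvd t"
  have "[ent_c g + t * ent_a g = ent_c g] (mod int p ^ r)" "[ent_d g + t * ent_b g = ent_d g] (mod int p ^ r)"
    using t by (simp_all add: cong_iff_dvd_diff)
  with y_int_row(1,2)[of t g, THEN cong_p_power[OF _ r]]
  have "F (ent_c (y_int t \<odot> g)) (ent_d (y_int t \<odot> g)) = F (ent_c g) (ent_d g)"
    by (intro cong) (auto intro: cong_trans)
  then show "row_fun F (y_int t \<odot> g) = row_fun F g" using g by (simp add: row_fun_def y_int_row)
qed

lemma Yf_y_int_inv: "1 \<le> q \<Longrightarrow> q \<le> r \<Longrightarrow> r \<le> n \<Longrightarrow> y_int_inv r (Yf q)"
  unfolding Yf_def
  by (intro row_fun_y_int_inv FY_cong) (auto intro: cong_dvd_modulus le_imp_power_dvd p_dvd_pn)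

lemma Wf_y_int_inv: "k < r \<Longrightarrow> r \<le> n \<Longrightarrow> y_int_inv r (Wf k)"
  unfolding Wf_def
  by (rule row_fun_y_int_inv, rule FW_cong)
     (erule cong_dvd_modulus, rule le_imp_power_dvd, simp, erule cong_dvd_modulus, rule p_dvd_pn, simp_all)

lemma Uf_y_int_inv: "1 \<le> r \<Longrightarrow> r \<le> n \<Longrightarrow> y_int_inv r Uf"
  unfolding Uf_def
  by (intro row_fun_y_int_inv FU_cong) (auto intro: cong_dvd_modulus p_dvd_pn)

section \<open>Sums over the coset representatives\<close>

lemma y_int_inj: "inj_on y_int {0..<int p ^ n}"
proof (rule inj_onI)
  fix x y assume "x \<in> {0..<int p ^ n}" "y \<in> {0..<int p ^ n}" "y_int x = y_int y"
  moreover from this have "[x = y] (mod int p ^ n)"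
    using int_mat_ent(3)[of 1 0 x 1] int_mat_ent(3)[of 1 0 y 1] by (simp add: y_int_def cong_def)
  ultimately show "x = y" by (simp add: cong_def)
qed

lemma wn_int_inj: "inj_on wn_int {0..<int p ^ n}"
proof (rule inj_onI)
  fix x y assume "x \<in> {0..<int p ^ n}" "y \<in> {0..<int p ^ n}" "wn_int x = wn_int y"
  moreover from this have "[- x = - y] (mod int p ^ n)"
    using int_mat_ent(4)[of 0 1 "-1" "- x"] int_mat_ent(4)[of 0 1 "-1" "- y"] by (simp add: wn_int_def cong_def)
  ultimately show "x = y" by (simp add: cong_minus_minus_iff) (simp add: cong_def)
qed

lemma y_int_wn_int_disjoint: "y_int ` p_multiples \<inter> wn_int ` {0..<int p ^ n} = {}"
proof -
  have "y_int t \<noteq> wn_int b" if "t \<in> p_multiples" for t b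
  proof
    assume "y_int t = wn_int b"
    then have "[t = - 1] (mod int p ^ n)"
      using int_mat_ent(3)[of 1 0 t 1] int_mat_ent(3)[of 0 1 "-1" "- b"] by (simp add: y_int_def wn_int_def cong_def)
    from cong_dvd_iff[OF cong_p[OF this]] that p_gt2 show False by (simp add: p_multiples_def)
  qed
  then show ?thesis by blast
qed

lemma sum_coset_reps:
  fixes F :: "_ \<Rightarrow> complex"
  shows "(\<Sum>h\<in>coset_reps. F h) = (\<Sum>t\<in>p_multiples. F (y_int t)) + (\<Sum>b\<in>{0..<int p ^ n}. F (wn_int b))"
proof -
  have "inj_on y_int p_multiples" using y_int_inj by (rule inj_on_subset) (auto simp: p_multiples_def)
  then show ?thesis
    unfolding coset_reps_def using p_multiples_finite y_int_wn_int_disjoint wn_int_inj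
    by (simp add: sum.union_disjoint sum.reindex)
qed

lemma multiples_image:
  assumes "r \<le> n"
  shows "{t \<in> {0..<int p ^ n}. int p ^ r dvd t} = (*) (int p ^ r) ` {0..<int p ^ (n - r)}"
proof -
  have split: "int p ^ n = int p ^ r * int p ^ (n - r)" using assms by (simp flip: power_add)
  have "{t \<in> {0..<m * N}. m dvd t} = (*) m ` {0..<N}" if "m > 0" for m N :: int
  proof (rule Set.set_eqI, rule iffI)
    fix t assume "t \<in> {t \<in> {0..<m * N}. m dvd t}"
    then obtain k where "t = m * k" "0 \<le> m * k" "m * k < m * N" by auto
    then show "t \<in> (*) m ` {0..<N}"
      using that by (auto simp: zero_le_mult_iff mult_less_cancel_left_pos)
  next
    fix t assume "t \<in> (*) m ` {0..<N}"
    then obtain k where "k \<in> {0..<N}" "t = m * k" by blast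
    then show "t \<in> {t \<in> {0..<m * N}. m dvd t}" using that by simp
  qed
  then show ?thesis unfolding split by simp
qed

lemma sum_p_multiples:
  fixes F :: "int \<Rightarrow> complex"
  assumes "1 \<le> r" "r \<le> n"
  shows "(\<Sum>t\<in>p_multiples. if int p ^ r dvd t then F t else 0) = (\<Sum>k\<in>{0..<int p ^ (n - r)}. F (int p ^ r * k))"
proof -
  have "(\<Sum>t\<in>p_multiples. if int p ^ r dvd t then F t else 0) = (\<Sum>t\<in>{t \<in> p_multiples. int p ^ r dvd t}. F t)"
    using p_multiples_finite by (simp add: sum.inter_filter)
  also have "{t \<in> p_multiples. int p ^ r dvd t} = {t \<in> {0..<int p ^ n}. int p ^ r dvd t}"
    using p_dvd_pn[OF assms(1)] by (auto simp: p_multiples_def intro: dvd_trans)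
  also have "\<dots> = (*) (int p ^ r) ` {0..<int p ^ (n - r)}" by (rule multiples_image[OF assms(2)])
  also have "(\<Sum>t\<in>\<dots>. F t) = (\<Sum>k\<in>{0..<int p ^ (n - r)}. F (int p ^ r * k))"
    using p_gt2 by (subst sum.reindex) (auto simp: inj_on_def)
  finally show ?thesis .
qed

lemma card_coset_reps: "card coset_reps = p ^ n + p ^ (n - 1)"
proof -
  have "of_nat (card coset_reps) = (\<Sum>h\<in>coset_reps. 1 :: complex)" by simp
  \<comment> \<open>The test holds for every t in \<open>p_multiples\<close>; it only brings the sum
    into the form of \<open>sum_p_multiples\<close> with r = 1.\<close>
  also have "\<dots> = (\<Sum>t\<in>p_multiples. if int p ^ 1 dvd t then 1 else 0) + of_nat (p ^ n)"
    unfolding sum_coset_reps by (intro arg_cong2[where f = "(+)"] sum.cong) (auto simp: p_multiples_def nat_power_eq)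
  also have "\<dots> = of_nat (p ^ (n - 1)) + of_nat (p ^ n)"
    using n_ge by (subst sum_p_multiples) (auto simp: nat_power_eq)
  also have "\<dots> = of_nat (p ^ n + p ^ (n - 1))" by simp
  finally show ?thesis by (simp only: of_nat_eq_iff)
qed

section \<open>Convolution by Y_r, W_r and U_0\<close>

lemma not_dvd_one:
  assumes "1 \<le> r"
  shows "\<not> int p ^ r dvd 1"
proof
  assume "int p ^ r dvd 1"
  then have "int p dvd 1" by (rule dvd_trans[OF p_dvd_pn[OF assms]])
  then show False using p_gt2 by simp
qed

lemma row_fun_inv_y_int:
  assumes "\<And>c c' d d'. [c = c'] (mod int p ^ n) \<Longrightarrow> [d = d'] (mod int p ^ n) \<Longrightarrow> F c d = F c' d'"
  shows "row_fun F (ginv (y_int t)) = F (- t) 1"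
  using assms[OF int_mat_ent(3,4)[of 1 0 "- t" 1]] y_int_closed[of "- t"]
  unfolding inv_y_int by (simp add: row_fun_def y_int_def int_mat_ent)

lemma row_fun_inv_wn_int:
  assumes "\<And>c c' d d'. [c = c'] (mod int p ^ n) \<Longrightarrow> [d = d'] (mod int p ^ n) \<Longrightarrow> F c d = F c' d'"
  shows "row_fun F (ginv (wn_int t)) = F 1 0"
  using assms[OF int_mat_ent(3,4)[of "- t" "-1" 1 0]] int_mat_closed[of "- t" 0 "- 1" 1]
  unfolding inv_wn_int by (simp add: row_fun_def int_mat_ent)

lemma Yf_conv:
  assumes "1 \<le> r" "r \<le> n" "\<phi> \<in> H.Ind" "g \<in> carrier G"
  shows "(Yf r \<star> \<phi>) g = (\<Sum>k\<in>{0..<int p ^ (n - r)}. \<phi> (y_int (int p ^ r * k) \<odot> g))"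
proof -
  have c: "FY r c d = FY r c' d'" if "[c = c'] (mod int p ^ n)" "[d = d'] (mod int p ^ n)" for c c' d d'
    by (rule FY_cong_n[OF assms(2) that])
  have "\<not> int p ^ r dvd 1" by (rule not_dvd_one[OF assms(1)])
  then have z: "Yf r (ginv (wn_int t)) = 0" for t
    using row_fun_inv_wn_int[of "FY r" t] c by (simp add: Yf_def FY_def)
  have y: "Yf r (ginv (y_int t)) = (if int p ^ r dvd t then 1 else 0)" for t
    using row_fun_inv_y_int[of "FY r" t] c by (simp add: Yf_def FY_def)
  have "(Yf r \<star> \<phi>) g = (\<Sum>t\<in>p_multiples. if int p ^ r dvd t then \<phi> (y_int t \<odot> g) else 0)"
    unfolding H.convolution_alt[OF Yf_Hecke[OF assms(1,2)] assms(3,4)] sum_coset_reps y z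
    by (simp add: if_distrib[of "\<lambda>x. x * _"] cong: if_cong)
  then show ?thesis using sum_p_multiples[OF assms(1,2)] by simp
qed

text \<open>The values of W_r are taken at inverses of representatives, so the weights are L (-k);
  the factor \<open>L (- 1)\<close> is their common sign.\<close>

lemma Wf_conv:
  assumes "1 \<le> r" "r < n" "\<phi> \<in> H.Ind" "g \<in> carrier G"
  shows "(Wf r \<star> \<phi>) g = L (- 1) * (\<Sum>k\<in>{0..<int p ^ (n - r)}. L k * \<phi> (y_int (int p ^ r * k) \<odot> g))"
proof -
  have c: "FW r c d = FW r c' d'" if "[c = c'] (mod int p ^ n)" "[d = d'] (mod int p ^ n)" for c c' d d'
    by (rule FW_cong_n[OF assms(2) that])
  have "\<not> int p ^ r dvd 1" by (rule not_dvd_one[OF assms(1)])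
  then have z: "Wf r (ginv (wn_int t)) = 0" for t
    using row_fun_inv_wn_int[of "FW r" t] c by (simp add: Wf_def FW_def)
  have y: "Wf r (ginv (y_int t)) = (if int p ^ r dvd t then L (- 1) * L (t div int p ^ r) else 0)" for t
  proof (cases "int p ^ r dvd t")
    case True
    then obtain k where k: "t = int p ^ r * k" by blast
    have "FW r (- t) 1 = FW r (int p ^ r * ((-1) * k)) 1" by (simp add: k)
    also have "\<dots> = L (- 1) * L k" unfolding FW_mult L_mult by simp
    finally show ?thesis using row_fun_inv_y_int[of "FW r" t] c k p_gt2 by (simp add: Wf_def)
  next
    case False
    then show ?thesis using row_fun_inv_y_int[of "FW r" t] c by (simp add: Wf_def FW_def)
  qed
  have "(Wf r \<star> \<phi>) g
      = (\<Sum>t\<in>p_multiples. if int p ^ r dvd t then L (- 1) * L (t div int p ^ r) * \<phi> (y_int t \<odot> g) else 0)"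
    unfolding H.convolution_alt[OF Wf_Hecke[OF assms(1,2)] assms(3,4)] sum_coset_reps y z
    by (simp add: if_distrib[of "\<lambda>x. x * _"] cong: if_cong)
  also have "\<dots> = (\<Sum>k\<in>{0..<int p ^ (n - r)}. L (- 1) * L k * \<phi> (y_int (int p ^ r * k) \<odot> g))"
    using assms(1,2) by (subst sum_p_multiples) auto
  finally show ?thesis by (simp add: sum_distrib_left mult.assoc)
qed

text \<open>U_0 vanishes on rows with p | c, which leaves the representatives
  \<open>wn_int b\<close>. Their inverses have lower left entry 1, hence the constant
  \<open>P (- 1)\<close>.\<close>

lemma Uf_conv:
  assumes "\<phi> \<in> H.Ind" "g \<in> carrier G"
  shows "(Uf \<star> \<phi>) g = P (- 1) * (\<Sum>b\<in>{0..<int p ^ n}. \<phi> (wn_int b \<odot> g))"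
proof -
  have c: "FU c d = FU c' d'" if "[c = c'] (mod int p ^ n)" "[d = d'] (mod int p ^ n)" for c c' d d'
    using that by (intro FU_cong cong_p)
  have z: "Uf (ginv (wn_int t)) = P (- 1)" for t
    using row_fun_inv_wn_int[of FU t] c by (simp add: Uf_def FU_def)
  have y: "Uf (ginv (y_int t)) = 0" if "t \<in> p_multiples" for t
    using row_fun_inv_y_int[of FU t] c that by (simp add: Uf_def FU_def P_def p_multiples_def)
  have "(\<Sum>t\<in>p_multiples. Uf (ginv (y_int t)) * \<phi> (y_int t \<odot> g)) = 0" using y by (intro sum.neutral) simp
  then show ?thesis
    unfolding H.convolution_alt[OF Uf_Hecke assms] sum_coset_reps z by (simp add: sum_distrib_left)
qed

lemma sum_periodic_power:
  assumes "1 \<le> r" and per: "\<And>x y. [x = y] (mod int p) \<Longrightarrow> F x = F y"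
  shows "(\<Sum>k\<in>{0..<int p ^ r}. F k :: complex) = of_nat p ^ (r - 1) * (\<Sum>k\<in>{0..<int p}. F k)"
proof -
  have "int p ^ r = int p * int (p ^ (r - 1))" using assms(1) by (cases r) auto
  then show ?thesis using sum_periodic[of "int p" F "p ^ (r - 1)"] per by simp
qed

lemma Yf_conv_inv:
  assumes "1 \<le> r" "r \<le> n" "\<phi> \<in> H.Ind" "y_int_inv r \<phi>"
  shows "Yf r \<star> \<phi> = of_nat p ^ (n - r) *\<^sub>f \<phi>"
proof
  fix g
  show "(Yf r \<star> \<phi>) g = (of_nat p ^ (n - r) *\<^sub>f \<phi>) g"
  proof (cases "g \<in> carrier G")
    case True
    then have "(Yf r \<star> \<phi>) g = (\<Sum>k\<in>{0..<int p ^ (n - r)}. \<phi> g)"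
      using assms(4) unfolding Yf_conv[OF assms(1-3) True] by (intro sum.cong) (auto simp: y_int_inv_def)
    then show ?thesis by (simp add: fscale_def nat_power_eq)
  qed (simp add: H.convolution_def fscale_def H.Ind_outside[OF assms(3)])
qed

text \<open>All translates in the sum coincide, so the weights add up to a multiple of the complete
  sum of Legendre symbols.\<close>

lemma Wf_conv_inv:
  assumes "1 \<le> r" "r < n" "\<phi> \<in> H.Ind" "y_int_inv r \<phi>"
  shows "Wf r \<star> \<phi> = 0"
proof
  fix g
  show "(Wf r \<star> \<phi>) g = 0 g"
  proof (cases "g \<in> carrier G")
    case True
    then have "(Wf r \<star> \<phi>) g = L (- 1) * (\<Sum>k\<in>{0..<int p ^ (n - r)}. L k * \<phi> g)"
      using assms(4) unfolding Wf_conv[OF assms(1-3) True]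
      by (intro arg_cong2[where f = "(*)"] sum.cong) (auto simp: y_int_inv_def)
    also have "\<dots> = 0"
      using assms(2) sum_periodic_power[of "n - r" L] L_cong sum_L by (simp flip: sum_distrib_right)
    finally show ?thesis by simp
  qed (simp add: H.convolution_def)
qed

text \<open>On rows with p^r | c the product is a correlation sum of the Legendre symbol with shift
  (c / p^r) d. Its two values p - 1 and -1 are those of the coefficient of the character in p
  Y_(r+1) - Y_r.\<close>

lemma Wf_Wf:
  assumes r: "1 \<le> r" "r < n"
  shows "Wf r \<star> Wf r = (L (- 1) * of_nat p ^ (n - r - 1)) *\<^sub>f (of_nat p *\<^sub>f Yf (r + 1) - Yf r)"
proof
  fix g
  have Ind: "Wf r \<in> H.Ind" using Wf_Hecke[OF r] H.Hecke_subset_Ind by blast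
  show "(Wf r \<star> Wf r) g = ((L (- 1) * of_nat p ^ (n - r - 1)) *\<^sub>f (of_nat p *\<^sub>f Yf (r + 1) - Yf r)) g"
  proof (cases "g \<in> carrier G")
    case g: True
    have cong: "FW r (ent_c (y_int t \<odot> g)) (ent_d (y_int t \<odot> g)) = FW r (ent_c g + t * ent_a g) (ent_d g + t * ent_b g)" for t
      by (rule FW_cong_n[OF r(2) y_int_row(1,2)])
    have W: "Wf r (y_int t \<odot> g) = of_int (snd g) * FW r (ent_c g + t * ent_a g) (ent_d g + t * ent_b g)" for t
      using g by (simp add: Wf_def row_fun_def y_int_row cong)
    show ?thesis
    proof (cases "int p ^ r dvd ent_c g")
      case True
      then obtain m where m: "ent_c g = int p ^ r * m" by blast
      have pc: "int p dvd ent_c g" by (rule dvd_trans[OF p_dvd_pn[OF r(1)] True])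
      note ad = ad_unit[OF g pc]
      have "Wf r (y_int (int p ^ r * k) \<odot> g) = of_int (snd g) * P (ent_d g) * L (k + m * ent_d g)" for k
      proof -
        have d: "[ent_d g + int p ^ r * k * ent_b g = ent_d g] (mod int p)"
          using p_dvd_pn[OF r(1)] by (simp add: cong_iff_dvd_diff)
        have "FW r (ent_c g + int p ^ r * k * ent_a g) (ent_d g + int p ^ r * k * ent_b g)
            = FW r (int p ^ r * (m + k * ent_a g)) (ent_d g)"
          using d by (intro FW_cong) (simp_all add: m algebra_simps)
        also have "\<dots> = P (ent_d g) * L (m * ent_d g + k * (ent_a g * ent_d g))"
          unfolding FW_mult by (simp add: algebra_simps)
        \<comment> \<open>The relation a d = 1 modulo p turns the coefficient of k into 1, so the
          symbol becomes a pure shift.\<close>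
        also have "L (m * ent_d g + k * (ent_a g * ent_d g)) = L (m * ent_d g + k * 1)"
          by (intro L_cong cong_add cong_mult cong_refl ad(1))
        finally show ?thesis unfolding W by (simp add: add.commute)
      qed
      then have "(Wf r \<star> Wf r) g = L (- 1) * (of_int (snd g) * P (ent_d g)) *
          (\<Sum>k\<in>{0..<int p ^ (n - r)}. L k * L (k + m * ent_d g))"
        unfolding Wf_conv[OF r Ind g] by (simp add: sum_distrib_left mult_ac)
      also have "(\<Sum>k\<in>{0..<int p ^ (n - r)}. L k * L (k + m * ent_d g))
          = of_nat p ^ (n - r - 1) * (\<Sum>k\<in>{0..<int p}. L k * L (k + m * ent_d g))"
        using r by (intro sum_periodic_power arg_cong2[where f = "(*)"] L_cong cong_add cong_refl) auto
      also have "int p dvd m * ent_d g \<longleftrightarrow> int p ^ (r + 1) dvd ent_c g"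
        using ad(3) p_gt2 by (simp add: m p_dvd_mult)
      then have "(\<Sum>k\<in>{0..<int p}. L k * L (k + m * ent_d g))
          = (if int p ^ (r + 1) dvd ent_c g then of_nat p - 1 else -1)"
        by (simp add: sum_L_L del: power_Suc power_add)
      finally show ?thesis
        using g True by (simp add: fscale_def Yf_def row_fun_def FY_def algebra_simps)
    next
      case False
      then have "\<not> int p ^ r dvd ent_c g + int p ^ r * k * ent_a g" for k
        by (metis dvd_add_left_iff dvd_triv_left mult.assoc)
      then have "(Wf r \<star> Wf r) g = 0"
        unfolding Wf_conv[OF r Ind g] W by (simp add: FW_def)
      moreover have "\<not> int p ^ (r + 1) dvd ent_c g"
        using False by (meson dvd_trans le_add1 le_imp_power_dvd)
      ultimately show ?thesis using False by (simp add: fscale_def Yf_def row_fun_def FY_def)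
    qed
  qed (simp add: H.convolution_def fscale_def Yf_def row_fun_def)
qed

text \<open>If p | c, the p^n terms P (a + b c) all equal P d and produce Y_1. Otherwise a + b c
  runs evenly through the residues modulo p, and the sum of P decides whether U_0 appears.\<close>

lemma Uf_Uf: "Uf \<star> Uf = (P (- 1) * of_nat p ^ n) *\<^sub>f Yf 1
    + (if \<eta> = triv_char then of_nat p ^ (n - 1) * (of_nat p - 1) else 0) *\<^sub>f Uf"
proof
  fix g
  define \<delta> :: complex where "\<delta> = (if \<eta> = triv_char then of_nat p ^ (n - 1) * (of_nat p - 1) else 0)"
  have Ind: "Uf \<in> H.Ind" using Uf_Hecke H.Hecke_subset_Ind by blast
  have "(Uf \<star> Uf) g = ((P (- 1) * of_nat p ^ n) *\<^sub>f Yf 1 + \<delta> *\<^sub>f Uf) g"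
  proof (cases "g \<in> carrier G")
    case g: True
    have "FU (ent_c (wn_int b \<odot> g)) (ent_d (wn_int b \<odot> g)) = FU (- (ent_a g + b * ent_c g)) 0" for b
      by (intro FU_cong cong_p[OF wn_int_row(1)])
    then have U: "Uf (wn_int b \<odot> g) = of_int (snd g) * P (ent_a g + b * ent_c g)" for b
      using g by (simp add: Uf_def row_fun_def wn_int_row FU_def add.commute)
    have conv: "(Uf \<star> Uf) g = P (- 1) * (of_int (snd g) * (\<Sum>b\<in>{0..<int p ^ n}. P (ent_a g + b * ent_c g)))"
      unfolding Uf_conv[OF Ind g] U by (simp add: sum_distrib_left)
    show ?thesis
    proof (cases "int p dvd ent_c g")
      case True
      note ad = ad_unit[OF g True]
      have "P (ent_a g + b * ent_c g) = P (ent_d g)" for b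
      proof -
        have "[ent_a g + b * ent_c g = ent_a g] (mod int p)" using True by (simp add: cong_iff_dvd_diff)
        then show ?thesis using P_cong P_inverse[OF ad(1)] by metis
      qed
      then have "(\<Sum>b\<in>{0..<int p ^ n}. P (ent_a g + b * ent_c g)) = of_nat p ^ n * P (ent_d g)"
        by (simp add: nat_power_eq)
      then show ?thesis
        unfolding conv using g True
        by (simp add: fscale_def Yf_def Uf_def row_fun_def FY_def FU_def P_def[of "- _"])
    next
      case False
      have "(\<Sum>b\<in>{0..<int p ^ n}. P (ent_a g + b * ent_c g))
          = of_nat p ^ (n - 1) * (\<Sum>b\<in>{0..<int p}. P (ent_a g + b * ent_c g))"
        using n_ge by (intro sum_periodic_power P_cong cong_add cong_mult cong_refl) auto
      also have "(\<Sum>b\<in>{0..<int p}. P (ent_a g + b * ent_c g)) = (\<Sum>b\<in>{0..<int p}. P (ent_c g * b + ent_a g))"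
        by (simp add: algebra_simps)
      also have "\<dots> = (\<Sum>b\<in>{0..<int p}. P b)"
        using coprime_p[OF False, of 1] by (intro sum_affine_residues P_cong) auto
      also have "of_nat p ^ (n - 1) * \<dots> = \<delta>" by (simp add: sum_P \<delta>_def)
      finally have sum: "(\<Sum>b\<in>{0..<int p ^ n}. P (ent_a g + b * ent_c g)) = \<delta>" .
      \<comment> \<open>\<delta> is nonzero only for the trivial character, where both values of
        \<open>P\<close> are 1.\<close>
      have \<delta>P: "\<delta> * P (- ent_c g) = \<delta> * P (- 1)"
        using False p_gt2 by (simp add: P_def \<delta>_def)
      have "((P (- 1) * of_nat p ^ n) *\<^sub>f Yf 1 + \<delta> *\<^sub>f Uf) g = of_int (snd g) * (\<delta> * P (- ent_c g))"
        using g False by (simp add: fscale_def Yf_def Uf_def row_fun_def FY_def FU_def)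
      then show ?thesis unfolding conv sum \<delta>P by simp
    qed
  qed (simp add: H.convolution_def fscale_def Yf_def Uf_def row_fun_def)
  then show "(Uf \<star> Uf) g = ((P (- 1) * of_nat p ^ n) *\<^sub>f Yf 1
      + (if \<eta> = triv_char then of_nat p ^ (n - 1) * (of_nat p - 1) else 0) *\<^sub>f Uf) g"
    unfolding \<delta>_def .
qed

section \<open>Local constancy and identification of the induced space\<close>

lemma ent_c_mult_inv:
  assumes "h \<in> carrier G"
  shows "[ent_c (g \<odot> ginv h) = ent_c g * ent_d h - ent_d g * ent_c h] (mod int p ^ n)"
proof -
  have "[ent_c g * ent_a (ginv h) + ent_d g * ent_c (ginv h) = ent_c g * ent_d h + ent_d g * (- ent_c h)] (mod int p ^ n)"
    using ent_inv[OF assms] by (intro cong_add cong_mult cong_refl) simp_all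
  then show ?thesis using ent_mult(3)[of g "ginv h"] by (simp add: cong_def)
qed

lemma ent_d_mult_inv:
  assumes "h \<in> carrier G"
  shows "[ent_d (g \<odot> ginv h) = ent_d g * ent_a h - ent_c g * ent_b h] (mod int p ^ n)"
proof -
  have "[ent_c g * ent_b (ginv h) + ent_d g * ent_d (ginv h) = ent_c g * (- ent_b h) + ent_d g * ent_a h] (mod int p ^ n)"
    using ent_inv[OF assms] by (intro cong_add cong_mult cong_refl) simp_all
  then show ?thesis using ent_mult(4)[of g "ginv h"] by (simp add: cong_def)
qed

text \<open>Elements with the same sign and the same bottom row modulo p^n differ on the left by an
  element of \<open>K0bar p n\<close> with character value 1. Fixing these discrete coordinates
  defines an open set.\<close>

lemma Ind_locally_constant:
  assumes \<phi>: "\<phi> \<in> H.Ind"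
  shows "locally_constant_on (carrier G) \<phi>"
  unfolding locally_constant_on_def
proof
  fix x assume x: "x \<in> carrier G"
  define V where "V = {y. ent_c y = ent_c x} \<inter> {y. ent_d y = ent_d x} \<inter> {y. snd y = snd x}"
  have op: "open (f -` {c})" if "continuous_on UNIV f" for f :: "padic mat2 \<times> int \<Rightarrow> int" and c
    using that by (intro open_vimage open_discrete)
  have coord: "continuous_on UNIV (\<lambda>y. f y n)" if "continuous_on UNIV f"
    for f :: "padic mat2 \<times> int \<Rightarrow> padic"
    using continuous_on_compose2[OF continuous_on_product_coordinates that] by simp
  have "V = ent_c -` {ent_c x} \<inter> ent_d -` {ent_d x} \<inter> snd -` {snd x}" by (auto simp: V_def)
  moreover have "continuous_on UNIV ent_c" "continuous_on UNIV ent_d"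
    unfolding ent_c_def[abs_def] ent_d_def[abs_def] by (intro coord continuous_intros)+
  moreover have "continuous_on UNIV (snd :: padic mat2 \<times> int \<Rightarrow> int)" by (intro continuous_intros)
  ultimately have "open V" using op by auto
  then have "openin (top_of_set (carrier G)) (carrier G \<inter> V)" by (rule openin_open_Int)
  moreover have "x \<in> carrier G \<inter> V" using x by (simp add: V_def)
  moreover have "\<phi> y = \<phi> x" if y: "y \<in> carrier G \<inter> V" for y
  proof -
    let ?q = "y \<odot> ginv x"
    have yx: "y \<in> carrier G" "ent_c y = ent_c x" "ent_d y = ent_d x" "snd y = snd x" using y by (auto simp: V_def)
    have "[ent_c ?q = 0] (mod int p ^ n)"
      using ent_c_mult_inv[OF x, of y] by (simp add: yx mult.commute)
    then have q: "?q \<in> K0bar p n" using x yx by (simp add: Q_iff cong_0_iff)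
    have "[ent_d ?q = 1] (mod int p ^ n)"
      using ent_d_mult_inv[OF x, of y] ent_det[OF x] by (simp add: yx cong_def mult.commute)
    from P_cong[OF cong_p[OF this]] have "P (ent_d ?q) = 1" by simp
    moreover have "snd ?q = 1" using snd_values[OF x] ent_inv(5)[OF x] yx by (auto simp: snd_mult)
    ultimately have "genuine_char \<eta> ?q = 1" using q by (simp add: genuine_char_eq)
    then have "\<phi> (?q \<odot> x) = \<phi> x" using H.Ind_eq[OF \<phi> q x] by simp
    moreover have "?q \<odot> x = y" using x yx(1) by (simp add: K.m_assoc)
    ultimately show ?thesis by simp
  qed
  ultimately show "\<exists>U. openin (top_of_set (carrier G)) U \<and> x \<in> U \<and> (\<forall>y\<in>U. \<phi> y = \<phi> x)"
    by blast
qed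

lemma Ind_rep_eq: "Ind_rep p n \<eta> = H.Ind"
  using Ind_locally_constant by (auto simp: Ind_rep_def H.Ind_def)

lemma Hecke_eq: "Hecke p n \<eta> = H.Hecke_space"
  by (simp add: Hecke_def H.Hecke_space_def)

section \<open>Double cosets\<close>

definition in_double_coset :: "padic mat2 \<times> int \<Rightarrow> padic mat2 \<times> int \<Rightarrow> bool" where
  "in_double_coset g x \<longleftrightarrow> (\<exists>q\<in>K0bar p n. \<exists>q'\<in>K0bar p n. x = q \<odot> g \<odot> q')"

text \<open>Equivariance determines a Hecke function on a double coset from its value at the
  representative, which settles the definite description in \<open>Hecke_elt\<close>.\<close>

lemma Hecke_elt_eqI:
  assumes g: "g \<in> carrier G" and f: "f \<in> H.Hecke_space" "f g = 1"
    and supp: "\<And>x. x \<in> carrier G \<Longrightarrow> f x \<noteq> 0 \<Longrightarrow> in_double_coset g x"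
  shows "Hecke_elt p n \<eta> g = f"
  unfolding Hecke_elt_def
proof (rule the_equality)
  let ?S = "K0bar p n <#>\<^bsub>G\<^esub> {g} <#>\<^bsub>G\<^esub> K0bar p n"
  have S: "x \<in> ?S \<longleftrightarrow> in_double_coset g x" for x by (auto simp: set_mult_def in_double_coset_def)
  have "f x = 0" if "x \<notin> carrier G" for x
    using f(1) H.Hecke_subset_Ind H.Ind_outside[OF _ that] by blast
  then show "is_Hecke_elt p n \<eta> g f"
    using f supp unfolding is_Hecke_elt_def Hecke_eq S by blast
  fix f' assume f': "is_Hecke_elt p n \<eta> g f'"
  show "f' = f"
  proof
    fix x
    show "f' x = f x"
    proof (cases "in_double_coset g x")
      case True
      then obtain q q' where "q \<in> K0bar p n" "q' \<in> K0bar p n" "x = q \<odot> g \<odot> q'" by (auto simp: in_double_coset_def)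
      then show ?thesis
        using H.Hecke_both[of f q q' g] H.Hecke_both[of f' q q' g] f f' g
        by (simp add: is_Hecke_elt_def Hecke_eq)
    next
      case False
      then have "f' x = 0" using f' S unfolding is_Hecke_elt_def by blast
      moreover have "f x = 0"
        using False supp f(1) H.Hecke_subset_Ind H.Ind_outside by blast
      ultimately show ?thesis by simp
    qed
  qed
qed

definition w_elt :: "padic mat2 \<times> int" where "w_elt = int_mat 0 1 (- 1) 0"

definition y_unit :: "padic \<Rightarrow> nat \<Rightarrow> padic mat2 \<times> int" where
  "y_unit a r = (y_mat p (a \<otimes>\<^bsub>Zp p\<^esub> Zp_of_int p (int p ^ r)), 1)"

lemma w_elt_eq: "(w_mat p, 1) = w_elt" and w_elt_closed: "w_elt \<in> carrier G"
  by (simp_all add: w_mat_def w_elt_def int_mat_def Zp_of_int_hom Zp_of_int_minus)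
     (simp add: int_mat_def[symmetric] int_mat_closed)

lemma y_unit_closed:
  assumes "a \<in> carrier (Zp p)"
  shows "y_unit a r \<in> carrier G"
proof -
  interpret Z: cring "Zp p" by (rule Zp_cring) simp
  show ?thesis using assms
    by (simp add: y_unit_def y_mat_def Kbar_carrier Z.minus_eq)
qed

lemma y_unit_ent: "[ent_c (y_unit a r) = a n * int p ^ r] (mod int p ^ n)" "[ent_d (y_unit a r) = 1] (mod int p ^ n)"
  "snd (y_unit a r) = 1"
  by (simp_all add: y_unit_def y_mat_def ent_c_def ent_d_def Zp_simps Zp_of_int_def cong_def mod_simps)

text \<open>The factorisation is x = q w(1) n(t), with n(t) upper unipotent and t = d / c modulo
  p^n.\<close>

lemma in_double_coset_w:
  assumes x: "x \<in> carrier G" and c: "\<not> int p dvd ent_c x"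
  shows "in_double_coset w_elt x"
proof -
  obtain t where t: "int p ^ n dvd ent_d x - ent_c x * t" using solve_unit[OF c] by blast
  let ?q = "x \<odot> ginv (wn_int t)"
  have q: "?q \<in> K0bar p n" using t coset_wn_int[OF x] by simp
  have n: "int_mat 1 t 0 1 \<in> carrier G" by (simp add: int_mat_closed)
  have "?q \<odot> w_elt \<odot> int_mat 1 t 0 1 = ?q \<odot> (w_elt \<odot> int_mat 1 t 0 1)"
    using x n w_elt_closed by (intro K.m_assoc) auto
  also have "w_elt \<odot> int_mat 1 t 0 1 = wn_int t" by (simp add: wn_int_def w_elt_def int_mat_mult)
  also have "?q \<odot> wn_int t = x" using x by (simp add: K.m_assoc)
  finally have "x = ?q \<odot> w_elt \<odot> int_mat 1 t 0 1" by simp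
  moreover have "int_mat 1 t 0 1 \<in> K0bar p n"
    using int_mat_closed[of 1 1 t 0] int_mat_ent(3)[of 1 t 0 1] by (simp add: Q_iff cong_0_iff)
  ultimately show ?thesis using q unfolding in_double_coset_def by blast
qed

text \<open>The quotient a / b, written b' a, is a square modulo p, and its root lifts to
  p^n.\<close>

lemma unit_square_class:
  assumes "\<not> int p dvd b" "\<not> int p dvd a" "L a = L b"
  shows "\<exists>u. \<not> int p dvd u \<and> [u\<^sup>2 * b = a] (mod int p ^ n)"
proof -
  obtain b' where b': "[b * b' = 1] (mod int p ^ n)"
    using coprime_p[OF assms(1)] cong_solve_coprime_int by blast
  have b'1: "[b * b' = 1] (mod int p)" by (rule cong_p[OF b'])
  have nb': "\<not> int p dvd b'" using unit_of_inverse[OF b'1] by simp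
  then have nz: "\<not> int p dvd b' * a" using assms by (simp add: p_dvd_mult)
  have "L (b' * a) = L b' * L b" by (simp add: L_mult assms)
  also have "\<dots> = L (b * b')" by (simp add: L_mult)
  also have "\<dots> = 1" using L_cong[OF b'1] by simp
  finally have "QuadRes (int p) (b' * a)" by (auto simp: L_def Legendre_def split: if_splits)
  then obtain y where "[y\<^sup>2 = b' * a] (mod int p)" by (auto simp: QuadRes_def)
  then obtain u where u: "[u\<^sup>2 = b' * a] (mod int p ^ n)"
    using square_lift[OF p_prime p_odd nz] by blast
  then have "[u\<^sup>2 * b = b' * a * b] (mod int p ^ n)" by (intro cong_mult cong_refl)
  also have "b' * a * b = b * b' * a" by simp
  also have "[b * b' * a = 1 * a] (mod int p ^ n)" by (intro cong_mult b' cong_refl)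
  finally have "[u\<^sup>2 * b = a] (mod int p ^ n)" by simp
  moreover have "\<not> int p dvd u\<^sup>2" using cong_dvd_iff[OF cong_p[OF u]] nz by simp
  then have "\<not> int p dvd u" by (simp add: power2_eq_square p_dvd_mult)
  ultimately show ?thesis by blast
qed

text \<open>Up to left multiplication by \<open>K0bar p n\<close>, x is y(t) with t = c / d. As d^2
  is a square, the unit part t0 of t has the symbol of (c / p^r) d, which is that of a; hence u^2 t0
  = a modulo p^n for some unit u.\<close>

lemma in_double_coset_y:
  assumes x: "x \<in> carrier G" and r: "1 \<le> r" "r < n"
    and a: "a \<in> carrier (Zp p)" "\<not> int p dvd a n"
    and c: "int p ^ r dvd ent_c x" "\<not> int p ^ Suc r dvd ent_c x"
    and La: "L (ent_c x div int p ^ r * ent_d x) = L (a n)"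
  shows "in_double_coset (y_unit a r) x"
proof -
  have "int p dvd ent_c x" by (rule dvd_trans[OF p_dvd_pn[OF r(1)] c(1)])
  then have d: "\<not> int p dvd ent_d x" using ad_unit[OF x] by blast
  obtain t where t: "int p ^ n dvd ent_c x - ent_d x * t" using solve_unit[OF d] by blast
  obtain m where m: "ent_c x = int p ^ r * m" using c(1) by blast
  have pn: "int p ^ n = int p ^ r * int p ^ (n - r)" using r by (simp flip: power_add)
  have "int p ^ r dvd ent_c x - ent_d x * t" using t unfolding pn by (rule dvd_mult_left)
  then have "int p ^ r dvd ent_c x - (ent_c x - ent_d x * t)" by (rule dvd_diff[OF c(1)])
  then have "int p ^ r dvd t" using dvd_mult_cancel_unit[OF d, of r t] by (simp add: mult.commute)
  then obtain t0 where t0: "t = int p ^ r * t0" by blast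
  have "ent_c x - ent_d x * t = int p ^ r * (m - ent_d x * t0)" by (simp add: m t0 algebra_simps)
  then have "int p ^ (n - r) dvd m - ent_d x * t0"
    using t p_gt2 unfolding pn by simp
  then have "int p dvd m - ent_d x * t0"
    using r by (intro dvd_trans[OF p_dvd_pn[of "n - r"]]) auto
  then have mt: "[m = ent_d x * t0] (mod int p)" by (simp add: cong_iff_dvd_diff)
  have "\<not> int p dvd m" using c(2) by (auto simp: m)
  then have nt0: "\<not> int p dvd t0" using cong_dvd_iff[OF mt] by (simp add: p_dvd_mult)
  have "ent_c x div int p ^ r = m" using p_gt2 by (simp add: m)
  then have "L (a n) = L m * L (ent_d x)" using La by (simp add: L_mult)
  also have "\<dots> = L t0 * (L (ent_d x) * L (ent_d x))" using L_cong[OF mt] by (simp add: L_mult)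
  finally have "L (a n) = L t0" using L_square[OF d] by simp
  from unit_square_class[OF nt0 a(2) this] obtain u where
    u: "\<not> int p dvd u" and ut: "[u\<^sup>2 * t0 = a n] (mod int p ^ n)" by blast
  \<comment> \<open>Inverting u modulo p^(2n) makes the error u v - 1 a product of two multiples of
    p^n. These become the off-diagonal entries that restore determinant 1.\<close>
  obtain v where "[u * v = 1] (mod int p ^ (n + n))"
    using coprime_p[OF u] cong_solve_coprime_int by blast
  then obtain j where "u * v = 1 + int p ^ (n + n) * j" by (metis cong_iff_lin cong_sym)
  then have uv: "u * v = 1 + int p ^ n * int p ^ n * j" by (simp add: power_add)
  let ?M = "int p ^ n"
  txt \<open>Integral matrices of determinant \<open>1\<close> that are congruent to diagonal matrices modulo \<open>p ^ n\<close>;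
    multiplying by them replaces \<open>t\<close> by \<open>u\<^sup>2 t\<close>.\<close>
  define k1 where "k1 = int_mat v (?M * j) ?M u"
  define k2 where "k2 = int_mat u (?M * j) ?M v"
  have k: "k1 \<in> carrier G" "k2 \<in> carrier G"
    unfolding k1_def k2_def using uv by (auto intro!: int_mat_closed simp: algebra_simps)
  then have kQ: "k1 \<in> K0bar p n" "k2 \<in> K0bar p n"
    using int_mat_ent(3)[of v "?M * j" ?M u] int_mat_ent(3)[of u "?M * j" ?M v]
    by (auto simp: Q_iff k1_def k2_def cong_def mod_eq_0_iff_dvd)
  define h where "h = k1 \<odot> y_int t \<odot> k2"
  have h: "h \<in> carrier G" using k by (simp add: h_def)
  have h_int_mat: "h = int_mat ((v + ?M * j * t) * u + ?M * j * ?M) ((v + ?M * j * t) * (?M * j) + ?M * j * v)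
      ((?M + u * t) * u + u * ?M) ((?M + u * t) * (?M * j) + u * v)"
    by (simp add: h_def k1_def k2_def y_int_def int_mat_mult)
  have "[(?M + u * t) * u + u * ?M = u\<^sup>2 * t] (mod ?M)"
    by (simp add: cong_iff_dvd_diff power2_eq_square algebra_simps)
  then have ech: "[ent_c h = u\<^sup>2 * t] (mod ?M)"
    unfolding h_int_mat using int_mat_ent(3) cong_trans by blast
  have "[(?M + u * t) * (?M * j) + u * v = 1] (mod ?M)"
    unfolding uv by (simp add: cong_iff_dvd_diff algebra_simps)
  then have edh: "[ent_d h = 1] (mod ?M)"
    unfolding h_int_mat using int_mat_ent(4) cong_trans by blast
  let ?y = "y_unit a r"
  have y: "?y \<in> carrier G" by (rule y_unit_closed[OF a(1)])
  have "[ent_c (h \<odot> ginv ?y) = ent_c h * ent_d ?y - ent_d h * ent_c ?y] (mod ?M)" by (rule ent_c_mult_inv[OF y])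
  also have "[ent_c h * ent_d ?y - ent_d h * ent_c ?y = u\<^sup>2 * t * 1 - 1 * (a n * int p ^ r)] (mod ?M)"
    by (intro cong_diff cong_mult ech edh y_unit_ent)
  also have "u\<^sup>2 * t * 1 - 1 * (a n * int p ^ r) = int p ^ r * (u\<^sup>2 * t0 - a n)"
    by (simp add: t0 algebra_simps)
  also have "[int p ^ r * (u\<^sup>2 * t0 - a n) = int p ^ r * (a n - a n)] (mod ?M)"
    by (intro cong_mult cong_diff ut cong_refl)
  finally have "?M dvd ent_c (h \<odot> ginv ?y)" by (simp add: cong_0_iff)
  then have q1: "h \<odot> ginv ?y \<in> K0bar p n" using h y by (simp add: Q_iff)
  have q0: "x \<odot> ginv (y_int t) \<in> K0bar p n" using t coset_y_int[OF x] by simp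
  let ?q = "x \<odot> ginv (y_int t) \<odot> ginv k1 \<odot> (h \<odot> ginv ?y)"
  have "?q \<odot> ?y \<odot> ginv k2 = x \<odot> ginv (y_int t) \<odot> ginv k1 \<odot> h \<odot> ginv k2"
    using x h y k by (simp add: K.m_assoc)
  also have "\<dots> = x"
    using x k unfolding h_def by (simp add: K.m_assoc H.inv_cancel)
  finally have "x = ?q \<odot> ?y \<odot> ginv k2" by simp
  moreover have "?q \<in> K0bar p n" using q0 q1 kQ by simp
  moreover have "ginv k2 \<in> K0bar p n" using kQ by simp
  ultimately show ?thesis unfolding in_double_coset_def by blast
qed

text \<open>For \<sigma> = 1 and \<sigma> = -1 these are V_(r,1) and V_(r,\<lambda>), recovered as
  half of V_r + \<sigma> W_r with V_r = Y_r - Y_(r+1).\<close>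

definition V_sign :: "complex \<Rightarrow> nat \<Rightarrow> padic mat2 \<times> int \<Rightarrow> complex" where
  "V_sign \<sigma> r = (1/2) *\<^sub>f (Yf r - Yf (r + 1) + \<sigma> *\<^sub>f Wf r)"

text \<open>The type \<open>summand\<close> doubles as an index of the 2n double cosets:
  \<open>S\<^sub>1\<close> stands for the identity, \<open>S\<^sub>2\<close> for w(1),
  \<open>T r\<close> and \<open>T' r\<close> for y(p^r) and y(\<lambda> p^r).\<close>

fun basis_elt :: "summand \<Rightarrow> padic mat2 \<times> int \<Rightarrow> complex" where
  "basis_elt S\<^sub>1 = Yf n"
| "basis_elt S\<^sub>2 = Uf"
| "basis_elt (T r) = V_sign 1 r"
| "basis_elt (T' r) = V_sign (- 1) r"

fun basis_rep :: "summand \<Rightarrow> padic mat2 \<times> int" where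
  "basis_rep S\<^sub>1 = \<one>\<^bsub>G\<^esub>"
| "basis_rep S\<^sub>2 = w_elt"
| "basis_rep (T r) = y_unit \<one>\<^bsub>Zp p\<^esub> r"
| "basis_rep (T' r) = y_unit l r"

definition exactly_divides :: "nat \<Rightarrow> int \<Rightarrow> bool" where
  "exactly_divides r c \<longleftrightarrow> int p ^ r dvd c \<and> \<not> int p ^ Suc r dvd c"

text \<open>For a bottom row \<open>(c, d)\<close> with \<open>c\<close> of valuation \<open>r < n\<close>, \<open>r \<ge> 1\<close>, the double coset is determined by
  the class of \<open>c d / p ^ r\<close> modulo squares.\<close>

fun coset_cond :: "summand \<Rightarrow> padic mat2 \<times> int \<Rightarrow> bool" where
  "coset_cond S\<^sub>1 x \<longleftrightarrow> int p ^ n dvd ent_c x"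
| "coset_cond S\<^sub>2 x \<longleftrightarrow> \<not> int p dvd ent_c x"
| "coset_cond (T r) x \<longleftrightarrow> exactly_divides r (ent_c x) \<and> L (ent_c x div int p ^ r * ent_d x) = 1"
| "coset_cond (T' r) x \<longleftrightarrow> exactly_divides r (ent_c x) \<and> L (ent_c x div int p ^ r * ent_d x) = - 1"

lemma summands_cases:
  assumes "j \<in> summands n"
  obtains "j = S\<^sub>1" | "j = S\<^sub>2" | r where "j = T r" "1 \<le> r" "r < n" | r where "j = T' r" "1 \<le> r" "r < n"
  using assms n_ge by (fastforce simp: summands_def)

lemma V_sign_Hecke:
  assumes "1 \<le> r" "r < n"
  shows "V_sign \<sigma> r \<in> H.Hecke_space"
  unfolding V_sign_def using assms
  by (intro fvs.subspace_scale fvs.subspace_add fvs.subspace_diff H.Hecke_subspace Yf_Hecke Wf_Hecke) auto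

lemma exactly_divides_unit:
  assumes "x \<in> carrier G" "1 \<le> r" "exactly_divides r (ent_c x)"
  shows "\<not> int p dvd ent_c x div int p ^ r * ent_d x"
proof -
  obtain k where k: "ent_c x = int p ^ r * k" using assms(3) by (auto simp: exactly_divides_def)
  then have "\<not> int p dvd k" using assms(3) by (auto simp: exactly_divides_def)
  moreover have "int p dvd ent_c x" using k p_dvd_pn[OF assms(2)] by simp
  ultimately show ?thesis using ad_unit(3)[OF assms(1)] p_gt2 by (simp add: k p_dvd_mult)
qed

lemma V_sign_eval:
  assumes x: "x \<in> carrier G" and r: "1 \<le> r"
  shows "V_sign \<sigma> r x = (if exactly_divides r (ent_c x)
    then of_int (snd x) * P (ent_d x) * (1 + \<sigma> * L (ent_c x div int p ^ r * ent_d x)) / 2 else 0)"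
proof (cases "int p ^ Suc r dvd ent_c x")
  case True
  then obtain k where "ent_c x = int p ^ Suc r * k" by blast
  then have k: "ent_c x = int p ^ r * (int p * k)" by simp
  then have "int p dvd ent_c x div int p ^ r" using p_gt2 by simp
  then have "L (ent_c x div int p ^ r * ent_d x) = 0" by (simp add: L_zero_iff)
  with True x k show ?thesis
    by (simp add: V_sign_def exactly_divides_def fscale_def Yf_def Wf_def row_fun_def FY_def FW_def)
next
  case False
  with x show ?thesis
    by (simp add: V_sign_def exactly_divides_def fscale_def Yf_def Wf_def row_fun_def FY_def FW_def algebra_simps add_divide_distrib)
qed

lemma basis_elt_Hecke: "j \<in> summands n \<Longrightarrow> basis_elt j \<in> H.Hecke_space"
  by (erule summands_cases) (use n_ge in \<open>auto intro: Yf_Hecke Uf_Hecke V_sign_Hecke\<close>)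

lemma basis_elt_zero:
  assumes j: "j \<in> summands n" and x: "x \<in> carrier G" "\<not> coset_cond j x"
  shows "basis_elt j x = 0"
  using j
proof (cases rule: summands_cases)
  case 1
  then show ?thesis using x by (simp add: Yf_def row_fun_def FY_def)
next
  case 2
  then show ?thesis using x by (simp add: Uf_def row_fun_def FU_def P_def)
next
  case (3 r)
  have "L (ent_c x div int p ^ r * ent_d x) = - 1" if "exactly_divides r (ent_c x)"
    using L_square[OF exactly_divides_unit[OF x(1) 3(2) that]] x(2) that 3 square_eq_1_iff by force
  then show ?thesis using 3 x by (simp add: V_sign_eval)
next
  case (4 r)
  have "L (ent_c x div int p ^ r * ent_d x) = 1" if "exactly_divides r (ent_c x)"
    using L_square[OF exactly_divides_unit[OF x(1) 4(2) that]] x(2) that 4 square_eq_1_iff by force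
  then show ?thesis using 4 x by (simp add: V_sign_eval)
qed

lemma one_closed_n: "\<one>\<^bsub>Zp p\<^esub> \<in> carrier (Zp p)" "\<one>\<^bsub>Zp p\<^esub> n = 1"
  using p_gt2 n_ge by (simp_all add: Zp_of_int_hom(3)) (simp add: Zp_of_int_def)

lemma l_unit_n: "\<not> int p dvd l n"
  using L_l L_zero_iff[of "l n"] by simp

lemma coset_cond_in_double_coset:
  assumes j: "j \<in> summands n" and x: "x \<in> carrier G" "coset_cond j x"
  shows "in_double_coset (basis_rep j) x"
  using j
proof (cases rule: summands_cases)
  case 1
  then have "x \<in> K0bar p n" using x by (simp add: Q_iff)
  moreover have "x = x \<odot> \<one>\<^bsub>G\<^esub> \<odot> \<one>\<^bsub>G\<^esub>" using x by simp
  ultimately show ?thesis unfolding in_double_coset_def 1 basis_rep.simps using H.Q_one by blast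
next
  case 2
  then show ?thesis using x in_double_coset_w by simp
next
  case (3 r)
  have "\<not> int p dvd (1::int)" using p_gt2 by simp
  then show ?thesis
    using in_double_coset_y[OF x(1) 3(2,3) one_closed_n(1)] x(2) 3 by (simp add: one_closed_n(2) exactly_divides_def)
next
  case (4 r)
  then show ?thesis
    using in_double_coset_y[OF x(1) 4(2,3) l_closed l_unit_n] x(2) by (simp add: L_l exactly_divides_def)
qed

lemma exactly_divides_unique:
  assumes "exactly_divides r c" "exactly_divides q c"
  shows "r = q"
proof -
  have "\<not> r < q" if "exactly_divides r c" "exactly_divides q c" for r q
  proof
    assume "r < q"
    then have "int p ^ Suc r dvd int p ^ q" by (intro le_imp_power_dvd) simp
    then show False using that by (meson exactly_divides_def dvd_trans)
  qed
  then show ?thesis using assms by (metis linorder_neqE_nat)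
qed

lemma coset_cond_unique:
  assumes i: "i \<in> summands n" "coset_cond i x" and j: "j \<in> summands n" "coset_cond j x"
  shows "i = j"
proof -
  have A: "int p dvd ent_c x" if "exactly_divides r (ent_c x)" "1 \<le> r" for r
    using that p_dvd_pn dvd_trans unfolding exactly_divides_def by blast
  have B: "\<not> int p ^ n dvd ent_c x" if "exactly_divides r (ent_c x)" "r < n" for r
  proof
    assume "int p ^ n dvd ent_c x"
    moreover have "int p ^ Suc r dvd int p ^ n" using that by (intro le_imp_power_dvd) simp
    ultimately show False using that by (meson exactly_divides_def dvd_trans)
  qed
  have C: "int p ^ n dvd ent_c x \<Longrightarrow> int p dvd ent_c x"
    using n_ge by (intro dvd_trans[OF p_dvd_pn[of n]]) auto
  have D: False if "exactly_divides r (ent_c x)" "exactly_divides q (ent_c x)" "L (ent_c x div int p ^ r * ent_d x) = 1"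
    "L (ent_c x div int p ^ q * ent_d x) = - 1" for r q
    using exactly_divides_unique[OF that(1,2)] that(3,4) by simp
  from i(1) show ?thesis
    by (cases rule: summands_cases; use j(1) in \<open>cases rule: summands_cases\<close>)
       (use i(2) j(2) A B C D exactly_divides_unique in auto)
qed

lemma coset_cond_exists:
  assumes x: "x \<in> carrier G"
  shows "\<exists>j\<in>summands n. coset_cond j x"
proof (cases "int p dvd ent_c x \<and> \<not> int p ^ n dvd ent_c x")
  case False
  then have "coset_cond S\<^sub>1 x \<or> coset_cond S\<^sub>2 x" by auto
  then show ?thesis by (auto simp: summands_def)
next
  case True
  \<comment> \<open>One more than the valuation of c. The case assumption places that valuation
    between 1 and n - 1.\<close>
  define m where "m = (LEAST m. \<not> int p ^ m dvd ent_c x)"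
  have m: "\<not> int p ^ m dvd ent_c x" unfolding m_def by (rule LeastI[of _ n]) (use True in simp)
  have "m \<le> n" unfolding m_def by (rule Least_le) (use True in simp)
  have "m \<noteq> 0" "m \<noteq> 1" using m True by (metis one_dvd power_0, metis power_one_right)
  then obtain r where r: "m = Suc r" "1 \<le> r" "r < n" using \<open>m \<le> n\<close> by (cases m) auto
  have "int p ^ r dvd ent_c x" using not_less_Least[of r "\<lambda>m. \<not> int p ^ m dvd ent_c x"] r by (simp add: m_def)
  then have ex: "exactly_divides r (ent_c x)" using m r by (simp add: exactly_divides_def)
  have "L (ent_c x div int p ^ r * ent_d x) = 1 \<or> L (ent_c x div int p ^ r * ent_d x) = - 1"
    using L_square[OF exactly_divides_unit[OF x r(2) ex]] square_eq_1_iff by blast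
  then have "coset_cond (T r) x \<or> coset_cond (T' r) x" using ex by auto
  moreover have "T r \<in> summands n" "T' r \<in> summands n" using r by (auto simp: summands_def)
  ultimately show ?thesis by blast
qed

lemma basis_rep_closed: "basis_rep j \<in> carrier G"
  by (cases j) (simp_all add: w_elt_closed y_unit_closed one_closed_n l_closed)

lemma row_fun_at:
  assumes "\<And>c c' d d'. [c = c'] (mod int p ^ n) \<Longrightarrow> [d = d'] (mod int p ^ n) \<Longrightarrow> F c d = F c' d'"
    and "g \<in> carrier G" "[ent_c g = c] (mod int p ^ n)" "[ent_d g = d] (mod int p ^ n)" "snd g = 1"
  shows "row_fun F g = F c d"
  using assms(1)[OF assms(3,4)] assms(2,5) by (simp add: row_fun_def)

lemma V_sign_y_unit:
  assumes r: "1 \<le> r" "r < n" and a: "a \<in> carrier (Zp p)" "\<not> int p dvd a n"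
  shows "V_sign \<sigma> r (y_unit a r) = (1 + \<sigma> * L (a n)) / 2"
proof -
  note at = row_fun_at[OF _ y_unit_closed[OF a(1)] y_unit_ent[of a r]]
  have "Yf r (y_unit a r) = FY r (a n * int p ^ r) 1"
    unfolding Yf_def using r by (intro at FY_cong_n) auto
  moreover have "Yf (r + 1) (y_unit a r) = FY (r + 1) (a n * int p ^ r) 1"
    unfolding Yf_def using r by (intro at FY_cong_n) auto
  moreover have "Wf r (y_unit a r) = FW r (int p ^ r * a n) 1"
    unfolding Wf_def using r at[of "FW r"] FW_cong_n by (simp add: mult.commute)
  moreover have "\<not> int p ^ (r + 1) dvd a n * int p ^ r"
    using a(2) p_gt2 by simp
  ultimately show ?thesis
    using p_gt2 unfolding FW_mult by (simp add: V_sign_def fscale_def FY_def add_divide_distrib)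
qed

lemma basis_elt_rep:
  assumes "j \<in> summands n"
  shows "basis_elt j (basis_rep j) = 1"
  using assms
proof (cases rule: summands_cases)
  case 1
  have "row_fun (FY n) \<one>\<^bsub>G\<^esub> = FY n 0 1"
    unfolding int_mat_one by (rule row_fun_at) (auto intro: FY_cong_n int_mat_closed int_mat_ent)
  then show ?thesis by (simp add: 1 Yf_def FY_def)
next
  case 2
  have "row_fun FU w_elt = FU (- 1) 0"
    unfolding w_elt_def by (rule row_fun_at) (auto intro: FU_cong cong_p int_mat_closed int_mat_ent)
  then show ?thesis by (simp add: 2 Uf_def FU_def)
next
  case (3 r)
  have "\<not> int p dvd (1::int)" using p_gt2 by simp
  then show ?thesis using 3 V_sign_y_unit[OF 3(2,3) one_closed_n(1), of 1] by (simp add: one_closed_n(2))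
next
  case (4 r)
  then show ?thesis using V_sign_y_unit[OF 4(2,3) l_closed l_unit_n, of "- 1"] by (simp add: L_l)
qed

lemma Hecke_elt_basis:
  assumes "j \<in> summands n"
  shows "Hecke_elt p n \<eta> (basis_rep j) = basis_elt j"
proof (rule Hecke_elt_eqI[OF basis_rep_closed basis_elt_Hecke[OF assms] basis_elt_rep[OF assms]])
  show "in_double_coset (basis_rep j) x" if "x \<in> carrier G" "basis_elt j x \<noteq> 0" for x
    using that basis_elt_zero[OF assms] coset_cond_in_double_coset[OF assms] by blast
qed

text \<open>The double cosets partition the group, so the coefficient at j is the value of f at the
  representative of the j-th one.\<close>

lemma Hecke_space_span: "H.Hecke_space \<subseteq> fvs.span (basis_elt ` summands n)"
proof
  fix f assume f: "f \<in> H.Hecke_space"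
  have fin: "finite (summands n)" by (simp add: summands_def)
  have "f = (\<Sum>j\<in>summands n. f (basis_rep j) *\<^sub>f basis_elt j)"
  proof
    fix x
    show "f x = (\<Sum>j\<in>summands n. f (basis_rep j) *\<^sub>f basis_elt j) x"
    proof (cases "x \<in> carrier G")
      case True
      then obtain j where j: "j \<in> summands n" "coset_cond j x" using coset_cond_exists by blast
      then obtain q q' where q: "q \<in> K0bar p n" "q' \<in> K0bar p n" "x = q \<odot> basis_rep j \<odot> q'"
        using coset_cond_in_double_coset True unfolding in_double_coset_def by blast
      have "f x = f (basis_rep j) * basis_elt j x"
        using H.Hecke_both[OF f q(1,2) basis_rep_closed] basis_elt_rep[OF j(1)]
          H.Hecke_both[OF basis_elt_Hecke[OF j(1)] q(1,2) basis_rep_closed[of j]] q(3) by simp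
      also have "\<dots> = (\<Sum>i\<in>summands n. if i = j then f (basis_rep i) * basis_elt i x else 0)"
        using j fin by simp
      also have "\<dots> = (\<Sum>i\<in>summands n. f (basis_rep i) * basis_elt i x)"
        using basis_elt_zero[OF _ True] coset_cond_unique[OF _ _ j] by (intro sum.cong) auto
      finally show ?thesis by (simp add: sum_fun_apply fscale_def)
    next
      case False
      have "f' x = 0" if "f' \<in> H.Hecke_space" for f'
        using that H.Hecke_subset_Ind H.Ind_outside[OF _ False] by blast
      then have "f x = 0" "\<And>j. j \<in> summands n \<Longrightarrow> basis_elt j x = 0"
        using f basis_elt_Hecke by blast+
      then show ?thesis by (simp add: sum_fun_apply fscale_def)
    qed
  qed
  then show "f \<in> fvs.span (basis_elt ` summands n)"
    by (metis (no_types, lifting) fvs.span_base fvs.span_scale fvs.span_sum imageI)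
qed

section \<open>The orthogonal idempotents\<close>

lemma conv_outside: "g \<notin> carrier G \<Longrightarrow> (f \<star> \<phi>) g = 0"
  by (simp add: H.convolution_def)

lemma conv_swap_zero:
  assumes "f \<in> H.Hecke_space" "f' \<in> H.Hecke_space" "\<sigma> \<noteq> 0" "\<tau> \<noteq> 0" "f \<star> f' = 0"
    and "\<And>g. g \<in> carrier G \<Longrightarrow> f (ginv g) = \<sigma> * f g" "\<And>g. g \<in> carrier G \<Longrightarrow> f' (ginv g) = \<tau> * f' g"
  shows "f' \<star> f = 0"
proof
  fix g
  show "(f' \<star> f) g = 0 g"
  proof (cases "g \<in> carrier G")
    case True
    have "(f \<star> f') (ginv g) = \<sigma> * \<tau> * (f' \<star> f) g"
      by (rule H.convolution_reverse[OF assms(1,2,6,7) True])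
    then show ?thesis using assms(3,4,5) by simp
  qed (simp add: conv_outside)
qed

text \<open>Both sides of \<open>f \<star> f' = c *\<^sub>f f'\<close> acquire the same factor
  \<tau> under inversion because f is invariant. It is applied with Y_r in the place of f.\<close>

lemma conv_swap_scale:
  assumes "f \<in> H.Hecke_space" "f' \<in> H.Hecke_space" "\<tau> \<noteq> 0" "f \<star> f' = c *\<^sub>f f'"
    and "\<And>g. g \<in> carrier G \<Longrightarrow> f (ginv g) = 1 * f g" "\<And>g. g \<in> carrier G \<Longrightarrow> f' (ginv g) = \<tau> * f' g"
  shows "f' \<star> f = c *\<^sub>f f'"
proof
  fix g
  show "(f' \<star> f) g = (c *\<^sub>f f') g"
  proof (cases "g \<in> carrier G")
    case True
    have "(f \<star> f') (ginv g) = 1 * \<tau> * (f' \<star> f) g"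
      by (rule H.convolution_reverse[OF assms(1,2,5,6) True])
    then show ?thesis using assms(3,4) assms(6)[OF True] by (simp add: fscale_def)
  next
    case False
    have "f' g = 0" using assms(2) H.Hecke_subset_Ind H.Ind_outside[OF _ False] by blast
    then show ?thesis using False by (simp add: conv_outside fscale_def)
  qed
qed

lemma sign_nonzero: "L (- 1) \<noteq> 0" "P (- 1) \<noteq> 0" "L (- 1) * L (- 1) = 1"
proof -
  have "\<not> int p dvd (- 1 :: int)" using p_gt2 by simp
  then show "L (- 1) \<noteq> 0" "P (- 1) \<noteq> 0" "L (- 1) * L (- 1) = 1"
    using L_zero_iff[of "- 1"] P_square[of "- 1"] L_square[of "- 1"] by auto
qed

lemma Hecke_Ind: "f \<in> H.Hecke_space \<Longrightarrow> f \<in> H.Ind"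
  using H.Hecke_subset_Ind by blast

lemma y_int_inv_mono: "y_int_inv k f \<Longrightarrow> k \<le> r \<Longrightarrow> y_int_inv r f"
  unfolding y_int_inv_def by (meson dvd_trans le_imp_power_dvd)

text \<open>The coefficient stays free here and in \<open>u_comb\<close>, so that each product is
  computed once for both members of a pair.\<close>

definition v_comb :: "complex \<Rightarrow> nat \<Rightarrow> padic mat2 \<times> int \<Rightarrow> complex" where
  "v_comb c k = of_nat p *\<^sub>f Yf (k + 1) - Yf k + c *\<^sub>f Wf k"

definition u_comb :: "complex \<Rightarrow> padic mat2 \<times> int \<Rightarrow> complex" where
  "u_comb a = Uf + a *\<^sub>f Yf 1"

lemma v_comb_Hecke: "1 \<le> k \<Longrightarrow> k < n \<Longrightarrow> v_comb c k \<in> H.Hecke_space"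
  unfolding v_comb_def
  by (intro fvs.subspace_add fvs.subspace_diff fvs.subspace_scale H.Hecke_subspace Yf_Hecke Wf_Hecke) auto

lemma u_comb_Hecke: "u_comb a \<in> H.Hecke_space"
  unfolding u_comb_def using n_ge
  by (intro fvs.subspace_add fvs.subspace_scale H.Hecke_subspace Yf_Hecke Uf_Hecke) auto

text \<open>On functions invariant under y(p^k t), both p Y_(k+1) and Y_k act as the scalar p^(n-k),
  while W_k acts as zero.\<close>

lemma v_comb_conv_low:
  assumes k: "1 \<le> k" "k < n" and \<phi>: "\<phi> \<in> H.Ind" "y_int_inv k \<phi>"
  shows "v_comb c k \<star> \<phi> = 0"
proof -
  have n: "n - k = Suc (n - Suc k)" using k by simp
  have "Yf (k + 1) \<star> \<phi> = of_nat p ^ (n - Suc k) *\<^sub>f \<phi>"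
    using Yf_conv_inv[of "k + 1" \<phi>] k \<phi> y_int_inv_mono[OF \<phi>(2)] by simp
  moreover have "Yf k \<star> \<phi> = of_nat p ^ Suc (n - Suc k) *\<^sub>f \<phi>"
    using Yf_conv_inv[of k \<phi>] k \<phi> unfolding n by simp
  moreover have "Wf k \<star> \<phi> = 0" by (rule Wf_conv_inv[OF k \<phi>])
  ultimately show ?thesis unfolding v_comb_def H.convolution_linear by simp
qed

text \<open>The mirror image of \<open>v_comb_conv_low\<close>. The three products are transported
  by inversion, of which f is an eigenvector.\<close>

lemma low_conv_v_comb:
  assumes k: "1 \<le> k" "k < n" and f: "f \<in> H.Hecke_space" "y_int_inv k f"
    and \<tau>: "\<tau> \<noteq> 0" "\<And>g. g \<in> carrier G \<Longrightarrow> f (ginv g) = \<tau> * f g"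
  shows "f \<star> v_comb c k = 0"
proof -
  have n: "n - k = Suc (n - Suc k)" using k by simp
  have "f \<star> Yf (k + 1) = of_nat p ^ (n - Suc k) *\<^sub>f f"
  proof (rule conv_swap_scale[OF _ f(1) \<tau>(1) _ _ \<tau>(2)])
    show "Yf (k + 1) \<star> f = of_nat p ^ (n - Suc k) *\<^sub>f f"
      using Yf_conv_inv[of "k + 1" f] k y_int_inv_mono[OF f(2)] Hecke_Ind[OF f(1)] by simp
  qed (use k Yf_Hecke Yf_inv in auto)
  moreover have "f \<star> Yf k = of_nat p ^ Suc (n - Suc k) *\<^sub>f f"
  proof (rule conv_swap_scale[OF _ f(1) \<tau>(1) _ _ \<tau>(2)])
    show "Yf k \<star> f = of_nat p ^ Suc (n - Suc k) *\<^sub>f f"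
      using Yf_conv_inv[of k f] k f(2) Hecke_Ind[OF f(1)] unfolding n by simp
  qed (use k Yf_Hecke Yf_inv in auto)
  moreover have "f \<star> Wf k = 0"
    by (rule conv_swap_zero[OF Wf_Hecke[OF k] f(1) sign_nonzero(1) \<tau>(1)
          Wf_conv_inv[OF k Hecke_Ind[OF f(1)] f(2)] Wf_inv[OF k] \<tau>(2)])
  ultimately show ?thesis unfolding v_comb_def H.convolution_linear by simp
qed

text \<open>Since j < k, the constituents Y_(j+1), Y_j and W_j are all invariant under y(p^k t), and
  v_k annihilates such functions from both sides.\<close>

lemma v_comb_orth_less:
  assumes "1 \<le> j" "j < k" "k < n"
  shows "v_comb c k \<star> v_comb c' j = 0" "v_comb c' j \<star> v_comb c k = 0"
proof -
  have inv: "y_int_inv k (Yf (j + 1))" "y_int_inv k (Yf j)" "y_int_inv k (Wf j)"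
    using assms by (auto intro!: Yf_y_int_inv Wf_y_int_inv)
  have Hk: "Yf (j + 1) \<in> H.Hecke_space" "Yf j \<in> H.Hecke_space" "Wf j \<in> H.Hecke_space"
    using assms by (auto intro!: Yf_Hecke Wf_Hecke)
  have k: "1 \<le> k" "k < n" using assms by auto
  have "v_comb c k \<star> Yf (j + 1) = 0" "v_comb c k \<star> Yf j = 0" "v_comb c k \<star> Wf j = 0"
    using inv Hk by (auto intro!: v_comb_conv_low[OF k] Hecke_Ind)
  then show "v_comb c k \<star> v_comb c' j = 0"
    unfolding v_comb_def[of c' j] H.convolution_linear by simp
  have "Yf (j + 1) \<star> v_comb c k = 0"
    by (rule low_conv_v_comb[OF k Hk(1) inv(1), of 1]) (use assms Yf_inv in auto)
  moreover have "Yf j \<star> v_comb c k = 0"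
    by (rule low_conv_v_comb[OF k Hk(2) inv(2), of 1]) (use assms Yf_inv in auto)
  moreover have "Wf j \<star> v_comb c k = 0"
    by (rule low_conv_v_comb[OF k Hk(3) inv(3) sign_nonzero(1)]) (use assms Wf_inv in auto)
  ultimately show "v_comb c' j \<star> v_comb c k = 0"
    unfolding v_comb_def[of c' j] H.convolution_linear by simp
qed

lemma u_comb_v_comb_orth:
  assumes k: "1 \<le> k" "k < n"
  shows "v_comb c k \<star> u_comb a = 0" "u_comb a \<star> v_comb c k = 0"
proof -
  have inv: "y_int_inv k Uf" "y_int_inv k (Yf 1)" using k by (auto intro!: Yf_y_int_inv Uf_y_int_inv)
  have Hk: "Uf \<in> H.Hecke_space" "Yf 1 \<in> H.Hecke_space" using k by (auto intro!: Yf_Hecke Uf_Hecke)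
  have "v_comb c k \<star> Uf = 0" "v_comb c k \<star> Yf 1 = 0"
    using inv Hk by (auto intro!: v_comb_conv_low[OF k] Hecke_Ind)
  then show "v_comb c k \<star> u_comb a = 0" unfolding u_comb_def H.convolution_linear by simp
  have "Uf \<star> v_comb c k = 0" by (rule low_conv_v_comb[OF k Hk(1) inv(1) sign_nonzero(2) Uf_inv])
  moreover have "Yf 1 \<star> v_comb c k = 0"
    by (rule low_conv_v_comb[OF k Hk(2) inv(2), of 1]) (use k Yf_inv in auto)
  ultimately show "u_comb a \<star> v_comb c k = 0" unfolding u_comb_def H.convolution_linear by simp
qed

text \<open>Y_(k+1) acts as a scalar on all three constituents, Y_k and W_k annihilate each other,
  and W_k squares to a multiple of p Y_(k+1) - Y_k. Thus the plane spanned by W_k and p Y_(k+1) -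
  Y_k is closed under products.\<close>

lemma v_comb_v_comb:
  assumes k: "1 \<le> k" "k < n"
  shows "v_comb c k \<star> v_comb c' k = (of_nat p ^ (n - k - 1) * (of_nat p + c * c' * L (- 1))) *\<^sub>f
      (of_nat p *\<^sub>f Yf (k + 1) - Yf k) + (of_nat p ^ (n - k) * (c + c')) *\<^sub>f Wf k"
proof -
  define N :: complex where "N = of_nat p ^ (n - k - 1)"
  have pN: "of_nat p ^ (n - k) = of_nat p * N"
    using k by (simp add: N_def flip: power_Suc) (simp add: Suc_diff_Suc)
  have Hk: "Yf (k + 1) \<in> H.Hecke_space" "Yf k \<in> H.Hecke_space" "Wf k \<in> H.Hecke_space"
    using k by (auto intro!: Yf_Hecke Wf_Hecke)
  note Ind = Hk[THEN Hecke_Ind]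
  have inv: "y_int_inv (k + 1) (Yf (k + 1))" "y_int_inv (k + 1) (Yf k)" "y_int_inv (k + 1) (Wf k)" "y_int_inv k (Yf k)"
    using k by (auto intro!: Yf_y_int_inv Wf_y_int_inv)
  have Y1: "Yf (k + 1) \<star> \<phi> = N *\<^sub>f \<phi>" if "\<phi> \<in> H.Ind" "y_int_inv (k + 1) \<phi>" for \<phi>
    using Yf_conv_inv[of "k + 1" \<phi>] that k by (simp add: N_def)
  have Y0: "Yf k \<star> Yf k = (of_nat p * N) *\<^sub>f Yf k"
    using Yf_conv_inv[of k "Yf k"] Ind inv k pN by simp
  have W0: "Wf k \<star> Yf k = 0" by (rule Wf_conv_inv[OF k Ind(2) inv(4)])
  have W1: "Yf k \<star> Wf k = 0"
    by (rule conv_swap_zero[OF Hk(3,2) sign_nonzero(1) _ W0 Wf_inv[OF k], of 1]) (use k Yf_inv in auto)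
  have YY: "Yf k \<star> Yf (k + 1) = N *\<^sub>f Yf k"
    by (rule conv_swap_scale[OF Hk(1,2) _ Y1[OF Ind(2) inv(2)], of 1]) (use k Yf_inv in auto)
  have WY: "Wf k \<star> Yf (k + 1) = N *\<^sub>f Wf k"
    by (rule conv_swap_scale[OF Hk(1,3) sign_nonzero(1) Y1[OF Ind(3) inv(3)] _ Wf_inv[OF k]])
       (use k Yf_inv in auto)
  have WW: "Wf k \<star> Wf k = (L (- 1) * N) *\<^sub>f (of_nat p *\<^sub>f Yf (k + 1) - Yf k)"
    using Wf_Wf[OF k] by (simp add: N_def)
  have "v_comb c k \<star> v_comb c' k = (N * (of_nat p + c * c' * L (- 1))) *\<^sub>f
      (of_nat p *\<^sub>f Yf (k + 1) - Yf k) + ((of_nat p * N) * (c + c')) *\<^sub>f Wf k"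
    unfolding v_comb_def H.convolution_linear Y1[OF Ind(1) inv(1)] Y1[OF Ind(2) inv(2)] Y1[OF Ind(3) inv(3)]
      Y0 W0 W1 YY WY WW
    by (rule ext) (simp add: fscale_def algebra_simps)
  then show ?thesis unfolding pN N_def .
qed

text \<open>Y_1 acts as the scalar p^(n-1) on both itself and U_0; everything else is the square of
  U_0.\<close>

lemma u_comb_u_comb:
  "u_comb a \<star> u_comb b
    = ((if \<eta> = triv_char then of_nat p ^ (n - 1) * (of_nat p - 1) else 0) + (a + b) * of_nat p ^ (n - 1)) *\<^sub>f Uf
      + (of_nat p ^ (n - 1) * (P (- 1) * of_nat p + a * b)) *\<^sub>f Yf 1"
proof -
  define \<delta> :: complex where "\<delta> = (if \<eta> = triv_char then of_nat p ^ (n - 1) * (of_nat p - 1) else 0)"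
  define N :: complex where "N = of_nat p ^ (n - 1)"
  have pn: "of_nat p ^ n = of_nat p * N" using n_ge by (simp add: N_def flip: power_Suc)
  have Hk: "Uf \<in> H.Hecke_space" "Yf 1 \<in> H.Hecke_space" using n_ge by (auto intro!: Yf_Hecke Uf_Hecke)
  note Ind = Hk[THEN Hecke_Ind]
  have inv: "y_int_inv 1 Uf" "y_int_inv 1 (Yf 1)" using n_ge by (auto intro!: Yf_y_int_inv Uf_y_int_inv)
  have YU: "Yf 1 \<star> Uf = N *\<^sub>f Uf" and YY: "Yf 1 \<star> Yf 1 = N *\<^sub>f Yf 1"
    using Yf_conv_inv[of 1] Ind inv n_ge by (simp_all add: N_def)
  have UY: "Uf \<star> Yf 1 = N *\<^sub>f Uf"
    by (rule conv_swap_scale[OF Hk(2,1) sign_nonzero(2) YU _ Uf_inv]) (use n_ge Yf_inv in auto)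
  have UU: "Uf \<star> Uf = (P (- 1) * (of_nat p * N)) *\<^sub>f Yf 1 + \<delta> *\<^sub>f Uf"
    using Uf_Uf unfolding \<delta>_def pn .
  have "u_comb a \<star> u_comb b = (\<delta> + (a + b) * N) *\<^sub>f Uf + (N * (P (- 1) * of_nat p + a * b)) *\<^sub>f Yf 1"
    unfolding u_comb_def H.convolution_linear YU YY UY UU
    by (rule ext) (simp add: fscale_def algebra_simps)
  then show ?thesis unfolding \<delta>_def N_def .
qed

section \<open>The vectors of the theorem as functions of the bottom row\<close>

lemma I_elt_eq: "I_elt p n \<eta> = Yf n"
  using Hecke_elt_basis[of "S\<^sub>1"] by (simp add: I_elt_def summands_def Kbar_def sign_group_def)

lemma U0_elt_eq: "U0_elt p n \<eta> = Uf"
  using Hecke_elt_basis[of "S\<^sub>2"] by (simp add: U0_elt_def summands_def w_elt_eq)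

lemma Vra_elt_eq:
  assumes "1 \<le> r" "r < n"
  shows "Vra_elt p n \<eta> r \<one>\<^bsub>Zp p\<^esub> = V_sign 1 r" "Vra_elt p n \<eta> r l = V_sign (- 1) r"
proof -
  have "T r \<in> summands n" "T' r \<in> summands n" using assms by (auto simp: summands_def)
  from this[THEN Hecke_elt_basis]
  show "Vra_elt p n \<eta> r \<one>\<^bsub>Zp p\<^esub> = V_sign 1 r" "Vra_elt p n \<eta> r l = V_sign (- 1) r"
    by (simp_all add: Vra_elt_def y_unit_def)
qed

lemma V_elt_eq: "1 \<le> r \<Longrightarrow> r < n \<Longrightarrow> V_elt p n \<eta> l r = Yf r - Yf (r + 1)"
  unfolding V_elt_def Vra_elt_eq V_sign_def by (rule ext) (simp add: fscale_def field_simps)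

lemma W_elt_eq: "1 \<le> r \<Longrightarrow> r < n \<Longrightarrow> W_elt p n \<eta> l r = Wf r"
  unfolding W_elt_def Vra_elt_eq V_sign_def by (rule ext) (simp add: fscale_def field_simps)

text \<open>V_j = Y_j - Y_(j+1) and I = Y_n, so the defining sum telescopes.\<close>

lemma Y_elt_eq:
  assumes "1 \<le> r" "r \<le> n"
  shows "Y_elt p n \<eta> l r = Yf r"
proof -
  have "(\<Sum>j = r..<n. V_elt p n \<eta> l j) = (\<Sum>j = r..<n. Yf j - Yf (Suc j))"
    using assms by (intro sum.cong) (auto simp: V_elt_eq)
  also have "\<dots> = - (\<Sum>j = r..<n. Yf (Suc j) - Yf j)" by (simp add: sum_subtractf)
  also have "\<dots> = Yf r - Yf n" using assms(2) by (simp add: sum_Suc_diff')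
  finally show ?thesis by (simp add: Y_elt_def I_elt_eq)
qed

lemma of_int_p_star: "of_int (p_star p) = L (- 1) * of_nat p"
  by (simp add: p_star_def L_def)

lemma s_s: "s * s = L (- 1) * of_nat p"
  using s_square by (simp add: power2_eq_square of_int_p_star)

lemma s_nonzero: "s \<noteq> 0"
  using s_s sign_nonzero p_gt2 by auto

definition v_coeff :: complex where "v_coeff = of_nat p / s"

text \<open>This identity makes the factor p + c c' L (-1) in \<open>v_comb_v_comb\<close> equal to
  2p for c' = c = \<open>v_coeff\<close> and to 0 for c' = -c.\<close>

lemma v_coeff_v_coeff: "v_coeff * v_coeff * L (- 1) = of_nat p"
proof -
  have "v_coeff * v_coeff * L (- 1) * (s * s) = of_nat p * (of_nat p * L (- 1))"
    using s_nonzero by (simp add: v_coeff_def)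
  also have "\<dots> = of_nat p * (s * s)" by (simp add: s_s mult.commute)
  finally show ?thesis using s_nonzero by simp
qed

lemma v_coeff_nonzero: "v_coeff \<noteq> 0"
  using s_nonzero p_gt2 by (simp add: v_coeff_def)

text \<open>The product of \<open>u_comb a\<close> and \<open>u_comb b\<close> vanishes when a and b
  are the two roots of X^2 + (p - 1) X - p for trivial \<eta>, or of X^2 - s^2 for the quadratic
  character. The roots are 1 and -p, respectively s and -s.\<close>

definition u1_coeff :: complex where "u1_coeff = (if \<eta> = triv_char then 1 else s)"
definition u2_coeff :: complex where "u2_coeff = (if \<eta> = triv_char then - of_nat p else - s)"
text \<open>This is p^(n-1) times the difference of the two roots, which explains why the second
  eigenvalue is its negative.\<close>

definition u_eigenvalue :: complex where
  "u_eigenvalue = (if \<eta> = triv_char then of_nat p ^ (n - 1) * (of_nat p + 1) else 2 * s * of_nat p ^ (n - 1))"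

lemma P_minus1: "P (- 1) = (if \<eta> = triv_char then 1 else L (- 1))"
  using p_gt2 by (simp add: P_def)

lemma u1_coeff_facts:
  "u_comb u1_coeff \<star> u_comb u1_coeff = u_eigenvalue *\<^sub>f u_comb u1_coeff" "u_comb u2_coeff \<star> u_comb u2_coeff = (- u_eigenvalue) *\<^sub>f u_comb u2_coeff"
  "u_comb u1_coeff \<star> u_comb u2_coeff = 0" "u_comb u2_coeff \<star> u_comb u1_coeff = 0"
proof -
  define N :: complex where "N = of_nat p ^ (n - 1)"
  define D :: complex where "D = (if \<eta> = triv_char then N * (of_nat p - 1) else 0)"
  have mult: "u_comb a \<star> u_comb b = (D + (a + b) * N) *\<^sub>f Uf + (N * (P (- 1) * of_nat p + a * b)) *\<^sub>f Yf 1" for a b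
    unfolding u_comb_u_comb D_def N_def ..
  have \<kappa>N: "u_eigenvalue = (if \<eta> = triv_char then N * (of_nat p + 1) else 2 * s * N)"
    by (simp add: u_eigenvalue_def N_def)
  have ss: "s * (s * x) = L (- 1) * of_nat p * x" for x
    by (simp add: s_s flip: mult.assoc)
  have 1: "D + (u1_coeff + u1_coeff) * N = u_eigenvalue" "N * (P (- 1) * of_nat p + u1_coeff * u1_coeff) = u_eigenvalue * u1_coeff"
    by (simp_all add: D_def u1_coeff_def \<kappa>N P_minus1 s_s ss algebra_simps)
  have 2: "D + (u2_coeff + u2_coeff) * N = - u_eigenvalue" "N * (P (- 1) * of_nat p + u2_coeff * u2_coeff) = - u_eigenvalue * u2_coeff"
    by (simp_all add: D_def u2_coeff_def \<kappa>N P_minus1 s_s ss algebra_simps)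
  have 3: "D + (u1_coeff + u2_coeff) * N = 0" "P (- 1) * of_nat p + u1_coeff * u2_coeff = 0"
    by (simp_all add: D_def u1_coeff_def u2_coeff_def P_minus1 s_s algebra_simps)
  show "u_comb u1_coeff \<star> u_comb u1_coeff = u_eigenvalue *\<^sub>f u_comb u1_coeff"
    unfolding mult 1 unfolding u_comb_def by (rule ext) (simp add: fscale_def algebra_simps)
  show "u_comb u2_coeff \<star> u_comb u2_coeff = (- u_eigenvalue) *\<^sub>f u_comb u2_coeff"
    unfolding mult 2 unfolding u_comb_def by (rule ext) (simp add: fscale_def algebra_simps)
  show "u_comb u1_coeff \<star> u_comb u2_coeff = 0" unfolding mult 3 by simp
  show "u_comb u2_coeff \<star> u_comb u1_coeff = 0" unfolding mult add.commute[of u2_coeff] mult.commute[of u2_coeff] 3 by simp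
qed

lemma v_comb_facts:
  assumes k: "1 \<le> k" "k < n"
  shows "v_comb v_coeff k \<star> v_comb v_coeff k = (2 * of_nat p ^ (n - k)) *\<^sub>f v_comb v_coeff k"
    "v_comb (- v_coeff) k \<star> v_comb (- v_coeff) k = (2 * of_nat p ^ (n - k)) *\<^sub>f v_comb (- v_coeff) k"
    "v_comb v_coeff k \<star> v_comb (- v_coeff) k = 0" "v_comb (- v_coeff) k \<star> v_comb v_coeff k = 0"
proof -
  define N :: complex where "N = of_nat p ^ (n - k - 1)"
  have pN: "of_nat p ^ (n - k) = of_nat p * N"
    using k by (simp add: N_def flip: power_Suc) (simp add: Suc_diff_Suc)
  have mult: "v_comb c k \<star> v_comb c' k = (N * (of_nat p + c * c' * L (- 1))) *\<^sub>f
      (of_nat p *\<^sub>f Yf (k + 1) - Yf k) + (of_nat p * N * (c + c')) *\<^sub>f Wf k" for c c'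
    unfolding v_comb_v_comb[OF k] pN N_def ..
  have q: "v_coeff * v_coeff * L (- 1) = of_nat p" "(- v_coeff) * (- v_coeff) * L (- 1) = of_nat p"
    "v_coeff * (- v_coeff) * L (- 1) = - of_nat p" "(- v_coeff) * v_coeff * L (- 1) = - of_nat p"
    using v_coeff_v_coeff by simp_all
  show "v_comb v_coeff k \<star> v_comb v_coeff k = (2 * of_nat p ^ (n - k)) *\<^sub>f v_comb v_coeff k"
    "v_comb (- v_coeff) k \<star> v_comb (- v_coeff) k = (2 * of_nat p ^ (n - k)) *\<^sub>f v_comb (- v_coeff) k"
    "v_comb v_coeff k \<star> v_comb (- v_coeff) k = 0" "v_comb (- v_coeff) k \<star> v_comb v_coeff k = 0"
    unfolding mult q unfolding pN v_comb_def by (rule ext; simp add: fscale_def algebra_simps)+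
qed

section \<open>The complete orthogonal system\<close>

fun idem_vec :: "summand \<Rightarrow> padic mat2 \<times> int \<Rightarrow> complex" where
  "idem_vec S\<^sub>1 = u_comb u1_coeff"
| "idem_vec S\<^sub>2 = u_comb u2_coeff"
| "idem_vec (T k) = v_comb v_coeff k"
| "idem_vec (T' k) = v_comb (- v_coeff) k"

fun eigenvalue :: "summand \<Rightarrow> complex" where
  "eigenvalue S\<^sub>1 = u_eigenvalue"
| "eigenvalue S\<^sub>2 = - u_eigenvalue"
| "eigenvalue (T k) = 2 * of_nat p ^ (n - k)"
| "eigenvalue (T' k) = 2 * of_nat p ^ (n - k)"

lemma summand_vec_eq: 
  assumes "j \<in> summands n"
  shows "summand_vec p n \<eta> l s j = idem_vec j"
  using assms
proof (cases rule: summands_cases)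
  case 1
  have "1 \<le> n" using n_ge by simp
  then show ?thesis
    unfolding 1 summand_vec.simps idem_vec.simps u1_vec_def u_comb_def u1_coeff_def U0_elt_eq Y_elt_eq[OF order.refl \<open>1 \<le> n\<close>]
    by simp
next
  case 2
  have "1 \<le> n" using n_ge by simp
  then show ?thesis
    unfolding 2 summand_vec.simps idem_vec.simps u2_vec_def u_comb_def u2_coeff_def U0_elt_eq Y_elt_eq[OF order.refl \<open>1 \<le> n\<close>]
    by simp
next
  case (3 k)
  then show ?thesis by (simp add: v_vec_def Y_elt_eq W_elt_eq v_comb_def v_coeff_def)
next
  case (4 k)
  then show ?thesis by (simp add: v'_vec_def Y_elt_eq W_elt_eq v_comb_def v_coeff_def)
qed

lemma idem_vec_Hecke: "j \<in> summands n \<Longrightarrow> idem_vec j \<in> H.Hecke_space"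
  by (erule summands_cases) (auto intro: v_comb_Hecke u_comb_Hecke)

lemma eigenvalue_nonzero: "eigenvalue j \<noteq> 0"
proof -
  have "of_nat p + 1 \<noteq> (0::complex)" by (metis of_nat_1 of_nat_add of_nat_eq_0_iff add_is_0 one_neq_zero)
  then show ?thesis using p_gt2 s_nonzero by (cases j) (auto simp: u_eigenvalue_def)
qed

lemma idem_vec_idem: "j \<in> summands n \<Longrightarrow> idem_vec j \<star> idem_vec j = eigenvalue j *\<^sub>f idem_vec j"
  by (erule summands_cases) (simp_all add: u1_coeff_facts v_comb_facts)

lemma v_comb_orth_neq:
  assumes "1 \<le> j" "j < n" "1 \<le> k" "k < n" "j \<noteq> k"
  shows "v_comb c j \<star> v_comb c' k = 0"
  using assms v_comb_orth_less[of j k] v_comb_orth_less[of k j] by (cases "j < k") auto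

lemma idem_vec_orth:
  assumes "i \<in> summands n" "j \<in> summands n" "i \<noteq> j"
  shows "idem_vec i \<star> idem_vec j = 0"
  using assms(1)
proof (cases rule: summands_cases)
  case 1
  from assms(2) show ?thesis
    by (cases rule: summands_cases) (use 1 assms(3) u1_coeff_facts u_comb_v_comb_orth in simp_all)
next
  case 2
  from assms(2) show ?thesis
    by (cases rule: summands_cases) (use 2 assms(3) u1_coeff_facts u_comb_v_comb_orth in simp_all)
next
  case i: (3 r)
  from assms(2) show ?thesis
  proof (cases rule: summands_cases)
    case (4 k)
    then show ?thesis using i v_comb_orth_neq v_comb_facts by (cases "r = k") simp_all
  qed (use i assms(3) u_comb_v_comb_orth v_comb_orth_neq in simp_all)
next
  case i: (4 r)
  from assms(2) show ?thesis
  proof (cases rule: summands_cases)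
    case (3 k)
    then show ?thesis using i v_comb_orth_neq v_comb_facts by (cases "r = k") simp_all
  qed (use i assms(3) u_comb_v_comb_orth v_comb_orth_neq in simp_all)
qed

lemma sum_summands:
  fixes f :: "summand \<Rightarrow> 'b::comm_monoid_add"
  shows "(\<Sum>j\<in>summands n. f j) = f S\<^sub>1 + f S\<^sub>2 + (\<Sum>k\<in>{1..<n}. f (T k) + f (T' k))"
proof -
  have eq: "{1..n - 1} = {1..<n}" using n_ge by auto
  have "(\<Sum>j\<in>summands n. f j) = (\<Sum>j\<in>{S\<^sub>1, S\<^sub>2} \<union> T ` {1..<n}. f j) + (\<Sum>j\<in>T' ` {1..<n}. f j)"
    unfolding summands_def eq by (rule sum.union_disjoint) auto
  also have "(\<Sum>j\<in>{S\<^sub>1, S\<^sub>2} \<union> T ` {1..<n}. f j) = (\<Sum>j\<in>{S\<^sub>1, S\<^sub>2}. f j) + (\<Sum>j\<in>T ` {1..<n}. f j)"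
    by (rule sum.union_disjoint) auto
  finally show ?thesis by (simp add: sum.reindex inj_on_def sum.distrib add.assoc)
qed

lemma card_summands: "card (summands n) = 2 * n"
  using sum_summands[of "\<lambda>_. 1::nat"] n_ge by simp

lemma Hecke_unit_eq: "H.Hecke_unit = Yf n"
proof
  fix g
  show "H.Hecke_unit g = Yf n g"
    by (auto simp: H.Hecke_unit_def Yf_def row_fun_def FY_def genuine_char_eq Q_iff)
qed

text \<open>With E k = Y_k / p^(n-k), the pair at k contributes E (k+1) - E k and the first pair
  contributes E 1. The sum telescopes to E n = Y_n, the identity of the Hecke algebra.\<close>

lemma idem_vec_unit: "(\<Sum>j\<in>summands n. (1 / eigenvalue j) *\<^sub>f idem_vec j) = H.Hecke_unit"
proof -
  define E where "E = (\<lambda>k. (1 / of_nat p ^ (n - k)) *\<^sub>f Yf k)"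
  have T: "(1 / eigenvalue (T k)) *\<^sub>f idem_vec (T k) + (1 / eigenvalue (T' k)) *\<^sub>f idem_vec (T' k) = E (Suc k) - E k"
    if "k \<in> {1..<n}" for k
  proof -
    have "of_nat p ^ (n - k) = of_nat p * (of_nat p ^ (n - Suc k) :: complex)"
      using that by (simp flip: power_Suc add: Suc_diff_Suc)
    then show ?thesis using p_gt2
      by (intro ext) (simp add: E_def v_comb_def fscale_def field_simps)
  qed
  have S: "(1 / eigenvalue S\<^sub>1) *\<^sub>f idem_vec S\<^sub>1 + (1 / eigenvalue S\<^sub>2) *\<^sub>f idem_vec S\<^sub>2 = E 1"
  proof -
    have "(u1_coeff - u2_coeff) / u_eigenvalue = 1 / of_nat p ^ (n - 1)"
    proof -
      have "of_nat p ^ (n - 1) * (u1_coeff - u2_coeff) = u_eigenvalue"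
        by (simp add: u1_coeff_def u2_coeff_def u_eigenvalue_def)
      then show ?thesis using eigenvalue_nonzero[of S\<^sub>1] p_gt2 by (simp add: field_simps)
    qed
    then have "E 1 = ((u1_coeff - u2_coeff) / u_eigenvalue) *\<^sub>f Yf 1" by (simp add: E_def)
    also have "\<dots> = (1 / eigenvalue S\<^sub>1) *\<^sub>f idem_vec S\<^sub>1 + (1 / eigenvalue S\<^sub>2) *\<^sub>f idem_vec S\<^sub>2"
      by (rule ext) (simp add: u_comb_def fscale_def algebra_simps diff_divide_distrib)
    finally show ?thesis by simp
  qed
  have "(\<Sum>j\<in>summands n. (1 / eigenvalue j) *\<^sub>f idem_vec j) = E 1 + (\<Sum>k\<in>{1..<n}. E (Suc k) - E k)"
    unfolding sum_summands S using T by (intro arg_cong2[where f = "(+)"] refl sum.cong)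
  also have "\<dots> = E n" using n_ge by (simp add: sum_Suc_diff')
  also have "\<dots> = Yf n" by (simp add: E_def)
  finally show ?thesis by (simp add: Hecke_unit_eq)
qed

text \<open>The first pair gives Y_1 and then U_0, the difference of each later pair gives W_k, and
  Y_(k+1) follows from Y_k, W_k and v_k by induction. Together these generate the double coset
  basis.\<close>

lemma idem_vec_span: "H.Hecke_space \<subseteq> fvs.span (idem_vec ` summands n)"
proof -
  let ?S = "fvs.span (idem_vec ` summands n)"
  have e: "idem_vec j \<in> ?S" if "j \<in> summands n" for j using that by (intro fvs.span_base imageI)
  have S12: "u_comb u1_coeff \<in> ?S" "u_comb u2_coeff \<in> ?S" using e[of S\<^sub>1] e[of S\<^sub>2] by (simp_all add: summands_def)
  have "of_nat p ^ (n - 1) * (u1_coeff - u2_coeff) = u_eigenvalue" by (simp add: u1_coeff_def u2_coeff_def u_eigenvalue_def)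
  then have "u1_coeff - u2_coeff \<noteq> 0" using eigenvalue_nonzero[of S\<^sub>1] by auto
  then have "Yf 1 = (1 / (u1_coeff - u2_coeff)) *\<^sub>f (u_comb u1_coeff - u_comb u2_coeff)"
    by (intro ext) (simp add: u_comb_def fscale_def field_simps)
  then have Y1: "Yf 1 \<in> ?S" using S12 by (metis fvs.span_diff fvs.span_scale)
  have "Uf = u_comb u1_coeff - u1_coeff *\<^sub>f Yf 1" by (simp add: u_comb_def)
  then have U: "Uf \<in> ?S" using S12 Y1 by (metis fvs.span_diff fvs.span_scale)
  have vk: "v_comb v_coeff k \<in> ?S" "v_comb (- v_coeff) k \<in> ?S" if "1 \<le> k" "k < n" for k
    using e[of "T k"] e[of "T' k"] that by (auto simp: summands_def)
  have W: "Wf k \<in> ?S" if "1 \<le> k" "k < n" for k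
  proof -
    have "Wf k = (1 / (2 * v_coeff)) *\<^sub>f (v_comb v_coeff k - v_comb (- v_coeff) k)"
      using v_coeff_nonzero by (intro ext) (simp add: v_comb_def fscale_def field_simps)
    then show ?thesis using vk[OF that] by (metis fvs.span_diff fvs.span_scale)
  qed
  have Y: "Yf (Suc k) \<in> ?S" if "k < n" for k
    using that
  proof (induction k)
    case 0
    then show ?case using Y1 by simp
  next
    case (Suc k)
    have "Yf (Suc (Suc k)) = (1 / of_nat p) *\<^sub>f (Yf (Suc k) + (v_comb v_coeff (Suc k) - v_coeff *\<^sub>f Wf (Suc k)))"
      using p_gt2 by (intro ext) (simp add: v_comb_def fscale_def)
    moreover have "Yf (Suc k) \<in> ?S" "v_comb v_coeff (Suc k) \<in> ?S" "Wf (Suc k) \<in> ?S"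
      using Suc vk[of "Suc k"] W[of "Suc k"] by auto
    ultimately show ?case by (metis fvs.span_add fvs.span_diff fvs.span_scale)
  qed
  have "basis_elt j \<in> ?S" if "j \<in> summands n" for j
    using that
  proof (cases rule: summands_cases)
    case 1
    then show ?thesis using Y[of "n - 1"] n_ge by simp
  next
    case 2
    then show ?thesis using U by simp
  next
    case (3 r)
    then show ?thesis using Y[of "r - 1"] Y[of r] W[of r]
      by (auto simp: V_sign_def intro!: fvs.span_scale fvs.span_add fvs.span_diff)
  next
    case (4 r)
    then show ?thesis using Y[of "r - 1"] Y[of r] W[of r]
      by (auto simp: V_sign_def intro!: fvs.span_scale fvs.span_add fvs.span_diff)
  qed
  then have "fvs.span (basis_elt ` summands n) \<subseteq> ?S" by (intro fvs.span_minimal) auto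
  then show ?thesis using Hecke_space_span by blast
qed

section \<open>Values at the identity and dimensions\<close>

lemma row_fun_one:
  assumes "\<And>c c' d d'. [c = c'] (mod int p ^ n) \<Longrightarrow> [d = d'] (mod int p ^ n) \<Longrightarrow> F c d = F c' d'"
  shows "row_fun F \<one>\<^bsub>G\<^esub> = F 0 1"
  unfolding int_mat_one by (rule row_fun_at[OF assms]) (auto intro: int_mat_closed int_mat_ent)

lemma Yf_one: "1 \<le> r \<Longrightarrow> r \<le> n \<Longrightarrow> Yf r \<one>\<^bsub>G\<^esub> = 1"
  using row_fun_one[of "FY r"] FY_cong_n by (simp add: Yf_def FY_def)

lemma Wf_one: "1 \<le> r \<Longrightarrow> r < n \<Longrightarrow> Wf r \<one>\<^bsub>G\<^esub> = 0"
  using row_fun_one[of "FW r"] FW_cong_n L_zero_iff[of 0] by (simp add: Wf_def FW_def)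

lemma Uf_one: "Uf \<one>\<^bsub>G\<^esub> = 0"
  using row_fun_one[of FU] FU_cong[OF cong_p] by (simp add: Uf_def FU_def P_def)

lemma v_comb_one: "1 \<le> k \<Longrightarrow> k < n \<Longrightarrow> v_comb c k \<one>\<^bsub>G\<^esub> = of_nat p - 1"
  by (simp add: v_comb_def fscale_def Yf_one Wf_one)

lemma u_comb_one: "u_comb a \<one>\<^bsub>G\<^esub> = a"
  using n_ge by (simp add: u_comb_def fscale_def Yf_one Uf_one)

text \<open>The value at the identity, which also determines the dimension, is p - 1 or one of the
  nonzero roots.\<close>

lemma idem_vec_nonzero:
  assumes "j \<in> summands n"
  shows "idem_vec j \<noteq> 0"
proof -
  have p1: "of_nat p - 1 \<noteq> (0::complex)" using p_gt2 by auto
  have u: "u1_coeff \<noteq> 0" "u2_coeff \<noteq> 0" using s_nonzero p_gt2 by (auto simp: u1_coeff_def u2_coeff_def)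
  from assms have "idem_vec j \<one>\<^bsub>G\<^esub> \<noteq> 0"
    by (cases rule: summands_cases) (simp_all only: idem_vec.simps v_comb_one u_comb_one p1 u not_False_eq_True)
  then show ?thesis by auto
qed

lemma summand_space_eq: "j \<in> summands n \<Longrightarrow> summand_space p n \<eta> l s j = generated_rep G (idem_vec j)"
  by (simp add: summand_space_def summand_vec_eq)

lemma summands_finite: "finite (summands n)"
  by (simp add: summands_def)

lemma dim_summand:
  assumes "j \<in> summands n"
  shows "of_nat (fvs.dim (summand_space p n \<eta> l s j))
    = of_nat p ^ (n - 1) * (of_nat p + 1) * idem_vec j \<one>\<^bsub>G\<^esub> / eigenvalue j"
proof -
  have "p ^ n = p * p ^ (n - 1)" using n_ge by (simp flip: power_Suc)
  then have "of_nat (card coset_reps) = (of_nat p ^ (n - 1) * (of_nat p + 1) :: complex)"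
    by (simp add: card_coset_reps algebra_simps)
  then show ?thesis
    using H.dim_generated[OF idem_vec_Hecke[OF assms] idem_vec_idem[OF assms] eigenvalue_nonzero]
    by (simp add: summand_space_eq[OF assms])
qed

lemma dim_T:
  assumes k: "1 \<le> k" "k < n" and j: "j = T k \<or> j = T' k"
  shows "fvs.dim (summand_space p n \<eta> l s j) = p ^ (k - 1) * ((p\<^sup>2 - 1) div 2)"
proof -
  let ?d = "fvs.dim (summand_space p n \<eta> l s j)"
  have jS: "j \<in> summands n" using k j by (auto simp: summands_def)
  have "n - 1 = (k - 1) + (n - k)" using k by simp
  then have pow: "of_nat p ^ (n - 1) = (of_nat p ^ (k - 1) * of_nat p ^ (n - k) :: complex)"
    by (metis power_add)
  have ev: "idem_vec j \<one>\<^bsub>G\<^esub> = of_nat p - 1" "eigenvalue j = 2 * of_nat p ^ (n - k)"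
    using j k by (auto simp: v_comb_one)
  have "of_nat ?d = of_nat p ^ (k - 1) * (of_nat p + 1) * (of_nat p - 1 :: complex) / 2"
    unfolding dim_summand[OF jS] ev pow using p_gt2 by simp
  \<comment> \<open>Doubling clears the denominator, so that the complex identity descends to
    natural numbers; p odd makes the division by 2 exact.\<close>
  then have "of_nat (2 * ?d) = (of_nat p ^ (k - 1) * (of_nat p ^ 2 - 1) :: complex)"
    by (simp add: algebra_simps power2_eq_square)
  also have "\<dots> = of_nat (p ^ (k - 1) * (p\<^sup>2 - 1))"
    using p_gt2 by (simp add: of_nat_diff)
  finally have "2 * ?d = p ^ (k - 1) * (p\<^sup>2 - 1)" by (simp only: of_nat_eq_iff)
  moreover have "2 * ((p\<^sup>2 - 1) div 2) = p\<^sup>2 - 1" using p_odd by simp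
  ultimately have "2 * ?d = 2 * (p ^ (k - 1) * ((p\<^sup>2 - 1) div 2))" by (simp add: mult.left_commute)
  then show ?thesis by simp
qed

text \<open>The index of \<open>K0bar p n\<close> and the eigenvalues share the factor p^(n-1), so
  these two dimensions do not depend on n.\<close>

lemma dim_S:
  shows "\<eta> = triv_char \<Longrightarrow> fvs.dim (summand_space p n \<eta> l s S\<^sub>1) = 1"
    and "\<eta> = triv_char \<Longrightarrow> fvs.dim (summand_space p n \<eta> l s S\<^sub>2) = p"
    and "\<eta> \<noteq> triv_char \<Longrightarrow> fvs.dim (summand_space p n \<eta> l s S\<^sub>1) = (p + 1) div 2"
    and "\<eta> \<noteq> triv_char \<Longrightarrow> fvs.dim (summand_space p n \<eta> l s S\<^sub>2) = (p + 1) div 2"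
proof -
  have S: "S\<^sub>1 \<in> summands n" "S\<^sub>2 \<in> summands n" by (simp_all add: summands_def)
  let ?N = "of_nat p ^ (n - 1) * (of_nat p + 1) :: complex"
  have d1: "of_nat (fvs.dim (summand_space p n \<eta> l s S\<^sub>1)) = ?N * u1_coeff / u_eigenvalue"
    and d2: "of_nat (fvs.dim (summand_space p n \<eta> l s S\<^sub>2)) = ?N * u2_coeff / - u_eigenvalue"
    using dim_summand[OF S(1)] dim_summand[OF S(2)] by (simp_all add: u_comb_one)
  have N0: "?N \<noteq> 0" "of_nat p \<noteq> (0::complex)"
    using p_gt2 by (simp_all, metis of_nat_1 of_nat_add of_nat_eq_0_iff add_is_0 one_neq_zero)
  {
    assume \<eta>: "\<eta> = triv_char"
    have "?N * u1_coeff / u_eigenvalue = 1" "?N * u2_coeff / - u_eigenvalue = of_nat p"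
      using N0 unfolding u1_coeff_def u2_coeff_def u_eigenvalue_def if_P[OF \<eta>] by simp_all
    then have "of_nat (fvs.dim (summand_space p n \<eta> l s S\<^sub>1)) = (of_nat 1 :: complex)"
      "of_nat (fvs.dim (summand_space p n \<eta> l s S\<^sub>2)) = (of_nat p :: complex)"
      using d1 d2 by simp_all
    then show "fvs.dim (summand_space p n \<eta> l s S\<^sub>1) = 1" "fvs.dim (summand_space p n \<eta> l s S\<^sub>2) = p"
      by (simp_all only: of_nat_eq_iff)
  }
  {
    assume \<eta>: "\<eta> \<noteq> triv_char"
    have e: "?N * u1_coeff / u_eigenvalue = (of_nat p + 1) / 2" "?N * u2_coeff / - u_eigenvalue = (of_nat p + 1) / 2"
      using N0 s_nonzero unfolding u1_coeff_def u2_coeff_def u_eigenvalue_def if_not_P[OF \<eta>] by (simp_all add: field_simps)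
    have "of_nat (2 * fvs.dim (summand_space p n \<eta> l s S\<^sub>1)) = (of_nat (p + 1) :: complex)"
      "of_nat (2 * fvs.dim (summand_space p n \<eta> l s S\<^sub>2)) = (of_nat (p + 1) :: complex)"
      unfolding of_nat_mult d1 d2 e by simp_all
    then have "2 * fvs.dim (summand_space p n \<eta> l s S\<^sub>1) = p + 1"
      "2 * fvs.dim (summand_space p n \<eta> l s S\<^sub>2) = p + 1"
      by (simp_all only: of_nat_eq_iff)
    then show "fvs.dim (summand_space p n \<eta> l s S\<^sub>1) = (p + 1) div 2"
      "fvs.dim (summand_space p n \<eta> l s S\<^sub>2) = (p + 1) div 2" by simp_all
  }
qed

lemma direct_sum: "internal_direct_sum (Ind_rep p n \<eta>) (summands n) (summand_space p n \<eta> l s)"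
proof -
  have "internal_direct_sum H.Ind (summands n) (\<lambda>j. generated_rep G (idem_vec j))"
    by (rule H.internal_direct_sum_generated[OF summands_finite idem_vec_Hecke eigenvalue_nonzero idem_vec_idem
          idem_vec_orth idem_vec_unit])
  moreover have "(\<Pi>\<^sub>E j\<in>summands n. generated_rep G (idem_vec j)) = (\<Pi>\<^sub>E j\<in>summands n. summand_space p n \<eta> l s j)"
    by (rule PiE_cong) (simp add: summand_space_eq)
  ultimately show ?thesis
    unfolding internal_direct_sum_def Ind_rep_eq by (simp add: summand_space_eq)
qed

lemma irreducible_summand:
  "j \<in> summands n \<Longrightarrow> irreducible_rep G (summand_space p n \<eta> l s j)"
  unfolding summand_space_eq
  by (rule H.irreducible_generated[OF summands_finite idem_vec_Hecke eigenvalue_nonzero idem_vec_idem idem_vec_orth _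
        idem_vec_nonzero idem_vec_span])

end

theorem corollary3p10:
  fixes p n :: nat and \<eta> :: "padic \<Rightarrow> complex" and l :: padic and s :: complex
  assumes "Factorial_Ring.prime p" and "odd p" and "n \<ge> 2"
    and "\<eta> = triv_char \<or> \<eta> = legendre_char p"
    and "l \<in> Units (Zp p)" and "\<not> QuadRes (int p) (l 1)"
    and "s\<^sup>2 = of_int (p_star p)"
  shows "subrepresentation (Kbar p) (Ind_rep p n \<eta>)
    \<and> card (summands n) = 2 * n
    \<and> internal_direct_sum (Ind_rep p n \<eta>) (summands n) (summand_space p n \<eta> l s)
    \<and> (\<forall>j\<in>summands n. irreducible_rep (Kbar p) (summand_space p n \<eta> l s j))
    \<and> (\<forall>k\<in>{1..n-1}.
         fvs.dim (summand_space p n \<eta> l s (T k)) = p ^ (k - 1) * ((p\<^sup>2 - 1) div 2)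
       \<and> fvs.dim (summand_space p n \<eta> l s (T' k)) = p ^ (k - 1) * ((p\<^sup>2 - 1) div 2))
    \<and> (\<eta> = triv_char \<longrightarrow>
         fvs.dim (summand_space p n \<eta> l s S\<^sub>1) = 1
       \<and> fvs.dim (summand_space p n \<eta> l s S\<^sub>2) = p)
    \<and> (\<eta> = legendre_char p \<longrightarrow>
         fvs.dim (summand_space p n \<eta> l s S\<^sub>1) = (p + 1) div 2
       \<and> fvs.dim (summand_space p n \<eta> l s S\<^sub>2) = (p + 1) div 2)"
proof -
  interpret metaplectic_data p n \<eta> l s using assms by unfold_locales
  show ?thesis
  proof (intro conjI ballI impI)
    show "subrepresentation (Kbar p) (Ind_rep p n \<eta>)"
      unfolding Ind_rep_eq by (rule H.Ind_subrepresentation)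
    show "card (summands n) = 2 * n" by (rule card_summands)
    show "internal_direct_sum (Ind_rep p n \<eta>) (summands n) (summand_space p n \<eta> l s)" by (rule direct_sum)
    show "irreducible_rep (Kbar p) (summand_space p n \<eta> l s j)" if "j \<in> summands n" for j
      by (rule irreducible_summand[OF that])
    fix k assume "k \<in> {1..n-1}"
    then have k: "1 \<le> k" "k < n" using assms(3) by auto
    show "fvs.dim (summand_space p n \<eta> l s (T k)) = p ^ (k - 1) * ((p\<^sup>2 - 1) div 2)"
      "fvs.dim (summand_space p n \<eta> l s (T' k)) = p ^ (k - 1) * ((p\<^sup>2 - 1) div 2)"
      using dim_T[OF k] by auto
  next
    assume "\<eta> = triv_char"
    then show "fvs.dim (summand_space p n \<eta> l s S\<^sub>1) = 1" "fvs.dim (summand_space p n \<eta> l s S\<^sub>2) = p"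
      by (rule dim_S(1), rule dim_S(2))
  next
    assume "\<eta> = legendre_char p"
    then have "\<eta> \<noteq> triv_char" using legendre_char_neq by simp
    then show "fvs.dim (summand_space p n \<eta> l s S\<^sub>1) = (p + 1) div 2"
      "fvs.dim (summand_space p n \<eta> l s S\<^sub>2) = (p + 1) div 2"
      by (rule dim_S(3), rule dim_S(4))
  qed
qed

end
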